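(* Let $\sigma=\{\pi_i \mid i\in I\}$ be a partition of the set of all primes into mutually disjoint subsets, let $G$ be a finite group and let $H$ be a $\sigma$-nilpotent subgroup of $G$. Then: (1) If $H$ is $\sigma^{(i)}$-permutable in $G$ for some $i\in\{1,2,3\}$, then $H$ is $\sigma^{(i)}$-permutable in $G$ for all $i\in\{1,2,3\}$. (2) $H$ is $\sigma^{(3)}$-permutable in $G$ if and only if, for all $\pi_i\in\sigma$, every Hall $\pi_i$-subgroup of $H$ is $\sigma^{(3)}$-permutable in $G$.
   Context: All groups are finite. $\sigma=\{\pi_i \mid i\in I\}$ is a partition of the set $\mathbb{P}$ of all primes: $\pi_i\cap\pi_j=\emptyset$ for $i\neq j$ and $\bigcup_{i\in I}\pi_i=\mathbb{P}$. A subgroup $H$ of $G$ permutes with a subgroup $K$ of $G$ if $HK$ is a subgroup of $G$ (equivalently $HK=KH$). We write $P^x=x^{-1}Px$. For a set of primes $\pi$, a $\pi$-maximal subgroup of $G$ is a $\pi$-subgroup of $G$ not properly contained in any other $\pi$-subgroup of $G$. For a set of primes $\pi$, $\mathfrak{G}_\pi$ denotes the class of all finite $\pi$-groups. A subgroup $P$ of $G$ is a $\mathfrak{G}_\pi$-projector of $G$ if, for every normal subgroup $N$ of $G$, $PN/N$ is $\mathfrak{G}_\pi$-maximal in $G/N$, i.e. $PN/N$ is a $\pi$-maximal subgroup of $G/N$. (Such projectors exist in every finite group.) A subgroup $H$ of $G$ is called $\sigma^{(1)}$-permutable if for every $\pi_i\in\sigma$ it permutes with every $\pi_i$-maximal subgroup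 of $G$. A subgroup $H$ of $G$ is called $\sigma^{(2)}$-permutable if for every $\pi_i\in\sigma$ it permutes with every $\mathfrak{G}_{\pi_i}$-projector of $G$. A subgroup $H$ of $G$ is called $\sigma^{(3)}$-permutable if for every $\pi_i\in\sigma$ there is a $\mathfrak{G}_{\pi_i}$-projector $P$ of $G$ such that $HP^x=P^xH$ for all $x\in G$. A group is called $\sigma$-nilpotent if it is the direct product of its Hall $\pi_i$-subgroups for all $\pi_i\in\sigma$. *)

theory Defs
  imports
    "HOL-Algebra.Generated_Groups"
    "HOL-Computational_Algebra.Primes"
    "HOL-Library.Disjoint_Sets"
begin

text \<open>Every predicate on subgroups takes the ambient group as an argument; a subgroup \<open>H\<close> of \<open>G\<close>
  is itself a group as \<open>G\<lparr>carrier := H\<rparr>\<close>.\<close>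

definition partition_of_primes :: "nat set set \<Rightarrow> bool" where
  "partition_of_primes \<sigma> \<longleftrightarrow> disjoint \<sigma> \<and> \<Union>\<sigma> = {p. prime p}"

definition pi_group :: "nat set \<Rightarrow> ('a, 'b) monoid_scheme \<Rightarrow> bool" where
  "pi_group \<pi> G \<longleftrightarrow>
     group G \<and> finite (carrier G) \<and> (\<forall>p. prime p \<and> p dvd order G \<longrightarrow> p \<in> \<pi>)"

definition pi_subgroup :: "nat set \<Rightarrow> ('a, 'b) monoid_scheme \<Rightarrow> 'a set \<Rightarrow> bool" where
  "pi_subgroup \<pi> G P \<longleftrightarrow> subgroup P G \<and> pi_group \<pi> (G\<lparr>carrier := P\<rparr>)"

definition pi_maximal :: "nat set \<Rightarrow> ('a, 'b) monoid_scheme \<Rightarrow> 'a set \<Rightarrow> bool" where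
  "pi_maximal \<pi> G P \<longleftrightarrow> pi_subgroup \<pi> G P \<and> \<not> (\<exists>Q. pi_subgroup \<pi> G Q \<and> P \<subset> Q)"

definition hall_subgroup :: "nat set \<Rightarrow> ('a, 'b) monoid_scheme \<Rightarrow> 'a set \<Rightarrow> bool" where
  "hall_subgroup \<pi> G P \<longleftrightarrow>
     pi_subgroup \<pi> G P \<and> (\<forall>p\<in>\<pi>. prime p \<longrightarrow> \<not> p dvd card (rcosets\<^bsub>G\<^esub> P))"

text \<open>The carrier of \<open>G\<lparr>carrier := P <#>\<^bsub>G\<^esub> N\<rparr> Mod N\<close> is the set \<open>PN/N\<close> of cosets, a subset of \<open>G/N\<close>.\<close>

definition pi_projector :: "nat set \<Rightarrow> ('a, 'b) monoid_scheme \<Rightarrow> 'a set \<Rightarrow> bool" where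
  "pi_projector \<pi> G P \<longleftrightarrow>
     subgroup P G \<and>
     (\<forall>N. N \<lhd> G \<longrightarrow> pi_maximal \<pi> (G Mod N) (carrier (G\<lparr>carrier := P <#>\<^bsub>G\<^esub> N\<rparr> Mod N)))"

definition permutes_with :: "('a, 'b) monoid_scheme \<Rightarrow> 'a set \<Rightarrow> 'a set \<Rightarrow> bool" where
  "permutes_with G H K \<longleftrightarrow> subgroup (H <#>\<^bsub>G\<^esub> K) G"

definition conjugate :: "('a, 'b) monoid_scheme \<Rightarrow> 'a set \<Rightarrow> 'a \<Rightarrow> 'a set" where
  "conjugate G P x = (inv\<^bsub>G\<^esub> x <#\<^bsub>G\<^esub> P) #>\<^bsub>G\<^esub> x"

definition sigma1_permutable :: "nat set set \<Rightarrow> ('a, 'b) monoid_scheme \<Rightarrow> 'a set \<Rightarrow> bool" where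
  "sigma1_permutable \<sigma> G H \<longleftrightarrow>
     subgroup H G \<and> (\<forall>\<pi>\<in>\<sigma>. \<forall>P. pi_maximal \<pi> G P \<longrightarrow> permutes_with G H P)"

definition sigma2_permutable :: "nat set set \<Rightarrow> ('a, 'b) monoid_scheme \<Rightarrow> 'a set \<Rightarrow> bool" where
  "sigma2_permutable \<sigma> G H \<longleftrightarrow>
     subgroup H G \<and> (\<forall>\<pi>\<in>\<sigma>. \<forall>P. pi_projector \<pi> G P \<longrightarrow> permutes_with G H P)"

definition sigma3_permutable :: "nat set set \<Rightarrow> ('a, 'b) monoid_scheme \<Rightarrow> 'a set \<Rightarrow> bool" where
  "sigma3_permutable \<sigma> G H \<longleftrightarrow>
     subgroup H G \<and>
     (\<forall>\<pi>\<in>\<sigma>. \<exists>P. pi_projector \<pi> G P \<and>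
        (\<forall>x\<in>carrier G. H <#>\<^bsub>G\<^esub> conjugate G P x = conjugate G P x <#>\<^bsub>G\<^esub> H))"

text \<open>Internal direct product of a family of subgroups. The index set may be infinite, but in a
  finite group only finitely many of the factors are then nontrivial.\<close>

definition internal_direct_product ::
    "('a, 'b) monoid_scheme \<Rightarrow> 'i set \<Rightarrow> ('i \<Rightarrow> 'a set) \<Rightarrow> bool" where
  "internal_direct_product G I A \<longleftrightarrow>
     (\<forall>i\<in>I. A i \<lhd> G) \<and>
     generate G (\<Union>i\<in>I. A i) = carrier G \<and>
     (\<forall>i\<in>I. A i \<inter> generate G (\<Union>j\<in>I - {i}. A j) = {\<one>\<^bsub>G\<^esub>})"

definition sigma_nilpotent :: "nat set set \<Rightarrow> ('a, 'b) monoid_scheme \<Rightarrow> bool" where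
  "sigma_nilpotent \<sigma> G \<longleftrightarrow>
     group G \<and> finite (carrier G) \<and>
     (\<exists>A. (\<forall>\<pi>\<in>\<sigma>. hall_subgroup \<pi> G (A \<pi>)) \<and> internal_direct_product G \<sigma> A)"

end

theory Submission
  imports Defs "HOL-Algebra.Sylow" "HOL-Algebra.Multiplicative_Group" "HOL-Algebra.Left_Coset"
begin

text \<open>A projector is \<open>\<pi>\<close>-maximal, so the first notion implies the second; projectors exist and their
conjugates are projectors, so the second implies the third. Everything else follows from one fact,
\<open>hall_part_in_normal_pi_subgroup\<close>: if \<open>H\<close> permutes with all conjugates of some \<open>\<pi>\<close>-projector for
every \<open>\<pi> \<in> \<sigma>\<close>, then each Hall part \<open>A\<^sub>\<pi>\<close> of \<open>H\<close> lies in a normal \<open>\<pi>\<close>-subgroup \<open>M\<close> of \<open>G\<close>.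

Granting this, \<open>A\<^sub>\<pi>\<close> lies in every \<open>\<pi>\<close>-maximal subgroup. For \<open>\<tau> \<noteq> \<pi>\<close> and a conjugate \<open>P\<close> of the
\<open>\<tau>\<close>-projector, \<open>V = HP \<inter> M\<close> is a \<open>\<pi>\<close>-group normal in \<open>HP\<close>; the index of \<open>H\<close> in \<open>HV\<close> divides both
\<open>|V|\<close> and \<open>|P|\<close>, so \<open>V \<subseteq> H\<close> and \<open>V = A\<^sub>\<pi>\<close>. Hence \<open>P\<close> normalises \<open>A\<^sub>\<pi>\<close>. The conjugates of a
\<open>\<tau>\<close>-projector generate a subgroup that contains all \<open>\<tau>\<close>-subgroups, so \<open>A\<^sub>\<pi>\<close> permutes with all of
those (\<open>sigma3_imp_hall_part_sigma1\<close>). So every Hall part satisfies the strongest notion, and with the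
parts so does the group \<open>H\<close> that they generate. The same argument with a Hall part in the role of
\<open>H\<close> turns the hypothesis on the parts into the conclusion on \<open>H\<close>.

The fact itself is proved by induction on \<open>|G|\<close>. Two nontrivial normal subgroups with trivial
intersection, or a nontrivial normal \<open>\<rho>\<close>-subgroup with \<open>\<rho> \<in> \<sigma>\<close>, let the induction hypothesis for the
quotients finish. What remains is a group in which a single minimal normal subgroup is a product of
nonabelian simple factors, each of order divisible by primes from at least two members of \<open>\<sigma>\<close>.
Let \<open>J\<close> be the product of \<open>H\<close> with the factors that \<open>H\<close> does not centralise. If \<open>J \<subseteq> HP\<close> for projectors
\<open>P\<close> belonging to two such members, the index of \<open>H\<close> in \<open>J\<close> is \<open>1\<close>, and \<open>H\<close> contains a
simple factor, which is impossible for a \<open>\<sigma>\<close>-nilpotent group. Otherwise an argument of Kegel applies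
(\<open>moved_hull_in_product\<close>): a largest \<open>B\<close> above a conjugate of \<open>P\<close> all of whose conjugates permute with
\<open>H\<close>, subject to \<open>J \<subseteq> HB\<close> being false, is normalised by \<open>J\<close>. Then \<open>B\<close> centralises a factor \<open>S\<close>, and
the conjugate of \<open>P\<close> is not \<open>\<pi>\<close>-maximal, as it can be enlarged by an element of \<open>S\<close>.

Existence of projectors (\<open>exists_projector\<close>) comes from composing projectors along a chain of normal
subgroups. The essential case is a normal subgroup \<open>N\<close> with \<open>G/N\<close> a \<open>\<pi>\<close>-group, where a
\<open>\<pi>\<close>-subgroup \<open>P\<close> with \<open>PN = G\<close> is needed; it is found with the Frattini argument and the abelian case
of the Schur--Zassenhaus theorem.\<close>

section \<open>Numbers with prescribed prime divisors\<close>

definition pi_number :: "nat set \<Rightarrow> nat \<Rightarrow> bool" where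
  "pi_number \<pi> n \<longleftrightarrow> n \<noteq> 0 \<and> (\<forall>p. prime p \<longrightarrow> p dvd n \<longrightarrow> p \<in> \<pi>)"

lemma pi_number_dvd: "pi_number \<pi> n \<Longrightarrow> m dvd n \<Longrightarrow> pi_number \<pi> m"
  unfolding pi_number_def by (metis dvd_0_left_iff dvd_trans)

lemma pi_number_mult: "pi_number \<pi> m \<Longrightarrow> pi_number \<pi> n \<Longrightarrow> pi_number \<pi> (m * n)"
  unfolding pi_number_def by (auto simp: prime_dvd_mult_iff)

lemma pi_number_one [simp]: "pi_number \<pi> 1"
  unfolding pi_number_def by auto

lemma pi_number_coprime:
  assumes "pi_number \<pi> m" "\<And>p. prime p \<Longrightarrow> p \<in> \<pi> \<Longrightarrow> \<not> p dvd n"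
  shows "coprime m n"
proof (rule ccontr)
  assume "\<not> coprime m n"
  then have "gcd m n \<noteq> 1" by (metis coprime_iff_gcd_eq_1)
  then obtain p where "prime p" "p dvd gcd m n" by (metis prime_factor_nat)
  then show False using assms unfolding pi_number_def by auto
qed

lemma pi_number_disjoint_coprime:
  assumes "pi_number \<pi> m" "pi_number \<tau> n" "\<pi> \<inter> \<tau> = {}"
  shows "coprime m n"
  using assms by (intro pi_number_coprime[of \<pi>]) (auto simp: pi_number_def disjoint_iff)

lemma prime_subgroup_pi_number:
  assumes "card V = p" "prime p" "p \<in> \<pi>" shows "pi_number \<pi> (card V)"
  using assms prime_gt_0_nat[OF assms(2)] primes_dvd_imp_eq unfolding pi_number_def by blast

lemma partition_disjoint: "partition_of_primes \<sigma> \<Longrightarrow> \<pi> \<in> \<sigma> \<Longrightarrow> \<tau> \<in> \<sigma> \<Longrightarrow> \<pi> \<noteq> \<tau> \<Longrightarrow> \<pi> \<inter> \<tau> = {}"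
  unfolding partition_of_primes_def disjoint_def by blast

lemma partition_cover: "partition_of_primes \<sigma> \<Longrightarrow> prime p \<Longrightarrow> \<exists>\<pi>\<in>\<sigma>. p \<in> \<pi>"
  unfolding partition_of_primes_def by blast

section \<open>Indices and products of subgroups\<close>

lemma card_by_fibres:
  assumes "finite A" "\<And>y. y \<in> f ` A \<Longrightarrow> card {x \<in> A. f x = y} = c"
  shows "card A = card (f ` A) * c"
proof -
  have "(\<Sum>y\<in>f ` A. \<Sum>x\<in>{x \<in> A. f x = y}. 1::nat) = (\<Sum>x\<in>A. 1)"
    using assms(1) by (intro sum.group) simp_all
  then show ?thesis using assms(2) by simp
qed

locale finite_group = group +
  assumes finite_carrier: "finite (carrier G)"

begin

text \<open>A relation between arbitrary subsets of \<open>G\<close>. Normality inside a subgroup \<open>E\<close> becomes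
\<open>normalises E N\<close>, and no change of the ambient group is needed.\<close>

definition normalises :: "'a set \<Rightarrow> 'a set \<Rightarrow> bool" where
  "normalises K B \<longleftrightarrow> (\<forall>k\<in>K. \<forall>b\<in>B. inv k \<otimes> b \<otimes> k \<in> B)"

abbreviation index :: "'a set \<Rightarrow> 'a set \<Rightarrow> nat" where
  "index M N \<equiv> card M div card N"

lemma cancel_inv [simp]:
  assumes "x \<in> carrier G" "y \<in> carrier G"
  shows "x \<otimes> (inv x \<otimes> y) = y" "inv x \<otimes> (x \<otimes> y) = y"
  using assms by (simp_all add: m_assoc[symmetric])

lemma subgroup_finite: "subgroup H G \<Longrightarrow> finite H"
  using finite_carrier finite_subset subgroup.subset by blast

lemma subgroup_card_pos: "subgroup H G \<Longrightarrow> card H > 0"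
  using subgroup_finite subgroup.one_closed by (metis card_gt_0_iff empty_iff)

lemma card_gt_one:
  assumes "subgroup S G" "S \<noteq> {\<one>}" shows "card S > 1"
  using assms subgroup_card_pos[OF assms(1)] subgroup.one_closed[OF assms(1)]
  by (metis One_nat_def Suc_lessI card_1_singletonE singletonD)

lemma nontrivial_prime:
  assumes "subgroup S G" "S \<noteq> {\<one>}"
  obtains p where "prime p" "p dvd card S"
  using card_gt_one[OF assms] by (metis less_irrefl prime_factor_nat)

lemma sub_carrier: "subgroup H G \<Longrightarrow> x \<in> H \<Longrightarrow> x \<in> carrier G"
  using subgroup.mem_carrier by fast

lemma subgroup_restrict:
  assumes "subgroup N G" "subgroup M G" "N \<subseteq> M"
  shows "subgroup N (G\<lparr>carrier := M\<rparr>)"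
  using assms subgroup_incl by blast

lemma subgroup_of_subgroup:
  assumes "subgroup U G" "subgroup P (G\<lparr>carrier := U\<rparr>)"
  shows "subgroup P G" "P \<subseteq> U"
  using incl_subgroup[OF assms] subgroup.subset[OF assms(2)] by auto

lemma subgroup_finite_group:
  assumes "subgroup M G" shows "finite_group (G\<lparr>carrier := M\<rparr>)"
proof -
  interpret M: group "G\<lparr>carrier := M\<rparr>"
    using assms subgroup_imp_group by blast
  show ?thesis by unfold_locales (use subgroup_finite[OF assms] in simp)
qed

lemma index_rcosets:
  assumes "subgroup N G" "subgroup M G" "N \<subseteq> M"
  shows "card (rcosets\<^bsub>G\<lparr>carrier := M\<rparr>\<^esub> N) = index M N" "card M = card N * index M N"
proof -
  interpret M: group "G\<lparr>carrier := M\<rparr>"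
    using assms subgroup_imp_group by blast
  have l: "card (rcosets\<^bsub>G\<lparr>carrier := M\<rparr>\<^esub> N) * card N = card M"
    using M.lagrange[OF subgroup_restrict[OF assms]] unfolding order_def by simp
  then show e: "card (rcosets\<^bsub>G\<lparr>carrier := M\<rparr>\<^esub> N) = index M N"
    using subgroup_card_pos[OF assms(1)] by (metis nonzero_mult_div_cancel_right less_not_refl)
  show "card M = card N * index M N" by (subst mult.commute) (rule l[unfolded e, symmetric])
qed

lemmas card_index = index_rcosets(2)

lemma subgroup_card_dvd:
  assumes "subgroup N G" "subgroup M G" "N \<subseteq> M"
  shows "card N dvd card M"
  using card_index[OF assms] by (metis dvd_triv_left)

lemma index_dvd_card:
  assumes "subgroup N G" "subgroup M G" "N \<subseteq> M"
  shows "index M N dvd card M"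
  using card_index[OF assms] by (metis dvd_triv_right)

lemma index_pos:
  assumes "subgroup N G" "subgroup M G" "N \<subseteq> M"
  shows "index M N > 0"
  using card_index[OF assms] subgroup_card_pos[OF assms(2)] by (metis gr0I mult_is_0 less_not_refl)

lemma index_mult:
  assumes "subgroup N G" "subgroup M G" "subgroup L G" "N \<subseteq> M" "M \<subseteq> L"
  shows "index L N = index L M * index M N"
proof -
  have "card L = card N * (index L M * index M N)"
    using card_index[OF assms(2,3,5)] card_index[OF assms(1,2,4)] by (metis mult.assoc mult.commute)
  then show ?thesis using subgroup_card_pos[OF assms(1)] by (metis nonzero_mult_div_cancel_left less_not_refl)
qed

lemma subgroup_eq_of_index_one:
  assumes "subgroup N G" "subgroup M G" "N \<subseteq> M" "index M N = 1"
  shows "N = M"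
  using card_index[OF assms(1-3)] assms(4) card_subset_eq[OF subgroup_finite[OF assms(2)] assms(3)] by simp

lemma subgroup_Int: "subgroup H G \<Longrightarrow> subgroup K G \<Longrightarrow> subgroup (H \<inter> K) G"
  by (rule subgroups_Inter_pair)

lemma coprime_subgroups_inter:
  assumes "subgroup U G" "subgroup W G" "coprime (card U) (card W)"
  shows "U \<inter> W = {\<one>}"
proof -
  have I: "subgroup (U \<inter> W) G" using subgroup_Int assms by blast
  have "card (U \<inter> W) dvd card U" "card (U \<inter> W) dvd card W"
    using subgroup_card_dvd[OF I] assms by auto
  then have "card (U \<inter> W) = 1" using assms(3) by (metis coprime_common_divisor_nat)
  then show ?thesis using subgroup.one_closed[OF I] by (metis card_1_singletonE singletonD)
qed

lemma pi_subgroup_iff: "pi_subgroup \<pi> G P \<longleftrightarrow> subgroup P G \<and> pi_number \<pi> (card P)"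
proof -
  have "group (G\<lparr>carrier := P\<rparr>)" if "subgroup P G"
    using that subgroup_imp_group by blast
  then show ?thesis
    unfolding pi_subgroup_def pi_group_def pi_number_def order_def
    using subgroup_finite subgroup_card_pos by fastforce
qed

lemma set_mult_iff: "x \<in> H <#> K \<longleftrightarrow> (\<exists>h\<in>H. \<exists>k\<in>K. x = h \<otimes> k)"
  unfolding set_mult_def by auto

lemma set_multI: "h \<in> H \<Longrightarrow> k \<in> K \<Longrightarrow> h \<otimes> k \<in> H <#> K"
  unfolding set_mult_def by auto

lemma sub_set_mult_left:
  assumes "subgroup H G" "subgroup K G" shows "H \<subseteq> H <#> K"
proof
  fix h assume h: "h \<in> H"
  then have "h \<otimes> \<one> \<in> H <#> K" using subgroup.one_closed[OF assms(2)] by (intro set_multI)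
  then show "h \<in> H <#> K" using sub_carrier[OF assms(1) h] by simp
qed

lemma sub_set_mult_right:
  assumes "subgroup H G" "subgroup K G" shows "K \<subseteq> H <#> K"
proof
  fix h assume h: "h \<in> K"
  then have "\<one> \<otimes> h \<in> H <#> K" using subgroup.one_closed[OF assms(1)] by (intro set_multI)
  then show "h \<in> H <#> K" using sub_carrier[OF assms(2) h] by simp
qed

lemma set_mult_least:
  assumes "subgroup L G" "H \<subseteq> L" "K \<subseteq> L" shows "H <#> K \<subseteq> L"
  using assms subgroup.m_closed[OF assms(1)] unfolding set_mult_def by auto

lemma subgroup_absorb:
  assumes "subgroup P G" "subgroup Q G" "Q \<subseteq> P" shows "P <#> Q = P" "Q <#> P = P"
  using set_mult_least[OF assms(1) subset_refl assms(3)] set_mult_least[OF assms(1) assms(3) subset_refl]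
    sub_set_mult_left[OF assms(1,2)] sub_set_mult_right[OF assms(2,1)] by auto

lemma set_mult_carrier:
  assumes "subgroup P G" shows "P <#> carrier G = carrier G" "carrier G <#> P = carrier G"
  using set_mult_least[OF subgroup_self subgroup.subset[OF assms] subset_refl]
    set_mult_least[OF subgroup_self subset_refl subgroup.subset[OF assms]]
    sub_set_mult_right[OF assms subgroup_self] sub_set_mult_left[OF subgroup_self assms] by auto

lemma dedekind:
  assumes A: "subgroup A G" and B: "B \<subseteq> carrier G" and C: "subgroup C G" "A \<subseteq> C"
  shows "(A <#> B) \<inter> C = A <#> (B \<inter> C)"
proof (intro equalityI subsetI)
  fix x assume x: "x \<in> (A <#> B) \<inter> C"
  then obtain a b where ab: "a \<in> A" "b \<in> B" "x = a \<otimes> b" using set_mult_iff by auto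
  have c: "a \<in> carrier G" "b \<in> carrier G" using ab B sub_carrier[OF A] by auto
  have "inv a \<otimes> x \<in> C" using ab C x subgroup.m_closed[OF C(1)] subgroup.m_inv_closed[OF C(1)] by auto
  then have "b \<in> C" using ab c by simp
  then show "x \<in> A <#> (B \<inter> C)" using ab set_multI by auto
next
  fix x assume "x \<in> A <#> (B \<inter> C)"
  then obtain a b where ab: "a \<in> A" "b \<in> B" "b \<in> C" "x = a \<otimes> b" using set_mult_iff by auto
  then show "x \<in> (A <#> B) \<inter> C" using set_multI subgroup.m_closed[OF C(1)] C(2) by auto
qed

text \<open>One inclusion suffices, because inversion turns it into the other.\<close>

lemma set_mult_comm_of_subset:
  assumes "subgroup H G" "subgroup K G" "K <#> H \<subseteq> H <#> K"
  shows "H <#> K = K <#> H"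
proof
  show "H <#> K \<subseteq> K <#> H"
  proof
    fix x assume "x \<in> H <#> K"
    then obtain h k where hk: "h \<in> H" "k \<in> K" "x = h \<otimes> k" using set_mult_iff by auto
    have c: "h \<in> carrier G" "k \<in> carrier G" using hk assms sub_carrier by auto
    have "inv k \<otimes> inv h \<in> K <#> H"
      by (intro set_multI subgroup.m_inv_closed) (use hk assms in auto)
    then obtain h' k' where hk': "h' \<in> H" "k' \<in> K" "inv k \<otimes> inv h = h' \<otimes> k'" using assms(3) set_mult_iff by blast
    have c': "h' \<in> carrier G" "k' \<in> carrier G" using hk' assms sub_carrier by auto
    have "x = inv (inv k \<otimes> inv h)" using hk c by (simp add: inv_mult_group)
    also have "\<dots> = inv k' \<otimes> inv h'" using hk' c' by (simp add: inv_mult_group)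
    finally show "x \<in> K <#> H" using hk' assms subgroup.m_inv_closed set_multI by metis
  qed
qed fact

lemma set_mult_subgroup_iff:
  assumes "subgroup H G" "subgroup K G"
  shows "subgroup (H <#> K) G \<longleftrightarrow> H <#> K = K <#> H"
proof
  assume s: "subgroup (H <#> K) G"
  have "K <#> H \<subseteq> H <#> K"
    using set_mult_least[OF s sub_set_mult_right sub_set_mult_left] assms by blast
  then show "H <#> K = K <#> H" using set_mult_comm_of_subset assms by blast
next
  assume e: "H <#> K = K <#> H"
  show "subgroup (H <#> K) G"
  proof (rule subgroupI)
    show "H <#> K \<subseteq> carrier G" using assms by (simp add: setmult_subset_G subgroup.subset)
    show "H <#> K \<noteq> {}" using sub_set_mult_left[OF assms] subgroup.one_closed[OF assms(1)] by blast
    fix x assume x: "x \<in> H <#> K"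
    then obtain h k where hk: "h \<in> H" "k \<in> K" "x = h \<otimes> k" using set_mult_iff by auto
    have c: "h \<in> carrier G" "k \<in> carrier G" using hk assms sub_carrier by auto
    have "inv k \<otimes> inv h \<in> K <#> H"
      by (intro set_multI subgroup.m_inv_closed) (use hk assms in auto)
    then show "inv x \<in> H <#> K" using e hk c by (simp add: inv_mult_group)
    fix y assume "y \<in> H <#> K"
    then obtain h' k' where hk': "h' \<in> H" "k' \<in> K" "y = h' \<otimes> k'" using set_mult_iff by auto
    have c': "h' \<in> carrier G" "k' \<in> carrier G" using hk' assms sub_carrier by auto
    have "k \<otimes> h' \<in> H <#> K" using e hk hk' set_multI by metis
    then obtain a b where ab: "a \<in> H" "b \<in> K" "k \<otimes> h' = a \<otimes> b" using set_mult_iff by auto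
    have cc: "a \<in> carrier G" "b \<in> carrier G" using ab assms sub_carrier by auto
    have "x \<otimes> y = h \<otimes> (k \<otimes> h') \<otimes> k'" using hk hk' c c' by (simp add: m_assoc)
    also have "\<dots> = (h \<otimes> a) \<otimes> (b \<otimes> k')" using ab cc c c' by (simp add: m_assoc)
    finally show "x \<otimes> y \<in> H <#> K"
      using ab hk hk' assms subgroup.m_closed set_multI by metis
  qed
qed

lemma permutes_with_iff:
  assumes "subgroup H G" "subgroup K G"
  shows "permutes_with G H K \<longleftrightarrow> H <#> K = K <#> H"
  unfolding permutes_with_def using set_mult_subgroup_iff[OF assms] .

lemma card_set_mult:
  assumes H: "subgroup H G" and K: "subgroup K G"
  shows "card (H <#> K) * card (H \<inter> K) = card H * card K"
proof -
  let ?f = "\<lambda>(h,k). h \<otimes> k"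
  have fin: "finite (H \<times> K)" using assms subgroup_finite by simp
  have im: "?f ` (H \<times> K) = H <#> K" unfolding set_mult_def by auto
  have fib: "card {z \<in> H \<times> K. ?f z = y} = card (H \<inter> K)" if y: "y \<in> H <#> K" for y
  proof -
    obtain h k where hk: "h \<in> H" "k \<in> K" "y = h \<otimes> k" using y set_mult_iff by auto
    have c: "h \<in> carrier G" "k \<in> carrier G" using hk assms sub_carrier by auto
    \<comment> \<open>The pairs with product \<open>hk\<close> are the pairs \<open>(hd, inv d k)\<close> with \<open>d \<in> H \<inter> K\<close>.\<close>
    have "bij_betw (\<lambda>d. (h \<otimes> d, inv d \<otimes> k)) (H \<inter> K) {z \<in> H \<times> K. ?f z = y}"
    proof (rule bij_betw_imageI)
      show "inj_on (\<lambda>d. (h \<otimes> d, inv d \<otimes> k)) (H \<inter> K)"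
        using c sub_carrier[OF H] by (auto simp: inj_on_def)
      show "(\<lambda>d. (h \<otimes> d, inv d \<otimes> k)) ` (H \<inter> K) = {z \<in> H \<times> K. ?f z = y}"
      proof (intro equalityI subsetI)
        fix z assume "z \<in> (\<lambda>d. (h \<otimes> d, inv d \<otimes> k)) ` (H \<inter> K)"
        then obtain d where d: "d \<in> H" "d \<in> K" "z = (h \<otimes> d, inv d \<otimes> k)" by auto
        have dc: "d \<in> carrier G" using d sub_carrier[OF H] by auto
        have "h \<otimes> d \<otimes> (inv d \<otimes> k) = h \<otimes> (d \<otimes> inv d) \<otimes> k" using dc c by (simp add: m_assoc)
        then have "h \<otimes> d \<otimes> (inv d \<otimes> k) = y" using dc c hk by simp
        then show "z \<in> {z \<in> H \<times> K. ?f z = y}"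
          using d hk subgroup.m_closed[OF H] subgroup.m_closed[OF K] subgroup.m_inv_closed[OF K] by auto
      next
        fix z assume "z \<in> {z \<in> H \<times> K. ?f z = y}"
        then obtain a b where z: "z = (a,b)" "a \<in> H" "b \<in> K" "a \<otimes> b = h \<otimes> k" using hk by auto
        have zc: "a \<in> carrier G" "b \<in> carrier G" using z assms sub_carrier by auto
        define d where "d = inv h \<otimes> a"
        have dH: "d \<in> H" unfolding d_def using z hk subgroup.m_closed[OF H] subgroup.m_inv_closed[OF H] by auto
        have a: "a = h \<otimes> d" unfolding d_def using c zc by (simp add: m_assoc[symmetric])
        have "h \<otimes> (d \<otimes> b) = h \<otimes> k" using z a c zc sub_carrier[OF H dH] by (simp add: m_assoc)
        then have k: "d \<otimes> b = k" using c zc sub_carrier[OF H dH] by simp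
        then have "d = k \<otimes> inv b" using zc c sub_carrier[OF H dH] by (simp add: inv_solve_right)
        then have dK: "d \<in> K" using z hk subgroup.m_closed[OF K] subgroup.m_inv_closed[OF K] by auto
        have "inv d \<otimes> k = b" unfolding k[symmetric] using zc sub_carrier[OF H dH] by simp
        then have "z = (h \<otimes> d, inv d \<otimes> k)" unfolding z(1) a[symmetric] by simp
        then show "z \<in> (\<lambda>d. (h \<otimes> d, inv d \<otimes> k)) ` (H \<inter> K)"
          by (rule image_eqI) (use dH dK in simp)
      qed
    qed
    then show ?thesis by (rule bij_betw_same_card[THEN sym])
  qed
  have "card (H \<times> K) = card (?f ` (H \<times> K)) * card (H \<inter> K)"
    by (rule card_by_fibres[OF fin fib]) (simp only: im)
  then show ?thesis unfolding im by (simp add: card_cartesian_product)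
qed

lemma index_set_mult:
  assumes H: "subgroup H G" and K: "subgroup K G"
  shows "index (H <#> K) H = index K (H \<inter> K)"
proof -
  have "card (H <#> K) * card (H \<inter> K) = card H * (card (H \<inter> K) * index K (H \<inter> K))"
    using card_set_mult[OF assms] card_index[OF subgroup_Int[OF assms] K] by simp
  then have "card (H <#> K) = card H * index K (H \<inter> K)"
    using subgroup_card_pos[OF subgroup_Int[OF assms]] by simp
  then show ?thesis using subgroup_card_pos[OF H] by simp
qed

lemma index_set_mult_dvd:
  assumes "subgroup H G" "subgroup K G" shows "index (H <#> K) H dvd card K"
  unfolding index_set_mult[OF assms] by (rule index_dvd_card[OF subgroup_Int[OF assms] assms(2) Int_lower2])

lemma pi_number_set_mult:
  assumes A: "subgroup A G" "pi_number \<pi> (card A)" and B: "subgroup B G" "pi_number \<pi> (card B)"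
  shows "pi_number \<pi> (card (A <#> B))"
proof (rule pi_number_dvd[OF pi_number_mult[OF A(2) B(2)]])
  show "card (A <#> B) dvd card A * card B" using card_set_mult[OF A(1) B(1)] by (metis dvd_triv_left)
qed

lemma normalisesD: "normalises K B \<Longrightarrow> k \<in> K \<Longrightarrow> b \<in> B \<Longrightarrow> inv k \<otimes> b \<otimes> k \<in> B"
  unfolding normalises_def by blast

lemma normalises_mono: "normalises K B \<Longrightarrow> K' \<subseteq> K \<Longrightarrow> normalises K' B"
  unfolding normalises_def by blast

lemma normalises_self: "subgroup H G \<Longrightarrow> normalises H H"
  unfolding normalises_def by (simp add: subgroup.m_closed subgroup.m_inv_closed)

lemma normalises_Int: "normalises K A \<Longrightarrow> normalises K B \<Longrightarrow> normalises K (A \<inter> B)"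
  unfolding normalises_def by blast

lemma normalises_conj_inv:
  assumes "subgroup K G" "normalises K B" "k \<in> K" "b \<in> B"
  shows "k \<otimes> b \<otimes> inv k \<in> B"
  using assms subgroup.m_inv_closed[OF assms(1,3)] sub_carrier[OF assms(1,3)]
  unfolding normalises_def by (metis inv_inv)

lemma normalises_permute:
  assumes H: "subgroup H G" and K: "subgroup K G" and n: "normalises K H"
  shows "H <#> K = K <#> H"
proof (rule set_mult_comm_of_subset[OF K H, symmetric])
  show "H <#> K \<subseteq> K <#> H"
  proof
    fix x assume "x \<in> H <#> K"
    then obtain h k where hk: "h \<in> H" "k \<in> K" "x = h \<otimes> k" using set_mult_iff by auto
    have c: "h \<in> carrier G" "k \<in> carrier G" using hk assms sub_carrier by auto
    have "x = k \<otimes> (inv k \<otimes> h \<otimes> k)" using hk c by (simp add: m_assoc[symmetric])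
    moreover have "inv k \<otimes> h \<otimes> k \<in> H" using hk n unfolding normalises_def by simp
    ultimately show "x \<in> K <#> H" using hk set_multI by metis
  qed
qed

lemma normalises_subgroup:
  assumes H: "subgroup H G" and K: "subgroup K G" and n: "normalises K H"
  shows "subgroup (H <#> K) G" "subgroup (K <#> H) G"
  using normalises_permute[OF assms] set_mult_subgroup_iff[OF H K] by simp_all

lemma normalised_product:
  assumes H: "subgroup H G" and K: "subgroup K G" and n: "normalises K H"
  shows "subgroup (H <#> K) G" "H \<subseteq> H <#> K" "K \<subseteq> H <#> K"
  using normalises_subgroup(1)[OF assms] sub_set_mult_left[OF H K] sub_set_mult_right[OF H K] by auto

lemma normal_iff_normalises: "N \<lhd> G \<longleftrightarrow> subgroup N G \<and> normalises (carrier G) N"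
proof
  assume "N \<lhd> G"
  then show "subgroup N G \<and> normalises (carrier G) N"
    unfolding normalises_def using normal_imp_subgroup[of N G] normal.inv_op_closed1[of N G] by auto
next
  assume a: "subgroup N G \<and> normalises (carrier G) N"
  have "x \<otimes> h \<otimes> inv x \<in> N" if "x \<in> carrier G" "h \<in> N" for x h
    using a that unfolding normalises_def by (metis inv_closed inv_inv)
  then show "N \<lhd> G" using a normal_inv_iff by blast
qed

lemma normalI_normalises: "subgroup N G \<Longrightarrow> normalises (carrier G) N \<Longrightarrow> N \<lhd> G"
  using normal_iff_normalises by blast

lemma normalD:
  assumes "N \<lhd> G"
  shows "subgroup N G" "normalises (carrier G) N" "N \<subseteq> carrier G"
  using assms normal_iff_normalises subgroup.subset[of N G] by auto

lemma normal_in_subgroup: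
  assumes "subgroup U G" "subgroup N G" "N \<subseteq> U" "normalises U N"
  shows "N \<lhd> G\<lparr>carrier := U\<rparr>"
proof -
  interpret U: finite_group "G\<lparr>carrier := U\<rparr>" by (rule subgroup_finite_group[OF assms(1)])
  have "U.normalises U N"
    using assms(4) m_inv_consistent[OF assms(1)] unfolding U.normalises_def normalises_def by simp
  then show ?thesis using U.normal_iff_normalises subgroup_restrict[OF assms(2,1,3)] by simp
qed

text \<open>The index of \<open>N\<close> in \<open>NV\<close> divides both \<open>|V|\<close> and the index of \<open>N\<close> in \<open>M\<close>. This replaces
computations with elements of coprime order in \<open>M/N\<close>.\<close>

lemma coprime_normalised_subset:
  assumes V: "subgroup V G" and N: "subgroup N G" and M: "subgroup M G" and "V \<subseteq> M" "N \<subseteq> M"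
    and n: "normalises V N" and c: "coprime (card V) (index M N)"
  shows "V \<subseteq> N"
proof -
  have s: "subgroup (N <#> V) G" using normalises_subgroup[OF N V n] by simp
  have "index (N <#> V) N dvd index M N"
    using index_mult[OF N s M sub_set_mult_left[OF N V] set_mult_least[OF M]] assms by simp
  moreover have "index (N <#> V) N dvd card V"
    using index_set_mult_dvd[OF N V] by simp
  ultimately have "index (N <#> V) N = 1" using c by (metis coprime_common_divisor_nat)
  then have "N = N <#> V" using subgroup_eq_of_index_one[OF N s sub_set_mult_left[OF N V]] by simp
  then show ?thesis using sub_set_mult_right[OF N V] by simp
qed

lemma exists_subgroup_of_prime_card:
  assumes K: "subgroup K G" and p: "prime p" "p dvd card K"
  obtains V where "subgroup V G" "V \<subseteq> K" "card V = p"
proof -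
  interpret K: finite_group "G\<lparr>carrier := K\<rparr>" using subgroup_finite_group[OF K] .
  obtain m where m: "card K = p * m" using p by auto
  have "\<exists>H. subgroup H (G\<lparr>carrier := K\<rparr>) \<and> card H = p^1"
    using sylow_thm[of p "G\<lparr>carrier := K\<rparr>" 1 m] p m K.finite_carrier K.is_group unfolding order_def by auto
  then obtain V where V: "subgroup V (G\<lparr>carrier := K\<rparr>)" "card V = p" by auto
  then show ?thesis using that incl_subgroup[OF K V(1)] subgroup.subset[OF V(1)] by auto
qed

lemma pi_number_of_no_prime_subgroup:
  assumes K: "subgroup K G"
    and "\<And>p V. \<lbrakk>prime p; p \<notin> \<pi>; subgroup V G; V \<subseteq> K; card V = p\<rbrakk> \<Longrightarrow> False"
  shows "pi_number \<pi> (card K)"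
proof -
  have "p \<in> \<pi>" if p: "prime p" "p dvd card K" for p
  proof (rule ccontr)
    assume "p \<notin> \<pi>"
    obtain V where "subgroup V G" "V \<subseteq> K" "card V = p" by (rule exists_subgroup_of_prime_card[OF K p])
    then show False using assms(2) p \<open>p \<notin> \<pi>\<close> by blast
  qed
  then show ?thesis unfolding pi_number_def using subgroup_card_pos[OF K] by auto
qed

text \<open>The index of \<open>H\<close> in \<open>HV\<close> divides \<open>|V|\<close>, and it divides the index of \<open>H\<close> in \<open>HP\<close>, hence \<open>|P|\<close>.\<close>

lemma normalised_pi_subgroup_of_product:
  assumes H: "subgroup H G" and P: "subgroup P G" and HP: "subgroup (H <#> P) G"
    and V: "subgroup V G" "V \<subseteq> H <#> P" "normalises H V"
    and c: "coprime (card V) (card P)"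
  shows "V \<subseteq> H"
proof -
  have VH: "subgroup (V <#> H) G" "V <#> H = H <#> V"
    using normalises_subgroup[OF V(1) H V(3)] normalises_permute[OF V(1) H V(3)] by auto
  have HVH: "H \<subseteq> V <#> H" "V \<subseteq> V <#> H" "V <#> H \<subseteq> H <#> P"
    using sub_set_mult_right[OF V(1) H] sub_set_mult_left[OF V(1) H]
      set_mult_least[OF HP V(2) sub_set_mult_left[OF H P]] by auto
  have "index (V <#> H) H dvd card V"
    using VH index_set_mult_dvd[OF H V(1)] by simp
  moreover have "index (V <#> H) H dvd card P"
  proof -
    have "index (V <#> H) H dvd index (H <#> P) H" using index_mult[OF H VH(1) HP HVH(1,3)] by simp
    also have "\<dots> dvd card P"
      using index_set_mult_dvd[OF H P] by simp
    finally show ?thesis .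
  qed
  ultimately have "index (V <#> H) H = 1" using c by (metis coprime_common_divisor_nat)
  then have "H = V <#> H" using subgroup_eq_of_index_one[OF H VH(1) HVH(1)] by simp
  then show ?thesis using HVH(2) by simp
qed

section \<open>Conjugation, normalisers and centralisers\<close>

lemma conjugate_eq: "conjugate G P x = (\<lambda>p. inv x \<otimes> p \<otimes> x) ` P"
  unfolding conjugate_def l_coset_def r_coset_def by auto

lemma conjugate_memI: "p \<in> P \<Longrightarrow> inv x \<otimes> p \<otimes> x \<in> conjugate G P x"
  unfolding conjugate_eq by auto

lemma conj_mult:
  assumes "x \<in> carrier G" "a \<in> carrier G" "b \<in> carrier G"
  shows "inv x \<otimes> (a \<otimes> b) \<otimes> x = (inv x \<otimes> a \<otimes> x) \<otimes> (inv x \<otimes> b \<otimes> x)"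
  using assms by (simp add: m_assoc)

lemma conj_hom: "x \<in> carrier G \<Longrightarrow> group_hom G G (\<lambda>p. inv x \<otimes> p \<otimes> x)"
  by unfold_locales (auto intro!: homI simp: conj_mult)

lemma conjugate_subgroup: "subgroup P G \<Longrightarrow> x \<in> carrier G \<Longrightarrow> subgroup (conjugate G P x) G"
  unfolding conjugate_eq by (rule group_hom.subgroup_img_is_subgroup[OF conj_hom])

lemma conjugate_cong:
  assumes "x \<in> carrier G" "p \<in> carrier G" "q \<in> carrier G" "inv x \<otimes> p \<otimes> x = inv x \<otimes> q \<otimes> x"
  shows "p = q"
  using assms by simp

lemma conjugate_card:
  assumes P: "P \<subseteq> carrier G" and x: "x \<in> carrier G"
  shows "card (conjugate G P x) = card P"
  unfolding conjugate_eq
  by (rule card_image) (use P x in \<open>auto simp: inj_on_def intro: conjugate_cong\<close>)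

lemma conjugate_conjugate:
  assumes P: "P \<subseteq> carrier G" and x: "x \<in> carrier G" and y: "y \<in> carrier G"
  shows "conjugate G (conjugate G P x) y = conjugate G P (x \<otimes> y)"
proof -
  have "inv y \<otimes> (inv x \<otimes> p \<otimes> x) \<otimes> y = inv (x \<otimes> y) \<otimes> p \<otimes> (x \<otimes> y)" if "p \<in> P" for p
    using subsetD[OF P that] x y by (simp add: inv_mult_group m_assoc)
  then show ?thesis unfolding conjugate_eq image_image by (rule image_cong[OF refl])
qed

lemma conjugate_one: "P \<subseteq> carrier G \<Longrightarrow> conjugate G P \<one> = P"
  unfolding conjugate_eq by (force simp: subset_iff)

lemma conjugate_inv_cancel:
  assumes P: "P \<subseteq> carrier G" and x: "x \<in> carrier G"
  shows "conjugate G (conjugate G P x) (inv x) = P" "conjugate G (conjugate G P (inv x)) x = P"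
  using conjugate_conjugate[OF P] conjugate_one[OF P] x by simp_all

lemma conjugate_mono: "P \<subseteq> Q \<Longrightarrow> conjugate G P x \<subseteq> conjugate G Q x"
  unfolding conjugate_eq by auto

lemma conjugate_normalised:
  assumes B: "subgroup B G" and n: "normalises K B" and k: "k \<in> K" "k \<in> carrier G"
  shows "conjugate G B k = B"
proof (rule card_subset_eq[OF subgroup_finite[OF B]])
  show "conjugate G B k \<subseteq> B" using n k unfolding normalises_def conjugate_eq by auto
  show "card (conjugate G B k) = card B" using conjugate_card[OF subgroup.subset[OF B]] k by simp
qed

lemma conjugate_normal:
  assumes "N \<lhd> G" "x \<in> carrier G" shows "conjugate G N x = N"
  using conjugate_normalised normalD[OF assms(1)] assms(2) by blast

lemma normalisesI_conjugate:
  assumes "\<And>k. k \<in> K \<Longrightarrow> conjugate G B k \<subseteq> B" shows "normalises K B"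
  using assms unfolding normalises_def conjugate_eq by auto

lemma conjugate_set_mult:
  assumes H: "H \<subseteq> carrier G" and K: "K \<subseteq> carrier G" and x: "x \<in> carrier G"
  shows "conjugate G (H <#> K) x = conjugate G H x <#> conjugate G K x"
  unfolding conjugate_eq by (rule set_mult_hom[OF group_hom.homh[OF conj_hom[OF x]] H K])

lemma conjugate_generate:
  assumes X: "X \<subseteq> carrier G" and x: "x \<in> carrier G"
  shows "conjugate G (generate G X) x = generate G (conjugate G X x)"
  unfolding conjugate_eq using group_hom.generate_img[OF conj_hom[OF x] X] by simp

lemma normalises_set_mult:
  assumes N: "K \<subseteq> carrier G" and A: "A \<subseteq> carrier G" "normalises K A" and B: "B \<subseteq> carrier G" "normalises K B"
  shows "normalises K (A <#> B)"
  unfolding normalises_def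
proof (intro ballI)
  fix k x assume k: "k \<in> K" and "x \<in> A <#> B"
  then obtain a b where ab: "a \<in> A" "b \<in> B" "x = a \<otimes> b" using set_mult_iff by auto
  have "inv k \<otimes> x \<otimes> k = (inv k \<otimes> a \<otimes> k) \<otimes> (inv k \<otimes> b \<otimes> k)"
    unfolding ab(3) by (rule conj_mult) (use k N A B ab in auto)
  then show "inv k \<otimes> x \<otimes> k \<in> A <#> B"
    using set_multI[OF normalisesD[OF A(2) k ab(1)] normalisesD[OF B(2) k ab(2)]] by simp
qed

lemma normalises_conjugate:
  assumes K: "K \<subseteq> carrier G" and B: "B \<subseteq> carrier G" and g: "g \<in> carrier G" and n: "normalises K B"
  shows "normalises (conjugate G K g) (conjugate G B g)"
  unfolding normalises_def
proof (intro ballI)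
  fix k b assume "k \<in> conjugate G K g" "b \<in> conjugate G B g"
  then obtain u v where uv: "u \<in> K" "v \<in> B" "k = inv g \<otimes> u \<otimes> g" "b = inv g \<otimes> v \<otimes> g"
    unfolding conjugate_eq by auto
  have c: "u \<in> carrier G" "v \<in> carrier G" using uv K B by auto
  have "inv k \<otimes> b \<otimes> k = inv g \<otimes> (inv u \<otimes> v \<otimes> u) \<otimes> g"
    unfolding uv(3,4) using c g by (simp add: m_assoc inv_mult_group)
  then show "inv k \<otimes> b \<otimes> k \<in> conjugate G B g"
    using conjugate_memI[OF normalisesD[OF n uv(1,2)]] by simp
qed

text \<open>A product of generators can be moved past \<open>x \<in> K\<close> one generator at a time.\<close>

lemma permutes_generate:
  assumes K: "subgroup K G" and A: "\<And>A. A \<in> \<A> \<Longrightarrow> subgroup A G"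
    and p: "\<And>A. A \<in> \<A> \<Longrightarrow> A <#> K = K <#> A"
  shows "generate G (\<Union>\<A>) <#> K = K <#> generate G (\<Union>\<A>)"
proof -
  let ?E = "generate G (\<Union>\<A>)"
  have sub: "\<Union>\<A> \<subseteq> carrier G" using A subgroup.subset by fast
  have E: "subgroup ?E G" using generate_is_subgroup[OF sub] .
  have AE: "A \<subseteq> ?E" if "A \<in> \<A>" for A using that generate.incl[of _ "\<Union>\<A>" G] by auto
  have base: "a \<otimes> x \<in> K <#> ?E" if "A \<in> \<A>" "a \<in> A" "x \<in> K" for A a x
  proof -
    have "a \<otimes> x \<in> K <#> A" using p[OF that(1)] that set_multI by metis
    then show ?thesis using AE[OF that(1)] unfolding set_mult_def by auto
  qed
  have "\<forall>x\<in>K. e \<otimes> x \<in> K <#> ?E" if "e \<in> ?E" for e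
    using that
  proof (induction rule: generate.induct)
    case one
    show ?case using sub_set_mult_left[OF K E] sub_carrier[OF K] by auto
  next
    case (incl h)
    then show ?case using base by blast
  next
    case (inv h)
    then show ?case using base A subgroup.m_inv_closed by (metis UnionE)
  next
    case (eng h1 h2)
    show ?case
    proof
      fix x assume x: "x \<in> K"
      obtain y e where 1: "y \<in> K" "e \<in> ?E" "h2 \<otimes> x = y \<otimes> e" using eng.IH(2) x set_mult_iff by blast
      obtain z f where 2: "z \<in> K" "f \<in> ?E" "h1 \<otimes> y = z \<otimes> f" using eng.IH(1) 1(1) set_mult_iff by blast
      have c: "h1 \<in> carrier G" "h2 \<in> carrier G" "x \<in> carrier G" "y \<in> carrier G" "z \<in> carrier G" "e \<in> carrier G" "f \<in> carrier G"
        using eng x 1 2 sub_carrier[OF K] sub_carrier[OF E] by auto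
      have "h1 \<otimes> h2 \<otimes> x = h1 \<otimes> y \<otimes> e" using 1 c by (simp add: m_assoc)
      also have "\<dots> = z \<otimes> (f \<otimes> e)" using 2 c by (simp add: m_assoc)
      finally show "h1 \<otimes> h2 \<otimes> x \<in> K <#> ?E" using 1 2 subgroup.m_closed[OF E] set_multI by metis
    qed
  qed
  then have "?E <#> K \<subseteq> K <#> ?E" unfolding set_mult_def by auto
  then show ?thesis using set_mult_comm_of_subset[OF K E] by simp
qed

lemma normal_core:
  assumes P: "subgroup P G"
  shows "(\<Inter>x\<in>carrier G. conjugate G P x) \<lhd> G"
proof (rule normalI_normalises)
  let ?C = "\<Inter>x\<in>carrier G. conjugate G P x"
  show "subgroup ?C G"
    by (rule subgroups_Inter) (use conjugate_subgroup[OF P] in auto)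
  show "normalises (carrier G) ?C"
  proof (intro normalisesI_conjugate INF_greatest)
    fix g x assume g: "g \<in> carrier G" and x: "x \<in> carrier G"
    have "?C \<subseteq> conjugate G P (x \<otimes> inv g)" using g x by auto
    then have "conjugate G ?C g \<subseteq> conjugate G (conjugate G P (x \<otimes> inv g)) g" by (rule conjugate_mono)
    also have "\<dots> = conjugate G P x" using conjugate_conjugate[OF subgroup.subset[OF P]] g x by (simp add: m_assoc)
    finally show "conjugate G ?C g \<subseteq> conjugate G P x" .
  qed
qed

definition normaliser :: "'a set \<Rightarrow> 'a set" where
  "normaliser B = {x \<in> carrier G. conjugate G B x = B}"

lemma normaliser_subgroup:
  assumes B: "B \<subseteq> carrier G" shows "subgroup (normaliser B) G"
proof (rule subgroupI)
  show "normaliser B \<subseteq> carrier G" "normaliser B \<noteq> {}"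
    unfolding normaliser_def using conjugate_one[OF B] by auto
  fix a assume a: "a \<in> normaliser B"
  then show "inv a \<in> normaliser B" using conjugate_inv_cancel(1)[OF B, of a] unfolding normaliser_def by auto
  fix b assume "b \<in> normaliser B"
  then show "a \<otimes> b \<in> normaliser B" using a conjugate_conjugate[OF B, of a b] unfolding normaliser_def by auto
qed

lemma normaliser_normalises: "K \<subseteq> normaliser B \<Longrightarrow> normalises K B"
  unfolding normaliser_def by (intro normalisesI_conjugate) auto

lemma normalises_normaliser: "subgroup K G \<Longrightarrow> subgroup B G \<Longrightarrow> normalises K B \<Longrightarrow> K \<subseteq> normaliser B"
  unfolding normaliser_def using conjugate_normalised sub_carrier by auto

definition centraliser :: "'a set \<Rightarrow> 'a set" where
  "centraliser X = {g \<in> carrier G. \<forall>x\<in>X. g \<otimes> x = x \<otimes> g}"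

lemma centraliser_subgroup:
  assumes X: "X \<subseteq> carrier G" shows "subgroup (centraliser X) G"
proof (rule subgroupI)
  show "centraliser X \<subseteq> carrier G" "centraliser X \<noteq> {}"
    unfolding centraliser_def using X by (auto simp: subset_iff)
  fix a assume a: "a \<in> centraliser X"
  have ac: "a \<in> carrier G" using a unfolding centraliser_def by auto
  have "inv a \<otimes> x = x \<otimes> inv a" if "x \<in> X" for x
  proof -
    have xc: "x \<in> carrier G" using that X by auto
    have "a \<otimes> x = x \<otimes> a" using a that unfolding centraliser_def by auto
    then have "inv a \<otimes> (a \<otimes> x) \<otimes> inv a = inv a \<otimes> (x \<otimes> a) \<otimes> inv a" by simp
    then show ?thesis using ac xc by (simp add: m_assoc)
  qed
  then show "inv a \<in> centraliser X" using ac unfolding centraliser_def by blast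
  fix b assume b: "b \<in> centraliser X"
  have bc: "b \<in> carrier G" using b unfolding centraliser_def by auto
  have "a \<otimes> b \<otimes> x = x \<otimes> (a \<otimes> b)" if "x \<in> X" for x
  proof -
    have xc: "x \<in> carrier G" using that X by auto
    have e: "a \<otimes> x = x \<otimes> a" "b \<otimes> x = x \<otimes> b" using a b that unfolding centraliser_def by auto
    have "a \<otimes> b \<otimes> x = a \<otimes> (b \<otimes> x)" using ac bc xc by (simp add: m_assoc)
    also have "\<dots> = (a \<otimes> x) \<otimes> b" unfolding e(2) using ac bc xc by (simp add: m_assoc)
    also have "\<dots> = x \<otimes> (a \<otimes> b)" unfolding e(1) using ac bc xc by (simp add: m_assoc)
    finally show ?thesis .
  qed
  then show "a \<otimes> b \<in> centraliser X" using ac bc unfolding centraliser_def by blast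
qed

lemma centraliser_normalised:
  assumes X: "X \<subseteq> carrier G" and K: "subgroup K G" and n: "normalises K X"
  shows "normalises K (centraliser X)"
  unfolding normalises_def
proof (intro ballI)
  fix k z assume k: "k \<in> K" and z: "z \<in> centraliser X"
  have c: "k \<in> carrier G" "z \<in> carrier G" using k z sub_carrier[OF K] unfolding centraliser_def by auto
  have "inv k \<otimes> z \<otimes> k \<otimes> x = x \<otimes> (inv k \<otimes> z \<otimes> k)" if x: "x \<in> X" for x
  proof -
    have xc: "x \<in> carrier G" using x X by auto
    let ?t = "k \<otimes> x \<otimes> inv k"
    have t: "?t \<in> X" using normalises_conj_inv[OF K n k x] .
    have "x = inv k \<otimes> ?t \<otimes> k" using c xc by (simp add: m_assoc)
    moreover have "z \<otimes> ?t = ?t \<otimes> z" using z t unfolding centraliser_def by blast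
    ultimately show ?thesis using conj_mult[of k z ?t] conj_mult[of k ?t z] c xc by simp
  qed
  then show "inv k \<otimes> z \<otimes> k \<in> centraliser X" unfolding centraliser_def using c by blast
qed

lemma centraliser_normalises:
  assumes "X \<subseteq> carrier G" "U \<subseteq> centraliser X" shows "normalises U X"
proof -
  have "inv u \<otimes> x \<otimes> u = x" if "u \<in> U" "x \<in> X" for u x
  proof -
    have c: "u \<in> carrier G" "x \<in> carrier G" "u \<otimes> x = x \<otimes> u" using that assms unfolding centraliser_def by auto
    have "inv u \<otimes> x \<otimes> u = inv u \<otimes> (x \<otimes> u)" using c(1,2) by (simp add: m_assoc)
    also have "\<dots> = x" unfolding c(3)[symmetric] using c(1,2) by simp
    finally show ?thesis .
  qed
  then show ?thesis unfolding normalises_def by simp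
qed

lemma centraliser_sym: "U \<subseteq> carrier G \<Longrightarrow> W \<subseteq> carrier G \<Longrightarrow> U \<subseteq> centraliser W \<Longrightarrow> W \<subseteq> centraliser U"
  unfolding centraliser_def by (auto simp: subset_iff)

lemma centraliser_antimono: "X \<subseteq> Y \<Longrightarrow> centraliser Y \<subseteq> centraliser X"
  unfolding centraliser_def by auto

lemma centraliser_normal:
  assumes "N \<lhd> G" shows "centraliser N \<lhd> G"
  using normalI_normalises[OF centraliser_subgroup centraliser_normalised[OF _ subgroup_self]] normalD(2,3)[OF assms] by simp

text \<open>The commutator of \<open>u\<close> and \<open>w\<close> lies in both subgroups.\<close>

lemma normalises_trivial_inter_commute:
  assumes U: "subgroup U G" and W: "subgroup W G" and UW: "normalises U W" and WU: "normalises W U"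
    and I: "U \<inter> W \<subseteq> {\<one>}"
  shows "U \<subseteq> centraliser W"
proof
  fix u assume u: "u \<in> U"
  have "u \<otimes> w = w \<otimes> u" if w: "w \<in> W" for w
  proof -
    have c: "u \<in> carrier G" "w \<in> carrier G" using u w sub_carrier[OF U] sub_carrier[OF W] by auto
    let ?c = "inv u \<otimes> (inv w \<otimes> u \<otimes> w)"
    have "?c \<in> U"
      using subgroup.m_closed[OF U subgroup.m_inv_closed[OF U u] normalisesD[OF WU w u]] .
    moreover have "?c = (inv u \<otimes> inv w \<otimes> u) \<otimes> w" using c by (simp add: m_assoc)
    moreover have "\<dots> \<in> W"
      using subgroup.m_closed[OF W normalisesD[OF UW u subgroup.m_inv_closed[OF W w]] w] .
    ultimately have "?c = \<one>" using I by auto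
    then have "w \<otimes> (u \<otimes> ?c) = w \<otimes> u" using c by simp
    then show ?thesis using c by (simp add: m_assoc)
  qed
  then show "u \<in> centraliser W" unfolding centraliser_def using u sub_carrier[OF U] by auto
qed

end

section \<open>Epimorphisms of finite groups\<close>

locale finite_epi = group_hom G Q h for G (structure) and Q (structure) and h +
  assumes finite_dom: "finite (carrier G)"
    and onto: "h ` carrier G = carrier Q"

sublocale finite_epi \<subseteq> dom: finite_group G
  by unfold_locales (rule finite_dom)

sublocale finite_epi \<subseteq> cod: finite_group Q
  by unfold_locales (use finite_dom onto in \<open>metis finite_imageI\<close>)

context finite_epi
begin

abbreviation ker :: "'a set" where "ker \<equiv> kernel G Q h"

definition preimage :: "'c set \<Rightarrow> 'a set" where
  "preimage R = {x \<in> carrier G. h x \<in> R}"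

lemma ker_normal: "ker \<lhd> G" by (rule normal_kernel)

lemma ker_subgroup: "subgroup ker G" by (rule subgroup_kernel)

lemma image_subgroup: "subgroup A G \<Longrightarrow> subgroup (h ` A) Q"
  by (rule subgroup_img_is_subgroup)

lemma preimage_subgroup:
  assumes "subgroup R Q" shows "subgroup (preimage R) G"
proof (rule G.subgroupI)
  show "preimage R \<subseteq> carrier G" "preimage R \<noteq> {}"
    unfolding preimage_def using subgroup.one_closed[OF assms] hom_one by auto
qed (use subgroup.m_closed[OF assms] subgroup.m_inv_closed[OF assms] in \<open>auto simp: preimage_def\<close>)

lemma ker_preimage: "subgroup R Q \<Longrightarrow> ker \<subseteq> preimage R"
  unfolding preimage_def kernel_def using subgroup.one_closed by fastforce

lemma image_preimage: "R \<subseteq> carrier Q \<Longrightarrow> h ` preimage R = R"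
  unfolding preimage_def using onto by auto

lemma preimage_mono: "R \<subseteq> R' \<Longrightarrow> preimage R \<subseteq> preimage R'"
  unfolding preimage_def by auto

lemma preimage_image:
  assumes A: "subgroup A G" shows "preimage (h ` A) = A <#>\<^bsub>G\<^esub> ker"
proof (intro equalityI subsetI)
  fix x assume "x \<in> preimage (h ` A)"
  then obtain a where a: "a \<in> A" "x \<in> carrier G" "h x = h a" unfolding preimage_def by auto
  have ac: "a \<in> carrier G" using dom.sub_carrier[OF A a(1)] .
  have "inv\<^bsub>G\<^esub> a \<otimes>\<^bsub>G\<^esub> x \<in> ker" unfolding kernel_def using a ac by simp
  then have "a \<otimes>\<^bsub>G\<^esub> (inv\<^bsub>G\<^esub> a \<otimes>\<^bsub>G\<^esub> x) \<in> A <#>\<^bsub>G\<^esub> ker" using a by (intro dom.set_multI)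
  then show "x \<in> A <#>\<^bsub>G\<^esub> ker" using a ac by simp
next
  fix x assume "x \<in> A <#>\<^bsub>G\<^esub> ker"
  then obtain a k where "a \<in> A" "k \<in> ker" "x = a \<otimes>\<^bsub>G\<^esub> k" using dom.set_mult_iff by auto
  then show "x \<in> preimage (h ` A)"
    using dom.sub_carrier[OF A] unfolding preimage_def kernel_def by auto
qed

lemma preimage_image_eq:
  assumes A: "subgroup A G" "ker \<subseteq> A" shows "preimage (h ` A) = A"
  unfolding preimage_image[OF A(1)]
  using dom.set_mult_least[OF A(1) subset_refl A(2)] dom.sub_set_mult_left[OF A(1) ker_subgroup] by blast

lemma card_image_ker:
  assumes A: "subgroup A G" shows "card A = card (A \<inter> ker) * card (h ` A)"
proof -
  have fin: "finite A" using dom.subgroup_finite[OF A] .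
  have fib: "card {x \<in> A. h x = y} = card (A \<inter> ker)" if y: "y \<in> h ` A" for y
  proof -
    obtain a where a: "a \<in> A" "y = h a" using y by blast
    have ac: "a \<in> carrier G" using dom.sub_carrier[OF A a(1)] .
    have "bij_betw (\<lambda>k. a \<otimes>\<^bsub>G\<^esub> k) (A \<inter> ker) {x \<in> A. h x = y}"
    proof (rule bij_betw_imageI)
      show "inj_on (\<lambda>k. a \<otimes>\<^bsub>G\<^esub> k) (A \<inter> ker)"
        using ac dom.sub_carrier[OF A] by (auto simp: inj_on_def)
      show "(\<lambda>k. a \<otimes>\<^bsub>G\<^esub> k) ` (A \<inter> ker) = {x \<in> A. h x = y}"
      proof (intro equalityI subsetI)
        fix x assume "x \<in> (\<lambda>k. a \<otimes>\<^bsub>G\<^esub> k) ` (A \<inter> ker)"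
        then show "x \<in> {x \<in> A. h x = y}"
          using a ac subgroup.m_closed[OF A] dom.sub_carrier[OF A] unfolding kernel_def by auto
      next
        fix x assume "x \<in> {x \<in> A. h x = y}"
        then have x: "x \<in> A" "h x = h a" "x \<in> carrier G" using a dom.sub_carrier[OF A] by auto
        have "inv\<^bsub>G\<^esub> a \<otimes>\<^bsub>G\<^esub> x \<in> A \<inter> ker"
          using x a ac subgroup.m_closed[OF A] subgroup.m_inv_closed[OF A] unfolding kernel_def by simp
        moreover have "x = a \<otimes>\<^bsub>G\<^esub> (inv\<^bsub>G\<^esub> a \<otimes>\<^bsub>G\<^esub> x)" using x ac by simp
        ultimately show "x \<in> (\<lambda>k. a \<otimes>\<^bsub>G\<^esub> k) ` (A \<inter> ker)" by (rule rev_image_eqI)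
      qed
    qed
    then show ?thesis by (rule bij_betw_same_card[THEN sym])
  qed
  show ?thesis using card_by_fibres[OF fin fib] by simp
qed

lemma card_image_dvd: "subgroup A G \<Longrightarrow> card (h ` A) dvd card A"
  using card_image_ker by (metis dvd_triv_right)

lemma card_image_over:
  assumes A: "subgroup A G" "ker \<subseteq> A" shows "card (h ` A) = dom.index A ker"
proof -
  have "card A = card ker * card (h ` A)" using card_image_ker[OF A(1)] A(2) by (simp add: Int_absorb1)
  then show ?thesis using dom.subgroup_card_pos[OF ker_subgroup] by (metis nonzero_mult_div_cancel_left less_not_refl)
qed

lemma card_preimage:
  assumes R: "subgroup R Q" shows "card (preimage R) = card ker * card R"
  using card_image_ker[OF preimage_subgroup[OF R]] ker_preimage[OF R] image_preimage[OF subgroup.subset[OF R]]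
  by (simp add: Int_absorb1)

lemma index_preimage:
  assumes "subgroup N Q" "subgroup M Q" "N \<subseteq> M"
  shows "dom.index (preimage M) (preimage N) = cod.index M N"
  using card_preimage assms dom.subgroup_card_pos[OF ker_subgroup] by simp

lemma index_image_dvd:
  assumes "subgroup N G" "subgroup M G" "N \<subseteq> M"
  shows "cod.index (h ` M) (h ` N) dvd dom.index M N"
proof -
  have s: "subgroup (h ` N) Q" "subgroup (h ` M) Q" "h ` N \<subseteq> h ` M" using assms image_subgroup by auto
  have i: "subgroup (N \<inter> ker) G" "subgroup (M \<inter> ker) G"
    using dom.subgroup_Int ker_subgroup assms by auto
  have "card (h ` N) * card (N \<inter> ker) * (cod.index (h ` M) (h ` N) * dom.index (M \<inter> ker) (N \<inter> ker)) = card (h ` M) * card (M \<inter> ker)"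
  proof -
    have arith: "b * d * (i * j) = a * c" if "a = b * i" "c = d * j" for a b c d i j :: nat
      using that by simp
    show ?thesis
      by (rule arith) (fact cod.card_index[OF s] dom.card_index[OF i Int_mono[OF assms(3) subset_refl]])+
  qed
  also have "\<dots> = card N * dom.index M N"
    using card_image_ker[OF assms(2)] dom.card_index[OF assms] by (simp add: mult.commute)
  also have "\<dots> = card (h ` N) * card (N \<inter> ker) * dom.index M N"
    using card_image_ker[OF assms(1)] by (simp add: mult.commute)
  \<comment> \<open>The cofactor is the index of \<open>N \<inter> ker\<close> in \<open>M \<inter> ker\<close>.\<close>
  finally have "cod.index (h ` M) (h ` N) * dom.index (M \<inter> ker) (N \<inter> ker) = dom.index M N"
    using dom.subgroup_card_pos[OF i(1)] cod.subgroup_card_pos[OF s(1)] by simp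
  then show ?thesis by (metis dvd_triv_left)
qed

lemma image_set_mult:
  assumes "A \<subseteq> carrier G" "B \<subseteq> carrier G"
  shows "h ` (A <#>\<^bsub>G\<^esub> B) = h ` A <#>\<^bsub>Q\<^esub> h ` B"
  using set_mult_hom[OF homh assms] .

lemma image_conjugate:
  assumes "A \<subseteq> carrier G" "x \<in> carrier G"
  shows "h ` conjugate G A x = conjugate Q (h ` A) (h x)"
proof -
  have "h (inv\<^bsub>G\<^esub> x \<otimes>\<^bsub>G\<^esub> a \<otimes>\<^bsub>G\<^esub> x) = inv\<^bsub>Q\<^esub> h x \<otimes>\<^bsub>Q\<^esub> h a \<otimes>\<^bsub>Q\<^esub> h x" if "a \<in> A" for a
    using that assms by (simp add: subset_iff)
  then show ?thesis unfolding dom.conjugate_eq cod.conjugate_eq image_image by (rule image_cong[OF refl])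
qed

lemma image_normalises:
  assumes "K \<subseteq> carrier G" "B \<subseteq> carrier G" "dom.normalises K B"
  shows "cod.normalises (h ` K) (h ` B)"
proof -
  have "inv\<^bsub>Q\<^esub> (h k) \<otimes>\<^bsub>Q\<^esub> h b \<otimes>\<^bsub>Q\<^esub> h k = h (inv\<^bsub>G\<^esub> k \<otimes>\<^bsub>G\<^esub> b \<otimes>\<^bsub>G\<^esub> k)" if "k \<in> K" "b \<in> B" for k b
    using that assms by (simp add: subset_iff)
  then show ?thesis using assms(3) unfolding dom.normalises_def cod.normalises_def by auto
qed

lemma preimage_normal:
  assumes "R \<lhd> Q" shows "preimage R \<lhd> G"
proof -
  have R: "subgroup R Q" "cod.normalises (carrier Q) R" using assms cod.normal_iff_normalises by auto
  have "dom.normalises (carrier G) (preimage R)"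
    using R(2) unfolding dom.normalises_def cod.normalises_def preimage_def by simp
  then show ?thesis using dom.normal_iff_normalises preimage_subgroup[OF R(1)] by blast
qed

end

context finite_group
begin

lemma epi_Mod:
  assumes N: "N \<lhd> G"
  shows "finite_epi G (G Mod N) (\<lambda>x. N #> x)" "kernel G (G Mod N) (\<lambda>x. N #> x) = N"
proof -
  interpret N: normal N G by (rule N)
  interpret Q: group "G Mod N" by (rule N.factorgroup_is_group)
  show "finite_epi G (G Mod N) (\<lambda>x. N #> x)"
    by unfold_locales (use N.r_coset_hom_Mod finite_carrier carrier_FactGroup in auto)
  show "kernel G (G Mod N) (\<lambda>x. N #> x) = N"
    unfolding kernel_def using coset_join1[OF _ _ N.subgroup_axioms] coset_join2[OF _ N.subgroup_axioms] N.subset by auto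
qed

text \<open>An induction hypothesis speaks about groups whose elements have one fixed type, and the elements of
\<open>G Mod N\<close> are sets. Inductions on the group order pass to this copy of \<open>G/N\<close> instead, whose elements are
chosen coset representatives.\<close>

lemma exists_quotient_same_type:
  assumes N: "N \<lhd> G"
  obtains Q :: "('a, 'b) monoid_scheme" and h where "finite_epi G Q h" "kernel G Q h = N"
proof -
  interpret N: normal N G by (rule N)
  define r where "r x = (SOME y. y \<in> N #> x)" for x
  have rin: "r x \<in> N #> x" if "x \<in> carrier G" for x
    unfolding r_def using rcos_self[OF that N.subgroup_axioms] by (rule someI)
  have rc: "r x \<in> carrier G" if "x \<in> carrier G" for x
    using rin[OF that] r_coset_subset_G[OF N.subset that] by auto
  have rr: "N #> r x = N #> x" if "x \<in> carrier G" for x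
    using repr_independence[OF rin[OF that] that N.subgroup_axioms] by simp
  have req: "r x = r y" if "N #> x = N #> y" for x y unfolding r_def using that by simp
  have rmult: "r (r x \<otimes> r y) = r (x \<otimes> y)" if "x \<in> carrier G" "y \<in> carrier G" for x y
    by (rule req) (use that rc rr N.rcos_sum in metis)
  have rml: "r (r x \<otimes> y) = r (x \<otimes> y)" "r (x \<otimes> r y) = r (x \<otimes> y)" if "x \<in> carrier G" "y \<in> carrier G" for x y
    by (rule req, use that rc rr N.rcos_sum in metis)+
  define Q where "Q = G\<lparr>carrier := r ` carrier G, mult := (\<lambda>x y. r (x \<otimes> y)), one := r \<one>\<rparr>"
  have gQ: "group Q"
  proof (rule groupI)
    fix x assume "x \<in> carrier Q"
    then obtain a where a: "a \<in> carrier G" "x = r a" unfolding Q_def by auto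
    have "r (inv a) \<in> carrier Q" "r (inv a) \<otimes>\<^bsub>Q\<^esub> x = \<one>\<^bsub>Q\<^esub>"
      unfolding Q_def using a rmult[of "inv a" a] by simp_all
    then show "\<exists>y\<in>carrier Q. y \<otimes>\<^bsub>Q\<^esub> x = \<one>\<^bsub>Q\<^esub>" by blast
  qed (auto simp: Q_def rmult rml rc m_assoc)
  interpret E: finite_epi G Q r
    by (unfold_locales) (use group.axioms[OF gQ] gQ finite_carrier in \<open>auto simp: Q_def hom_def rmult
      group_def monoid_def group_axioms_def\<close>)
  have "kernel G Q r = N"
  proof -
    have "r x = r \<one> \<longleftrightarrow> x \<in> N" if x: "x \<in> carrier G" for x
    proof
      assume "r x = r \<one>"
      then have "N #> x = N #> \<one>" using rr[OF x] rr[of \<one>] by simp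
      then show "x \<in> N" using rcos_self[OF x N.subgroup_axioms] N.subset by simp
    next
      assume "x \<in> N"
      then have "N #> x = N #> \<one>" using coset_join2[OF x N.subgroup_axioms] N.subset by simp
      then show "r x = r \<one>" by (rule req)
    qed
    then show ?thesis unfolding kernel_def Q_def using N.subset by auto
  qed
  then show ?thesis using that[OF E.finite_epi_axioms] by blast
qed

end

section \<open>Projectors\<close>

context finite_group
begin

text \<open>The image of \<open>P\<close> in \<open>G/N\<close> is \<open>\<pi>\<close>-maximal, expressed by subgroups of \<open>G\<close> above \<open>N\<close>.\<close>

definition maximal_over :: "nat set \<Rightarrow> 'a set \<Rightarrow> 'a set \<Rightarrow> bool" where
  "maximal_over \<pi> N P \<longleftrightarrow> pi_number \<pi> (index (P <#> N) N) \<and>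
     (\<forall>R. subgroup R G \<longrightarrow> P <#> N \<subseteq> R \<longrightarrow> pi_number \<pi> (index R N) \<longrightarrow> R \<subseteq> P <#> N)"

definition projector :: "nat set \<Rightarrow> 'a set \<Rightarrow> bool" where
  "projector \<pi> P \<longleftrightarrow> subgroup P G \<and> (\<forall>N. N \<lhd> G \<longrightarrow> maximal_over \<pi> N P)"

end

lemma (in finite_epi) pi_maximal_image_iff:
  assumes P: "subgroup P G"
  shows "pi_maximal \<pi> Q (h ` P) \<longleftrightarrow> dom.maximal_over \<pi> ker P"
proof -
  let ?PN = "P <#>\<^bsub>G\<^esub> ker"
  have PN: "subgroup ?PN G" "ker \<subseteq> ?PN"
    using preimage_subgroup[OF image_subgroup[OF P]] preimage_image[OF P] dom.sub_set_mult_right[OF P ker_subgroup] by auto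
  have hPN: "h ` ?PN = h ` P"
    using image_preimage[of "h ` P"] preimage_image[OF P] subgroup.subset[OF image_subgroup[OF P]] by simp
  have 1: "pi_subgroup \<pi> Q (h ` P) \<longleftrightarrow> pi_number \<pi> (dom.index ?PN ker)"
    using cod.pi_subgroup_iff image_subgroup[OF P] card_image_over[OF PN] hPN by simp
  have 2: "(\<exists>R. pi_subgroup \<pi> Q R \<and> h ` P \<subset> R) \<longleftrightarrow>
      (\<exists>R. subgroup R G \<and> ?PN \<subseteq> R \<and> pi_number \<pi> (dom.index R ker) \<and> \<not> R \<subseteq> ?PN)" (is "?l \<longleftrightarrow> ?r")
  proof
    assume ?l
    then obtain R where R: "subgroup R Q" "pi_number \<pi> (card R)" "h ` P \<subset> R" using cod.pi_subgroup_iff by auto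
    have "h ` preimage R = R" using image_preimage subgroup.subset[OF R(1)] by simp
    moreover have "dom.index (preimage R) ker = card R"
      using card_image_over[OF preimage_subgroup[OF R(1)] ker_preimage[OF R(1)]] calculation by simp
    moreover have "?PN \<subseteq> preimage R" using preimage_mono[of "h ` P" R] R preimage_image[OF P] by auto
    moreover have "\<not> preimage R \<subseteq> ?PN" using image_mono[of "preimage R" ?PN h] hPN calculation(1) R(3) by auto
    ultimately show ?r using preimage_subgroup[OF R(1)] R(2) by metis
  next
    assume ?r
    then obtain R where R: "subgroup R G" "?PN \<subseteq> R" "pi_number \<pi> (dom.index R ker)" "\<not> R \<subseteq> ?PN" by auto
    have kR: "ker \<subseteq> R" using PN R by auto
    have "h ` P \<subseteq> h ` R" using hPN R(2) by (metis image_mono)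
    moreover have "h ` P \<noteq> h ` R" using preimage_image_eq[OF R(1) kR] preimage_image[OF P] R(4) by auto
    moreover have "pi_subgroup \<pi> Q (h ` R)"
      using cod.pi_subgroup_iff image_subgroup[OF R(1)] card_image_over[OF R(1) kR] R(3) by simp
    ultimately show ?l by blast
  qed
  show ?thesis unfolding pi_maximal_def dom.maximal_over_def 1 2 by auto
qed

context finite_group
begin

lemma carrier_set_mult_Mod:
  assumes N: "N \<lhd> G" and P: "subgroup P G"
  shows "carrier (G\<lparr>carrier := P <#> N\<rparr> Mod N) = (\<lambda>x. N #> x) ` P"
proof -
  interpret N: normal N G by (rule N)
  interpret E: finite_epi G "G Mod N" "\<lambda>x. N #> x" by (rule epi_Mod(1)[OF N])
  have "carrier (G\<lparr>carrier := P <#> N\<rparr> Mod N) = (\<lambda>x. N #> x) ` (P <#> N)"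
    unfolding FactGroup_def RCOSETS_def by auto
  also have "\<dots> = (\<lambda>x. N #> x) ` P"
    using E.image_preimage[of "(\<lambda>x. N #> x) ` P"] E.preimage_image[OF P] epi_Mod(2)[OF N]
      subgroup.subset[OF E.image_subgroup[OF P]] by simp
  finally show ?thesis .
qed

lemma pi_projector_iff: "pi_projector \<pi> G P \<longleftrightarrow> projector \<pi> P"
proof (cases "subgroup P G")
  case True
  have "pi_maximal \<pi> (G Mod N) (carrier (G\<lparr>carrier := P <#> N\<rparr> Mod N)) \<longleftrightarrow> maximal_over \<pi> N P" if "N \<lhd> G" for N
    using finite_epi.pi_maximal_image_iff[OF epi_Mod(1)[OF that] True] epi_Mod(2)[OF that] carrier_set_mult_Mod[OF that True] by simp
  then show ?thesis unfolding pi_projector_def projector_def by auto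
qed (simp add: pi_projector_def projector_def)

lemma projector_subgroup: "projector \<pi> P \<Longrightarrow> subgroup P G"
  unfolding projector_def by simp

lemma projector_pi_number:
  assumes "projector \<pi> P" shows "pi_number \<pi> (card P)"
proof -
  have "pi_number \<pi> (index (P <#> {\<one>}) {\<one>})"
    using assms one_is_normal unfolding projector_def maximal_over_def by blast
  then show ?thesis using subgroup_absorb(1)[OF projector_subgroup[OF assms] triv_subgroup]
      subgroup.one_closed[OF projector_subgroup[OF assms]] by simp
qed

lemma projector_over:
  assumes P: "projector \<pi> P" and N: "N \<lhd> G" and R: "subgroup R G" "P \<subseteq> R" "N \<subseteq> R" "pi_number \<pi> (index R N)"
  shows "R \<subseteq> P <#> N"
  using assms set_mult_least[OF R(1-3)] unfolding projector_def maximal_over_def by blast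

lemma projector_maximal:
  assumes P: "projector \<pi> P" and R: "subgroup R G" "P \<subseteq> R" "pi_number \<pi> (card R)"
  shows "R = P"
proof -
  have "R \<subseteq> P <#> {\<one>}"
    by (rule projector_over[OF P one_is_normal R(1,2)]) (use R subgroup.one_closed[OF R(1)] in auto)
  then show ?thesis using subgroup_absorb(1)[OF projector_subgroup[OF P] triv_subgroup]
      subgroup.one_closed[OF projector_subgroup[OF P]] R(2) by auto
qed

text \<open>\<open>MP/N\<close> is a \<open>\<pi>\<close>-group above the image of \<open>P\<close>.\<close>

lemma projector_covers:
  assumes P: "projector \<pi> P" and N: "N \<lhd> G" and M: "M \<lhd> G" "N \<subseteq> M" "pi_number \<pi> (index M N)"
  shows "M \<subseteq> P <#> N"
proof -
  note Ps = projector_subgroup[OF P] and Ms = normalD[OF M(1)] and Ns = normalD[OF N]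
  have nPM: "normalises P M" using normalises_mono[OF Ms(2) subgroup.subset[OF Ps]] .
  have MP: "subgroup (M <#> P) G" "M \<subseteq> M <#> P" "P \<subseteq> M <#> P"
    using normalised_product[OF Ms(1) Ps nPM] by auto
  have "index (M <#> P) N = index (M <#> P) M * index M N"
    by (rule index_mult[OF Ns(1) Ms(1) MP(1) M(2) MP(2)])
  moreover have "index (M <#> P) M dvd card P"
    using index_set_mult_dvd[OF Ms(1) Ps] by simp
  ultimately have "pi_number \<pi> (index (M <#> P) N)"
    using M(3) projector_pi_number[OF P] pi_number_mult pi_number_dvd by metis
  then have "M <#> P \<subseteq> P <#> N" using projector_over[OF P N MP(1,3)] M(2) MP(2) by auto
  then show ?thesis using MP(2) by auto
qed

lemma projector_conjugate:
  assumes P: "projector \<pi> P" and x: "x \<in> carrier G"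
  shows "projector \<pi> (conjugate G P x)"
  unfolding projector_def maximal_over_def
proof (intro conjI allI impI)
  note Ps = projector_subgroup[OF P]
  show "subgroup (conjugate G P x) G" by (rule conjugate_subgroup[OF Ps x])
  fix N assume N: "N \<lhd> G"
  note Ns = normalD[OF N]
  have PN: "P <#> N \<subseteq> carrier G" using setmult_subset_G[OF subgroup.subset[OF Ps] Ns(3)] .
  have e: "conjugate G P x <#> N = conjugate G (P <#> N) x"
    using conjugate_set_mult[OF subgroup.subset[OF Ps] Ns(3) x] conjugate_normal[OF N x] by simp
  have max: "pi_number \<pi> (index (P <#> N) N)"
    "\<And>R. subgroup R G \<Longrightarrow> P <#> N \<subseteq> R \<Longrightarrow> pi_number \<pi> (index R N) \<Longrightarrow> R \<subseteq> P <#> N"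
    using P N unfolding projector_def maximal_over_def by auto
  show "pi_number \<pi> (index (conjugate G P x <#> N) N)" unfolding e using conjugate_card[OF PN x] max(1) by simp
  fix R assume R: "subgroup R G" "conjugate G P x <#> N \<subseteq> R" "pi_number \<pi> (index R N)"
  have xi: "inv x \<in> carrier G" using x by simp
  have "P <#> N \<subseteq> conjugate G R (inv x)"
    using conjugate_mono[OF R(2)[unfolded e], of "inv x"] conjugate_inv_cancel(1)[OF PN x] by simp
  then have "conjugate G R (inv x) \<subseteq> P <#> N"
    by (intro max(2) conjugate_subgroup[OF R(1) xi])
      (use R(3) conjugate_card[OF subgroup.subset[OF R(1)] xi] in auto)
  then have "conjugate G (conjugate G R (inv x)) x \<subseteq> conjugate G (P <#> N) x" by (rule conjugate_mono)
  then show "R \<subseteq> conjugate G P x <#> N" using e conjugate_inv_cancel(2)[OF subgroup.subset[OF R(1)] x] by simp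
qed

text \<open>Modulo the normal closure of \<open>P\<close> the trivial group, as the image of \<open>P\<close>, is \<open>\<pi>\<close>-maximal. So no
\<open>\<pi>\<close>-subgroup survives in that quotient.\<close>

lemma conjugates_of_projector_generate:
  assumes P: "projector \<pi> P" and X: "subgroup X G" "pi_number \<pi> (card X)"
  shows "X \<subseteq> generate G (\<Union>x\<in>carrier G. conjugate G P x)"
proof -
  let ?U = "\<Union>x\<in>carrier G. conjugate G P x"
  let ?L = "generate G ?U"
  have Pc: "P \<subseteq> carrier G" using subgroup.subset[OF projector_subgroup[OF P]] .
  have U: "?U \<subseteq> carrier G"
    using conjugate_subgroup[OF projector_subgroup[OF P]] subgroup.subset by (metis UN_least)
  have L: "?L \<lhd> G"
  proof (intro normalI_normalises normalisesI_conjugate)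
    show "subgroup ?L G" using generate_is_subgroup[OF U] .
    fix g assume g: "g \<in> carrier G"
    have "conjugate G ?U g = (\<Union>x\<in>carrier G. conjugate G (conjugate G P x) g)"
      unfolding conjugate_eq[of ?U] conjugate_eq[of "conjugate G P _" g] by (rule image_UN)
    also have "\<dots> \<subseteq> ?U" using conjugate_conjugate[OF Pc _ g] g by auto
    finally show "conjugate G ?L g \<subseteq> ?L" unfolding conjugate_generate[OF U g] by (rule mono_generate)
  qed
  note Ls = normalD[OF L]
  have "P \<subseteq> ?U" using conjugate_one[OF Pc] by blast
  then have PL: "P \<subseteq> ?L" using generate.incl[of _ ?U G] by auto
  have LX: "subgroup (?L <#> X) G" "?L \<subseteq> ?L <#> X" "X \<subseteq> ?L <#> X"
    using normalised_product[OF Ls(1) X(1) normalises_mono[OF Ls(2) subgroup.subset[OF X(1)]]] by auto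
  have "index (?L <#> X) ?L dvd card X"
    using index_set_mult_dvd[OF Ls(1) X(1)] by simp
  then have "pi_number \<pi> (index (?L <#> X) ?L)" using X(2) pi_number_dvd by blast
  then have "?L <#> X \<subseteq> P <#> ?L" using projector_over[OF P L LX(1) _ LX(2)] PL LX(2) by auto
  also have "\<dots> = ?L" using subgroup_absorb(2)[OF Ls(1) projector_subgroup[OF P] PL] .
  finally show ?thesis using LX(3) by auto
qed

end

context finite_epi
begin

text \<open>A quotient of \<open>Q\<close> is a quotient of \<open>G\<close>.\<close>

lemma image_projector:
  assumes P: "dom.projector \<pi> P" shows "cod.projector \<pi> (h ` P)"
  unfolding cod.projector_def cod.maximal_over_def
proof (intro conjI allI impI)
  have Ps: "subgroup P G" using dom.projector_subgroup[OF P] .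
  show hP: "subgroup (h ` P) Q" by (rule image_subgroup[OF Ps])
  fix N assume N: "N \<lhd> Q"
  have Ns: "subgroup N Q" "N \<subseteq> carrier Q" using cod.normalD[OF N] by auto
  let ?N = "preimage N"
  have N': "?N \<lhd> G" by (rule preimage_normal[OF N])
  have e: "preimage (h ` P <#>\<^bsub>Q\<^esub> N) = P <#>\<^bsub>G\<^esub> ?N"
  proof -
    have PN: "subgroup (P <#>\<^bsub>G\<^esub> ?N) G" "ker \<subseteq> P <#>\<^bsub>G\<^esub> ?N"
      using dom.normalises_subgroup[OF dom.normalD(1)[OF N'] Ps] dom.normalises_mono[OF dom.normalD(2)[OF N'] subgroup.subset[OF Ps]]
        ker_preimage[OF Ns(1)] dom.sub_set_mult_right[OF Ps dom.normalD(1)[OF N']] by auto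
    have "h ` (P <#>\<^bsub>G\<^esub> ?N) = h ` P <#>\<^bsub>Q\<^esub> N"
      using image_set_mult[OF subgroup.subset[OF Ps] dom.normalD(3)[OF N']] image_preimage[OF Ns(2)] by simp
    then show ?thesis using preimage_image_eq[OF PN] by simp
  qed
  have s: "subgroup (h ` P <#>\<^bsub>Q\<^esub> N) Q"
    using cod.normalises_subgroup[OF Ns(1) hP] cod.normalises_mono[OF cod.normalD(2)[OF N] subgroup.subset[OF hP]] by simp
  have max: "pi_number \<pi> (dom.index (P <#>\<^bsub>G\<^esub> ?N) ?N)"
    "\<And>R. subgroup R G \<Longrightarrow> P <#>\<^bsub>G\<^esub> ?N \<subseteq> R \<Longrightarrow> pi_number \<pi> (dom.index R ?N) \<Longrightarrow> R \<subseteq> P <#>\<^bsub>G\<^esub> ?N"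
    using P N' unfolding dom.projector_def dom.maximal_over_def by auto
  show "pi_number \<pi> (cod.index (h ` P <#>\<^bsub>Q\<^esub> N) N)"
    using max(1) index_preimage[OF Ns(1) s cod.sub_set_mult_right[OF hP Ns(1)]] e by simp
  fix R assume R: "subgroup R Q" "h ` P <#>\<^bsub>Q\<^esub> N \<subseteq> R" "pi_number \<pi> (cod.index R N)"
  have NR: "N \<subseteq> R" using R(2) cod.sub_set_mult_right[OF hP Ns(1)] by auto
  have "preimage R \<subseteq> P <#>\<^bsub>G\<^esub> ?N"
    by (rule max(2)[OF preimage_subgroup[OF R(1)]])
      (use preimage_mono[OF R(2)] e index_preimage[OF Ns(1) R(1) NR] R(3) in auto)
  then have "h ` preimage R \<subseteq> h ` preimage (h ` P <#>\<^bsub>Q\<^esub> N)" unfolding e by (rule image_mono)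
  then show "R \<subseteq> h ` P <#>\<^bsub>Q\<^esub> N"
    using image_preimage[OF subgroup.subset[OF R(1)]] image_preimage[OF subgroup.subset[OF s]] by simp
qed

end

section \<open>Actions of prime-power groups\<close>

context finite_group
begin

text \<open>Every orbit has prime-power length different from \<open>1\<close>.\<close>

lemma prime_dvd_card_of_fixed_point_free:
  fixes act :: "'a \<Rightarrow> 'x \<Rightarrow> 'x"
  assumes V: "subgroup V G" and p: "prime p" "card V = p ^ k" and X: "finite X"
    and cl: "\<And>v x. v \<in> V \<Longrightarrow> x \<in> X \<Longrightarrow> act v x \<in> X"
    and one: "\<And>x. x \<in> X \<Longrightarrow> act \<one> x = x"
    and mlt: "\<And>v w x. v \<in> V \<Longrightarrow> w \<in> V \<Longrightarrow> x \<in> X \<Longrightarrow> act v (act w x) = act (v \<otimes> w) x"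
    and free: "\<And>x. x \<in> X \<Longrightarrow> \<exists>v\<in>V. act v x \<noteq> x"
  shows "p dvd card X"
proof -
  define orb where "orb x = (\<lambda>v. act v x) ` V" for x
  have inv_act: "act (inv v) (act v x) = x" if "v \<in> V" "x \<in> X" for v x
    using that mlt[of "inv v" v x] one subgroup.m_inv_closed[OF V] sub_carrier[OF V] by simp
  have self: "x \<in> orb x" if "x \<in> X" for x
    unfolding orb_def using one[OF that] subgroup.one_closed[OF V] by (metis imageI)
  have orb_sub: "orb x \<subseteq> X" if "x \<in> X" for x unfolding orb_def using cl that by auto
  have orb_mono: "orb y \<subseteq> orb x" if x: "x \<in> X" and y: "y \<in> orb x" for x y
  proof
    fix z assume z: "z \<in> orb y"
    obtain v where v: "v \<in> V" "y = act v x" using y unfolding orb_def by auto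
    obtain w where w: "w \<in> V" "z = act w y" using z unfolding orb_def by auto
    have "z = act (w \<otimes> v) x" using v w mlt x by simp
    then show "z \<in> orb x" unfolding orb_def using subgroup.m_closed[OF V] v w by auto
  qed
  have orb_sym: "x \<in> orb y" if x: "x \<in> X" and y: "y \<in> orb x" for x y
    using y inv_act x subgroup.m_inv_closed[OF V] unfolding orb_def by (smt (verit) image_iff)
  have orb_eq: "orb x = orb y" if xy: "x \<in> X" "y \<in> X" "orb x \<inter> orb y \<noteq> {}" for x y
  proof -
    obtain z where z: "z \<in> orb x" "z \<in> orb y" using xy(3) by blast
    have zX: "z \<in> X" using z orb_sub xy by auto
    have "orb x = orb z" using orb_mono[OF xy(1) z(1)] orb_mono[OF zX orb_sym[OF xy(1) z(1)]] by auto
    moreover have "orb y = orb z" using orb_mono[OF xy(2) z(2)] orb_mono[OF zX orb_sym[OF xy(2) z(2)]] by auto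
    ultimately show ?thesis by simp
  qed
  have orb_dvd: "p dvd card (orb x)" if x: "x \<in> X" for x
  proof -
    define St where "St = {v \<in> V. act v x = x}"
    have St: "subgroup St G"
    proof (rule subgroupI)
      show "St \<subseteq> carrier G" "St \<noteq> {}"
        unfolding St_def using subgroup.subset[OF V] one[OF x] subgroup.one_closed[OF V] by auto
      fix a assume a: "a \<in> St"
      then show "inv a \<in> St" unfolding St_def using inv_act[of a x] x subgroup.m_inv_closed[OF V] by auto
      fix b assume b: "b \<in> St"
      show "a \<otimes> b \<in> St" using a b mlt[of a b x] x subgroup.m_closed[OF V] unfolding St_def by auto
    qed
    have StV: "St \<subseteq> V" unfolding St_def by auto
    have fib: "card {v \<in> V. act v x = y} = card St" if y: "y \<in> orb x" for y
    proof -
      obtain w where w: "w \<in> V" "y = act w x" using y unfolding orb_def by auto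
      have wc: "w \<in> carrier G" using sub_carrier[OF V] w by simp
      have "bij_betw (\<lambda>v. w \<otimes> v) St {v \<in> V. act v x = y}"
      proof (rule bij_betw_imageI)
        show "inj_on (\<lambda>v. w \<otimes> v) St" using wc sub_carrier[OF St] by (auto simp: inj_on_def)
        show "(\<lambda>v. w \<otimes> v) ` St = {v \<in> V. act v x = y}"
        proof (intro equalityI subsetI)
          fix v assume "v \<in> (\<lambda>v. w \<otimes> v) ` St"
          then obtain u where u: "u \<in> V" "act u x = x" "v = w \<otimes> u" unfolding St_def by auto
          show "v \<in> {v \<in> V. act v x = y}" using u w mlt[of w u x] x subgroup.m_closed[OF V] by auto
        next
          fix v assume "v \<in> {v \<in> V. act v x = y}"
          then have v: "v \<in> V" "act v x = act w x" using w by auto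
          have "act (inv w \<otimes> v) x = x" using mlt[of "inv w" v x] v w x inv_act subgroup.m_inv_closed[OF V] by auto
          then have "inv w \<otimes> v \<in> St" unfolding St_def using v w subgroup.m_closed[OF V] subgroup.m_inv_closed[OF V] by auto
          moreover have "v = w \<otimes> (inv w \<otimes> v)" using wc sub_carrier[OF V v(1)] by simp
          ultimately show "v \<in> (\<lambda>v. w \<otimes> v) ` St" by (rule rev_image_eqI)
        qed
      qed
      then show ?thesis by (rule bij_betw_same_card[THEN sym])
    qed
    have c: "card V = card (orb x) * card St"
      using card_by_fibres[OF subgroup_finite[OF V]] fib unfolding orb_def by blast
    have "card (orb x) dvd p ^ k" using c p by (metis dvd_triv_left)
    then obtain j where j: "card (orb x) = p ^ j" using p divides_primepow_nat by blast
    have "j \<noteq> 0"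
    proof
      assume "j = 0"
      then have "card (orb x) = 1" using j by simp
      then obtain y where y: "orb x = {y}" using card_1_singletonE by blast
      have "\<forall>v\<in>V. act v x = x"
      proof
        fix v assume "v \<in> V"
        then have "act v x \<in> orb x" unfolding orb_def by auto
        then show "act v x = x" using y self[OF x] by auto
      qed
      then show False using free x by blast
    qed
    then show ?thesis using j by simp
  qed
  have un: "\<Union>(orb ` X) = X" using self orb_sub by blast
  have "card (\<Union>(orb ` X)) = sum card (orb ` X)"
  proof (rule card_Union_disjoint)
    show "pairwise disjnt (orb ` X)" using orb_eq by (auto simp: pairwise_def disjnt_def)
    show "\<And>A. A \<in> orb ` X \<Longrightarrow> finite A" using subgroup_finite[OF V] unfolding orb_def by auto
  qed
  then show ?thesis using un orb_dvd by (auto intro!: dvd_sum)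
qed

text \<open>Otherwise conjugation acts on \<open>S - {1}\<close> without fixed points, and \<open>p\<close> divides both \<open>|S| - 1\<close> and \<open>|S|\<close>.\<close>

lemma centre_p_group:
  assumes S: "subgroup S G" and p: "prime p" "card S = p ^ k" and ne: "S \<noteq> {\<one>}"
  shows "S \<inter> centraliser S \<noteq> {\<one>}"
proof
  assume e: "S \<inter> centraliser S = {\<one>}"
  have k: "k \<noteq> 0" using p ne subgroup.one_closed[OF S] card_1_singletonE
    by (metis power_0 singletonD)
  let ?X = "S - {\<one>}"
  have "p dvd card ?X"
  proof (rule prime_dvd_card_of_fixed_point_free[OF S p, where act = "\<lambda>v x. v \<otimes> x \<otimes> inv v"])
    fix v x assume v: "v \<in> S" and x: "x \<in> ?X"
    have c: "v \<in> carrier G" "x \<in> carrier G" using v x sub_carrier[OF S] by auto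
    have "v \<otimes> x \<otimes> inv v \<noteq> \<one>"
    proof
      assume "v \<otimes> x \<otimes> inv v = \<one>"
      then have "inv v \<otimes> (v \<otimes> x \<otimes> inv v) \<otimes> v = \<one>" using c by simp
      then show False using x c by (simp add: m_assoc)
    qed
    then show "v \<otimes> x \<otimes> inv v \<in> ?X" using v x subgroup.m_closed[OF S] subgroup.m_inv_closed[OF S] by auto
    fix w assume w: "w \<in> S"
    show "v \<otimes> (w \<otimes> x \<otimes> inv w) \<otimes> inv v = (v \<otimes> w) \<otimes> x \<otimes> inv (v \<otimes> w)"
      using c sub_carrier[OF S w] by (simp add: m_assoc inv_mult_group)
  next
    fix x assume x: "x \<in> ?X"
    then have "x \<notin> centraliser S" using e by auto
    then obtain s where s: "s \<in> S" "x \<otimes> s \<noteq> s \<otimes> x"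
      unfolding centraliser_def using x sub_carrier[OF S] by blast
    have c: "s \<in> carrier G" "x \<in> carrier G" using s x sub_carrier[OF S] by auto
    have "s \<otimes> x \<otimes> inv s \<noteq> x"
    proof
      assume "s \<otimes> x \<otimes> inv s = x"
      then have "x \<otimes> s = (s \<otimes> x \<otimes> inv s) \<otimes> s" by simp
      then show False using s c by (simp add: m_assoc)
    qed
    then show "\<exists>v\<in>S. v \<otimes> x \<otimes> inv v \<noteq> x" using s by blast
  qed (use subgroup_finite[OF S] sub_carrier[OF S] in auto)
  moreover have "card S = Suc (card ?X)"
    using card_Suc_Diff1[OF subgroup_finite[OF S] subgroup.one_closed[OF S]] by simp
  moreover have "p dvd card S" using p k by simp
  ultimately show False using p by (metis One_nat_def Suc_eq_plus1 dvd_add_right_iff nat_dvd_1_iff_1 not_prime_1)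
qed

text \<open>\<open>V\<close> acts by right multiplication on the cosets of \<open>S\<close> in \<open>N\<close>, whose number is prime to \<open>p\<close>. A fixed
coset \<open>Sn\<close> means that \<open>V\<close> lies in the conjugate of \<open>S\<close> by \<open>n\<close>.\<close>

lemma prime_power_subgroup_in_conjugate:
  assumes S: "subgroup S G" and N: "subgroup N G" and SN: "S \<subseteq> N" and nd: "\<not> p dvd index N S"
    and V: "subgroup V G" and VN: "V \<subseteq> N" and p: "prime p" "card V = p ^ k"
  obtains n where "n \<in> N" "V \<subseteq> conjugate G S n"
proof -
  let ?X = "(\<lambda>n. S #> n) ` N"
  have Xr: "rcosets\<^bsub>G\<lparr>carrier := N\<rparr>\<^esub> S = ?X" unfolding RCOSETS_def by auto
  have cX: "\<not> p dvd card ?X" using index_rcosets(1)[OF S N SN] nd Xr by simp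
  have ex: "\<exists>x\<in>?X. \<forall>v\<in>V. x #> inv v = x"
  proof (rule ccontr)
    assume none: "\<not> ?thesis"
    have "p dvd card ?X"
    proof (rule prime_dvd_card_of_fixed_point_free[OF V p, where act = "\<lambda>v x. x #> inv v"])
      fix v x assume v: "v \<in> V" and x: "x \<in> ?X"
      obtain n where n: "n \<in> N" "x = S #> n" using x by auto
      have c: "v \<in> carrier G" "n \<in> carrier G" using v n sub_carrier[OF V] sub_carrier[OF N] by auto
      have e: "x #> inv v = S #> (n \<otimes> inv v)" using n c coset_mult_assoc[OF subgroup.subset[OF S]] by simp
      have "n \<otimes> inv v \<in> N" using n v VN subgroup.m_closed[OF N] subgroup.m_inv_closed[OF N] by auto
      then show "x #> inv v \<in> ?X" using e by auto
      fix w assume w: "w \<in> V"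
      have wc: "w \<in> carrier G" using w sub_carrier[OF V] by auto
      show "x #> inv w #> inv v = x #> inv (v \<otimes> w)"
        using n c wc coset_mult_assoc[OF subgroup.subset[OF S]] by (simp add: inv_mult_group m_assoc)
    next
      fix x assume "x \<in> ?X"
      then obtain n where n: "n \<in> N" "x = S #> n" by auto
      then show "x #> inv \<one> = x" using coset_mult_assoc[OF subgroup.subset[OF S]] sub_carrier[OF N] by simp
    qed (use subgroup_finite[OF N] none in auto)
    then show False using cX by simp
  qed
  then obtain n where n: "n \<in> N" "\<forall>v\<in>V. S #> n #> inv v = S #> n" by auto
  have nc: "n \<in> carrier G" using n sub_carrier[OF N] by auto
  have "V \<subseteq> conjugate G S n"
  proof
    fix v assume v: "v \<in> V"
    have vc: "inv v \<in> V" "v \<in> carrier G" using v sub_carrier[OF V] subgroup.m_inv_closed[OF V] by auto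
    have "S #> (n \<otimes> v) = S #> n"
      using n(2) vc coset_mult_assoc[OF subgroup.subset[OF S] nc] inv_inv by fastforce
    then have "n \<otimes> v \<in> S #> n" using rcos_self[OF _ S, of "n \<otimes> v"] nc vc by simp
    then obtain s where s: "s \<in> S" "n \<otimes> v = s \<otimes> n" unfolding r_coset_def by auto
    have "v = inv n \<otimes> (n \<otimes> v)" using nc vc by simp
    then have "v = inv n \<otimes> s \<otimes> n" using s nc sub_carrier[OF S s(1)] by (simp add: m_assoc)
    then show "v \<in> conjugate G S n" using s conjugate_memI by metis
  qed
  then show ?thesis using that n by blast
qed

text \<open>A conjugate of \<open>S\<close> under \<open>G\<close> is a Sylow subgroup of \<open>N\<close>, hence already a conjugate under \<open>N\<close>.\<close>

lemma frattini:
  assumes N: "N \<lhd> G" and S: "subgroup S G" "S \<subseteq> N" and p: "prime p" "card S = p ^ k" "\<not> p dvd index N S"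
  shows "normaliser S <#> N = carrier G"
proof -
  have Ns: "subgroup N G" "normalises (carrier G) N" using N normal_iff_normalises by auto
  have "g \<in> normaliser S <#> N" if g: "g \<in> carrier G" for g
  proof -
    have s: "subgroup (conjugate G S g) G" using conjugate_subgroup[OF S(1) g] .
    have cN: "conjugate G S g \<subseteq> N"
      using conjugate_mono[OF S(2), of g] conjugate_normalised[OF Ns g g] by simp
    have card: "card (conjugate G S g) = p ^ k" using conjugate_card[OF subgroup.subset[OF S(1)] g] p by simp
    obtain n where n: "n \<in> N" "conjugate G S g \<subseteq> conjugate G S n"
      by (rule prime_power_subgroup_in_conjugate[OF S(1) Ns(1) S(2) p(3) s cN p(1) card])
    have nc: "n \<in> carrier G" using n sub_carrier[OF Ns(1)] by auto
    have "conjugate G S g = conjugate G S n"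
      by (rule card_subset_eq[OF _ n(2)])
        (use conjugate_card[OF subgroup.subset[OF S(1)]] g nc subgroup_finite[OF conjugate_subgroup[OF S(1) nc]] in auto)
    then have "conjugate G S (g \<otimes> inv n) = S"
      using conjugate_conjugate[OF subgroup.subset[OF S(1)] g, of "inv n"] conjugate_inv_cancel(1)[OF subgroup.subset[OF S(1)] nc] nc by simp
    then have "g \<otimes> inv n \<in> normaliser S" unfolding normaliser_def using g nc by simp
    then have "g \<otimes> inv n \<otimes> n \<in> normaliser S <#> N" using n by (rule_tac set_multI)
    then show ?thesis using g nc by (simp add: m_assoc)
  qed
  then show ?thesis
    using setmult_subset_G[of "normaliser S" N] subgroup.subset[OF Ns(1)] unfolding normaliser_def by blast
qed

end

section \<open>Complements and supplements of normal subgroups\<close>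

context finite_group
begin

text \<open>Choose a representative \<open>s(C)\<close> in each coset \<open>C\<close> of \<open>A\<close> and let \<open>D(g)\<close> be the product over all \<open>C\<close> of the
errors \<open>g s(C) inv (s(gC)) \<in> A\<close>. Taking the product over all cosets makes \<open>D\<close> a crossed homomorphism, \<open>D(gk) = (g D(k) inv g) D(g)\<close>,
which on \<open>A\<close> is the power map with exponent the index \<open>m\<close> of \<open>A\<close>. As \<open>m\<close> is prime to \<open>|A|\<close>, this power map
is bijective, so the kernel of \<open>D\<close> meets \<open>A\<close> trivially and every coset of \<open>A\<close> meets the kernel.\<close>

lemma schur_zassenhaus_abelian:
  assumes A: "A \<lhd> G" and ab: "\<And>a b. a \<in> A \<Longrightarrow> b \<in> A \<Longrightarrow> a \<otimes> b = b \<otimes> a"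
    and cop: "coprime (card A) (index (carrier G) A)"
  obtains K where "subgroup K G" "K <#> A = carrier G" "K \<inter> A = {\<one>}"
proof -
  interpret A: normal A G by (rule A)
  define M where "M = G\<lparr>carrier := A\<rparr>"
  have M_simps [simp]: "carrier M = A" "monoid.mult M = monoid.mult G" "one M = \<one>" unfolding M_def by auto
  interpret M: group M unfolding M_def by (rule subgroup_imp_group[OF A.subgroup_axioms])
  interpret M: comm_group M by (rule M.group_comm_groupI) (simp add: ab)
  have Ac: "a \<in> carrier G" if "a \<in> A" for a using that by (rule A.mem_carrier)
  have conjA: "g \<otimes> a \<otimes> inv g \<in> A" if "g \<in> carrier G" "a \<in> A" for g a using that by (rule A.inv_op_closed2)
  define X where "X = rcosets A"
  have finX: "finite X" unfolding X_def RCOSETS_def using finite_carrier by auto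
  have cardX: "card X = index (carrier G) A"
    unfolding X_def using index_rcosets(1)[OF A.subgroup_axioms subgroup_self A.subset] by simp
  have Xl: "\<exists>x\<in>carrier G. C = x <# A" if "C \<in> X" for C
    using that A.coset_eq unfolding X_def RCOSETS_def by auto
  have XI: "x <# A \<in> X" if "x \<in> carrier G" for x
    using that A.coset_eq unfolding X_def RCOSETS_def by auto
  define s where "s C = (SOME c. c \<in> C)" for C :: "'a set"
  have sC: "s C \<in> C" "s C \<in> carrier G" if C: "C \<in> X" for C
  proof -
    obtain x where x: "x \<in> carrier G" "C = x <# A" using Xl[OF C] by auto
    have "x \<in> C" using x lcos_self[OF x(1) A.subgroup_axioms] by simp
    then show 1: "s C \<in> C" unfolding s_def by (rule someI)
    then show "s C \<in> carrier G" using x l_coset_subset_G[OF A.subset x(1)] by auto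
  qed
  have act: "g <# C \<in> X" if g: "g \<in> carrier G" and C: "C \<in> X" for g C
  proof -
    obtain x where x: "x \<in> carrier G" "C = x <# A" using Xl[OF C] by auto
    show ?thesis using XI[of "g \<otimes> x"] x g lcos_m_assoc[OF A.subset g x(1)] by simp
  qed
  have Xsub: "C \<subseteq> carrier G" if "C \<in> X" for C using Xl[OF that] l_coset_subset_G[OF A.subset] by auto
  have act_mult: "g <# (k <# C) = (g \<otimes> k) <# C" if "g \<in> carrier G" "k \<in> carrier G" "C \<in> X" for g k C
    using lcos_m_assoc[OF Xsub[OF that(3)] that(1,2)] .
  have diff: "x \<otimes> inv y \<in> A" if C: "C \<in> X" and xy: "x \<in> C" "y \<in> C" for C x y
  proof -
    obtain z where z: "z \<in> carrier G" "C = z <# A" using Xl[OF C] by auto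
    obtain a b where ab: "a \<in> A" "b \<in> A" "x = z \<otimes> a" "y = z \<otimes> b" using xy z unfolding l_coset_def by auto
    have "x \<otimes> inv y = z \<otimes> (a \<otimes> inv b) \<otimes> inv z" using ab z Ac by (simp add: inv_mult_group m_assoc)
    then show ?thesis using conjA[OF z(1)] ab A.m_closed A.m_inv_closed by simp
  qed
  define t where "t g C = g \<otimes> s C \<otimes> inv (s (g <# C))" for g C
  have tA: "t g C \<in> A" if "g \<in> carrier G" "C \<in> X" for g C
    unfolding t_def using diff[OF act[OF that]] sC(1)[OF act[OF that]] sC(1)[OF that(2)]
    by (auto simp: l_coset_def)
  have t_mult: "t (g \<otimes> k) C = (g \<otimes> t k C \<otimes> inv g) \<otimes> t g (k <# C)" if gkC: "g \<in> carrier G" "k \<in> carrier G" "C \<in> X" for g k C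
    unfolding t_def using gkC act act_mult[OF gkC] sC(2) by (simp add: m_assoc)
  define D where "D g = finprod M (t g) X" for g
  have DA: "D g \<in> A" if "g \<in> carrier G" for g
    unfolding D_def using M.finprod_closed[of "t g" X] tA that by auto
  have conj_prod: "finprod M (\<lambda>C. g \<otimes> f C \<otimes> inv g) Y = g \<otimes> finprod M f Y \<otimes> inv g"
    if g: "g \<in> carrier G" and f: "f \<in> Y \<rightarrow> A" and Y: "finite Y" for g f Y
    using Y f
  proof (induction Y rule: finite_induct)
    case empty then show ?case using g by simp
  next
    case (insert y Y)
    have c: "f y \<in> A" "f \<in> Y \<rightarrow> A" using insert by auto
    have c2: "finprod M f Y \<in> A" using M.finprod_closed[of f Y] c by simp
    have e: "finprod M (\<lambda>C. g \<otimes> f C \<otimes> inv g) Y = g \<otimes> finprod M f Y \<otimes> inv g" using insert.IH c by simp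
    have "finprod M (\<lambda>C. g \<otimes> f C \<otimes> inv g) (insert y Y) = (g \<otimes> f y \<otimes> inv g) \<otimes> finprod M (\<lambda>C. g \<otimes> f C \<otimes> inv g) Y"
      using M.finprod_insert[of Y y "\<lambda>C. g \<otimes> f C \<otimes> inv g"] insert conjA[OF g] by (simp add: Pi_iff)
    also have "\<dots> = g \<otimes> (f y \<otimes> finprod M f Y) \<otimes> inv g" using e g c c2 Ac by (simp add: m_assoc)
    also have "f y \<otimes> finprod M f Y = finprod M f (insert y Y)"
      using M.finprod_insert[of Y y f] insert c by simp
    finally show ?case .
  qed
  have D_mult: "D (g \<otimes> k) = (g \<otimes> D k \<otimes> inv g) \<otimes> D g" if g: "g \<in> carrier G" and k: "k \<in> carrier G" for g k
  proof -
    have bij: "inj_on (\<lambda>C. k <# C) X" "(\<lambda>C. k <# C) ` X = X"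
    proof -
      have inv: "inv k <# (k <# C) = C" "k <# (inv k <# C) = C" if "C \<in> X" for C
        using act_mult[of "inv k" k C] act_mult[of k "inv k" C] k that lcos_mult_one[OF Xsub[OF that]] by simp_all
      show "inj_on (\<lambda>C. k <# C) X" using inv by (metis inj_onI)
      show "(\<lambda>C. k <# C) ` X = X"
        using inv(2) act[OF k] act[of "inv k"] k by (metis (no_types, lifting) image_subset_iff inv_closed rev_image_eqI subsetI subset_antisym)
    qed
    have "D (g \<otimes> k) = finprod M (\<lambda>C. (g \<otimes> t k C \<otimes> inv g) \<otimes>\<^bsub>M\<^esub> t g (k <# C)) X"
      unfolding D_def by (rule M.finprod_cong') (use t_mult[OF g k] tA act conjA g k in auto)
    also have "\<dots> = finprod M (\<lambda>C. g \<otimes> t k C \<otimes> inv g) X \<otimes>\<^bsub>M\<^esub> finprod M (\<lambda>C. t g (k <# C)) X"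
      by (rule M.finprod_multf) (use tA act conjA g k in auto)
    also have "finprod M (\<lambda>C. g \<otimes> t k C \<otimes> inv g) X = g \<otimes> D k \<otimes> inv g"
      unfolding D_def by (rule conj_prod) (use tA g k finX in auto)
    also have "finprod M (\<lambda>C. t g (k <# C)) X = finprod M (t g) ((\<lambda>C. k <# C) ` X)"
      by (rule M.finprod_reindex[symmetric]) (use tA g act k bij in auto)
    finally show ?thesis unfolding D_def bij(2) by simp
  qed
  have pow_M: "a [^]\<^bsub>M\<^esub> n = a [^] n" for a and n :: nat
    unfolding M_def by (simp add: nat_pow_def)
  let ?m = "card X"
  have D_A: "D a = a [^] ?m" if a: "a \<in> A" for a
  proof -
    have "t a C = a" if C: "C \<in> X" for C
    proof -
      obtain z where z: "z \<in> carrier G" "C = z <# A" using Xl[OF C] by auto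
      have "a <# C = (a \<otimes> z) <# A" using act_mult[OF Ac[OF a] z(1)] z XI[of \<one>] lcos_mult_one[OF A.subset]
          lcos_m_assoc[OF A.subset Ac[OF a] z(1)] by simp
      also have "a \<otimes> z \<in> z <# A"
      proof -
        have "inv z \<otimes> a \<otimes> z \<in> A" using A.inv_op_closed1[OF z(1) a] .
        moreover have "a \<otimes> z = z \<otimes> (inv z \<otimes> a \<otimes> z)" using z Ac[OF a] by (simp add: m_assoc)
        ultimately show ?thesis unfolding l_coset_def by auto
      qed
      then have "(a \<otimes> z) <# A = z <# A" using l_repr_independence[OF _ z(1) A.subgroup_axioms] by simp
      finally have "a <# C = C" using z by simp
      then show ?thesis unfolding t_def using sC(2)[OF C] Ac[OF a] by (simp add: m_assoc)
    qed
    then have "D a = finprod M (\<lambda>C. a) X" unfolding D_def using a by (intro M.finprod_cong') auto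
    then show ?thesis using M.finprod_const[of a X] a pow_M by simp
  qed
  have D_one: "D \<one> = \<one>" using D_A[of \<one>] by simp
  have torsion: "a = \<one>" if a: "a \<in> A" "a [^] ?m = \<one>" for a
  proof -
    have "a [^]\<^bsub>M\<^esub> order M = \<one>\<^bsub>M\<^esub>" using M.pow_order_eq_1[of a] a by simp
    then have "a [^] card A = \<one>" using pow_M unfolding order_def by simp
    then have "ord a dvd card A" "ord a dvd ?m" using a pow_eq_id[OF Ac[OF a(1)]] by auto
    then have "ord a = 1" using cop cardX by (metis coprime_common_divisor_nat)
    then show ?thesis using ord_eq_1[OF Ac[OF a(1)]] by simp
  qed
  have surj: "(\<lambda>a. a [^] ?m) ` A = A"
  proof (rule endo_inj_surj[OF subgroup_finite[OF A.subgroup_axioms]])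
    show "(\<lambda>a. a [^] ?m) ` A \<subseteq> A" using pow_M[of _ ?m] M.nat_pow_closed[of _ ?m] by auto
    show "inj_on (\<lambda>a. a [^] ?m) A"
    proof (rule inj_onI)
      fix a b assume h: "a \<in> A" "b \<in> A" "a [^] ?m = b [^] ?m"
      have c: "a \<in> carrier G" "b \<in> carrier G" using h Ac by auto
      have i: "inv b \<in> A" using h A.m_inv_closed by simp
      have "(a \<otimes> inv b) [^] ?m = a [^] ?m \<otimes> inv b [^] ?m"
        using pow_mult_distrib[of a "inv b" ?m] ab[OF h(1) i] c by simp
      also have "\<dots> = \<one>" using h(3) c by (simp add: nat_pow_inv)
      finally have "a \<otimes> inv b = \<one>" using torsion[of "a \<otimes> inv b"] A.m_closed[OF h(1) i] by simp
      then show "a = b" using c by (metis inv_equality inv_inv inv_closed)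
    qed
  qed
  define K where "K = {g \<in> carrier G. D g = \<one>}"
  have Ks: "subgroup K G"
  proof (rule subgroupI)
    show "K \<subseteq> carrier G" "K \<noteq> {}" unfolding K_def using D_one by auto
    fix a assume a: "a \<in> K"
    have ac: "a \<in> carrier G" using a unfolding K_def by simp
    have "D a = \<one>" using a unfolding K_def by simp
    then have "D (inv a \<otimes> a) = (inv a \<otimes> \<one> \<otimes> a) \<otimes> D (inv a)" using D_mult[of "inv a" a] ac by simp
    then have "D (inv a) = \<one>" using ac D_one Ac[OF DA[of "inv a"]] by simp
    then show "inv a \<in> K" using ac unfolding K_def by simp
    fix b assume "b \<in> K"
    then show "a \<otimes> b \<in> K" using a D_mult[of a b] unfolding K_def by simp
  qed
  moreover have "K <#> A = carrier G"
  proof (intro equalityI subsetI)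
    fix g assume g: "g \<in> carrier G"
    let ?b = "inv g \<otimes> inv (D g) \<otimes> g"
    have bA: "?b \<in> A" using A.inv_op_closed1[OF g] DA[OF g] by simp
    then obtain a where a: "a \<in> A" "a [^] ?m = ?b" using surj by (metis (mono_tags, lifting) imageE)
    have "D (g \<otimes> a) = (g \<otimes> ?b \<otimes> inv g) \<otimes> D g" using D_mult[OF g Ac[OF a(1)]] D_A[OF a(1)] a by simp
    also have "\<dots> = \<one>" using g Ac[OF DA[OF g]] by (simp add: m_assoc)
    finally have "g \<otimes> a \<in> K" unfolding K_def using g Ac[OF a(1)] by simp
    then have "g \<otimes> a \<otimes> inv a \<in> K <#> A" using a by (intro set_multI) auto
    then show "g \<in> K <#> A" using g Ac[OF a(1)] by (simp add: m_assoc)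
  qed (use setmult_subset_G[OF subgroup.subset[OF Ks] A.subset] in auto)
  moreover have "K \<inter> A = {\<one>}"
    using torsion D_A D_one unfolding K_def by auto
  ultimately show ?thesis using that by blast
qed

text \<open>The induction step for the next lemma. If a proper subgroup \<open>U\<close> supplements \<open>N\<close>, a supplement of \<open>U \<inter> N\<close>
in \<open>U\<close> also supplements \<open>N\<close>.\<close>

lemma pi_supplement_step:
  assumes IH: "\<And>(G' :: ('a, 'b) monoid_scheme) N'. \<lbrakk>card (carrier G') < card (carrier G); finite_group G'; N' \<lhd> G';
        pi_number \<pi> (card (carrier G') div card N')\<rbrakk>
      \<Longrightarrow> \<exists>P. subgroup P G' \<and> pi_number \<pi> (card P) \<and> P <#>\<^bsub>G'\<^esub> N' = carrier G'"
    and Nn: "N \<lhd> G" and piGN: "pi_number \<pi> (index (carrier G) N)"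
  shows "\<exists>P. subgroup P G \<and> pi_number \<pi> (card P) \<and> P <#> N = carrier G"
proof -
  have N: "subgroup N G" "normalises (carrier G) N" using Nn normal_iff_normalises by auto
  have Nc: "N \<subseteq> carrier G" using subgroup.subset[OF N(1)] .
  show ?thesis
  proof (cases "\<exists>U. subgroup U G \<and> U \<noteq> carrier G \<and> U <#> N = carrier G")
    case True
    then obtain U where U: "subgroup U G" "U \<noteq> carrier G" "U <#> N = carrier G" by auto
    have UN: "normalises U N" using normalises_mono[OF N(2) subgroup.subset[OF U(1)]] .
    have NU: "N <#> U = carrier G" using normalises_permute[OF N(1) U(1) UN] U by simp
    have I: "subgroup (U \<inter> N) G" using subgroup_Int[OF U(1) N(1)] .
    have less': "card U < card (carrier G)"
      using U(2) subgroup.subset[OF U(1)] finite_carrier by (metis psubset_card_mono psubsetI)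
    have "\<exists>P. subgroup P (G\<lparr>carrier := U\<rparr>) \<and> pi_number \<pi> (card P) \<and> P <#>\<^bsub>G\<lparr>carrier := U\<rparr>\<^esub> (U \<inter> N) = carrier (G\<lparr>carrier := U\<rparr>)"
    proof (rule IH)
      show "card (carrier (G\<lparr>carrier := U\<rparr>)) < card (carrier G)" using less' by simp
      show "finite_group (G\<lparr>carrier := U\<rparr>)" by (rule subgroup_finite_group[OF U(1)])
      show "U \<inter> N \<lhd> G\<lparr>carrier := U\<rparr>"
        by (rule normal_in_subgroup[OF U(1) I]) (use normalises_Int normalises_self[OF U(1)] UN in auto)
      show "pi_number \<pi> (card (carrier (G\<lparr>carrier := U\<rparr>)) div card (U \<inter> N))"
        using index_set_mult[OF N(1) U(1)] NU piGN by (simp add: Int_commute)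
    qed
    then obtain P where P: "subgroup P (G\<lparr>carrier := U\<rparr>)" "pi_number \<pi> (card P)" "P <#> (U \<inter> N) = U" by auto
    have Ps: "subgroup P G" using subgroup_of_subgroup(1)[OF U(1) P(1)] .
    have "P <#> N = P <#> ((U \<inter> N) <#> N)" using subgroup_absorb(2)[OF N(1) I] by simp
    also have "\<dots> = carrier G"
      using set_mult_assoc[OF subgroup.subset[OF Ps] subgroup.subset[OF I] Nc] P(3) U(3) by simp
    finally show ?thesis using Ps P(2) by blast
  next
    case False
    \<comment> \<open>From here on no proper subgroup supplements \<open>N\<close>, and a prime divisor \<open>p \<notin> \<pi>\<close> of \<open>|G|\<close>
      is led to a contradiction.\<close>
    then have Frat: "U = carrier G" if "subgroup U G" "U <#> N = carrier G" for U using that by blast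
    show ?thesis
    proof (cases "pi_number \<pi> (card (carrier G))")
      case True
      then show ?thesis using subgroup_self set_mult_carrier(2)[OF N(1)] by blast
    next
      case False
      then obtain p where p: "prime p" "p dvd card (carrier G)" "p \<notin> \<pi>"
        using subgroup_card_pos[OF subgroup_self] unfolding pi_number_def by auto
      have pGN: "\<not> p dvd index (carrier G) N" using piGN p unfolding pi_number_def by auto
      have pN: "p dvd card N" using card_index[OF N(1) subgroup_self Nc] p pGN prime_dvd_mult_iff by metis
      have "card N \<noteq> 0" "\<not> is_unit p" using subgroup_card_pos[OF N(1)] p(1) not_prime_unit by auto
      then obtain m where "card N = p ^ multiplicity p (card N) * m" and pm: "\<not> p dvd m"
        by (rule multiplicity_decompose')
      then obtain k where m: "card N = p ^ k * m" by blast
      interpret Ng: finite_group "G\<lparr>carrier := N\<rparr>" by (rule subgroup_finite_group[OF N(1)])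
      have "\<exists>S. subgroup S (G\<lparr>carrier := N\<rparr>) \<and> card S = p^k"
        using sylow_thm[of p "G\<lparr>carrier := N\<rparr>" k m] p m Ng.finite_carrier Ng.is_group unfolding order_def by auto
      then obtain S where S: "subgroup S G" "S \<subseteq> N" "card S = p ^ k" using subgroup_of_subgroup[OF N(1)] by blast
      have k0: "k \<noteq> 0" using pN pm m by (cases k) auto
      have "index N S = m" using m S(3) prime_gt_0_nat[OF p(1)] by simp
      then have nd: "\<not> p dvd index N S" using pm by simp
      have "normaliser S = carrier G"
        by (rule Frat[OF normaliser_subgroup[OF subgroup.subset[OF S(1)]] frattini[OF Nn S(1,2) p(1) S(3) nd]])
      then have nS: "normalises (carrier G) S" by (intro normaliser_normalises) simp
      have Sne: "S \<noteq> {\<one>}" 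
      proof
        assume "S = {\<one>}"
        then have "p ^ k = 1" using S(3) by simp
        then show False using k0 prime_gt_1_nat[OF p(1)] by simp
      qed
      have pGS: "\<not> p dvd index (carrier G) S"
        using index_mult[OF S(1) N(1) subgroup_self S(2) Nc] nd pGN p prime_dvd_mult_iff by metis
      \<comment> \<open>Every supplement is all of \<open>G\<close>, so by Frattini the Sylow \<open>p\<close>-subgroup \<open>S\<close> is normal. The
        preimage of a supplement in the quotient by the centre \<open>A\<close> of \<open>S\<close> is all of \<open>G\<close> as well, so
        \<open>G/A\<close> is a \<open>\<pi>\<close>-group and \<open>S = A\<close> is abelian.\<close>
      define A where "A = S \<inter> centraliser S"
      have A: "subgroup A G" "A \<subseteq> S" "A \<noteq> {\<one>}" unfolding A_def
        using subgroup_Int[OF S(1) centraliser_subgroup[OF subgroup.subset[OF S(1)]]]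
          centre_p_group[OF S(1) p(1) S(3) Sne] by auto
      have An: "A \<lhd> G" 
        using normalises_Int[OF nS centraliser_normalised[OF subgroup.subset[OF S(1)] subgroup_self nS]] A(1)
          normal_iff_normalises unfolding A_def by blast
      obtain Q :: "('a, 'b) monoid_scheme" and h where Q: "finite_epi G Q h" "kernel G Q h = A"
        by (rule exists_quotient_same_type[OF An])
      interpret E: finite_epi G Q h by (rule Q(1))
      have cQ: "card (carrier G) = card A * card (carrier Q)"
        using E.card_image_ker[OF subgroup_self] Q(2) E.onto subgroup.subset[OF A(1)] by (simp add: Int_absorb1)
      have Agt: "card A > 1"
        using A(1,3) subgroup_card_pos[OF A(1)] subgroup.one_closed[OF A(1)] by (metis One_nat_def Suc_lessI card_1_singletonE singletonD)
      have "\<exists>P. subgroup P Q \<and> pi_number \<pi> (card P) \<and> P <#>\<^bsub>Q\<^esub> h ` N = carrier Q"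
      proof (rule IH)
        show "card (carrier Q) < card (carrier G)" using cQ Agt E.cod.subgroup_card_pos[OF E.H.subgroup_self] by simp
        show "finite_group Q" by (rule E.cod.finite_group_axioms)
        show "h ` N \<lhd> Q"
          using E.cod.normal_iff_normalises E.image_subgroup[OF N(1)] E.image_normalises[OF subset_refl Nc N(2)] E.onto by simp
        show "pi_number \<pi> (card (carrier Q) div card (h ` N))"
          using pi_number_dvd[OF piGN] E.index_image_dvd[OF N(1) subgroup_self Nc] E.onto by simp
      qed
      then obtain P' where P': "subgroup P' Q" "pi_number \<pi> (card P')" "P' <#>\<^bsub>Q\<^esub> h ` N = carrier Q" by auto
      have pre: "subgroup (E.preimage P') G" by (rule E.preimage_subgroup[OF P'(1)])
      have "carrier G \<subseteq> E.preimage P' <#> N"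
      proof
        fix g assume g: "g \<in> carrier G"
        then have "h g \<in> P' <#>\<^bsub>Q\<^esub> h ` N" using P'(3) by simp
        then obtain q n where q: "q \<in> P'" "n \<in> N" "h g = q \<otimes>\<^bsub>Q\<^esub> h n" using E.cod.set_mult_iff by auto
        have c: "n \<in> carrier G" "q \<in> carrier Q" using q Nc E.cod.sub_carrier[OF P'(1)] by auto
        have "h (g \<otimes> inv n) = q" using q c g by (simp add: E.H.m_assoc)
        then have "g \<otimes> inv n \<in> E.preimage P'" unfolding E.preimage_def using q g c by simp
        then have "g \<otimes> inv n \<otimes> n \<in> E.preimage P' <#> N" using q by (intro set_multI)
        then show "g \<in> E.preimage P' <#> N" using g c by (simp add: m_assoc)
      qed
      then have "E.preimage P' = carrier G"
        using Frat[OF pre] set_mult_least[OF subgroup_self subgroup.subset[OF pre] Nc] by blast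
      then have "P' = carrier Q" using E.image_preimage[OF subgroup.subset[OF P'(1)]] E.onto by simp
      then have piQ: "pi_number \<pi> (index (carrier G) A)"
        using P'(2) cQ subgroup_card_pos[OF A(1)] by simp
      have "index (carrier G) A = index (carrier G) S * index S A"
        using index_mult[OF A(1) S(1) subgroup_self A(2) subgroup.subset[OF S(1)]] .
      then have "\<not> p dvd index S A" using piQ p unfolding pi_number_def by auto
      moreover obtain j where "index S A = p ^ j"
        using index_dvd_card[OF A(1) S(1) A(2)] divides_primepow_nat[OF p(1), of "index S A" k]
        unfolding S(3) by blast
      ultimately have "index S A = 1" by (cases j) auto
      then have SA: "A = S" using subgroup_eq_of_index_one[OF A(1) S(1) A(2)] by simp
      \<comment> \<open>A complement of \<open>S\<close> is a proper supplement of \<open>N\<close>.\<close>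
      obtain K where K: "subgroup K G" "K <#> A = carrier G" "K \<inter> A = {\<one>}"
      proof (rule schur_zassenhaus_abelian[OF An])
        show "a \<otimes> b = b \<otimes> a" if "a \<in> A" "b \<in> A" for a b
          using that A(2) unfolding A_def centraliser_def by blast
        show "coprime (card A) (index (carrier G) A)"
          using prime_imp_coprime[OF p(1) pGS] unfolding SA S(3) by simp
      qed
      have "K <#> N = carrier G"
        using mono_set_mult[of K K A N G] K(2) A(2) S(2) set_mult_least[OF subgroup_self subgroup.subset[OF K(1)] Nc] by auto
      then have "K = carrier G" by (rule Frat[OF K(1)])
      then show ?thesis using K(3) A(3) subgroup.subset[OF A(1)] by (simp add: Int_absorb1)
    qed
  qed
qed

end

lemma exists_pi_supplement:
  fixes G :: "('a, 'b) monoid_scheme"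
  assumes "finite_group G" "N \<lhd> G" "pi_number \<pi> (card (carrier G) div card N)"
  shows "\<exists>P. subgroup P G \<and> pi_number \<pi> (card P) \<and> P <#>\<^bsub>G\<^esub> N = carrier G"
  using assms
proof (induction "card (carrier G)" arbitrary: G N rule: less_induct)
  case (less G N)
  show ?case by (rule finite_group.pi_supplement_step[OF less.prems(1) less.hyps less.prems(2,3)])
qed

section \<open>Existence of projectors\<close>

context finite_group
begin

text \<open>\<open>P/N\<close> is a projector of \<open>E/N\<close>. Both parameters vary in the induction: \<open>E\<close> shrinks and \<open>N\<close> grows.\<close>

definition rel_projector :: "nat set \<Rightarrow> 'a set \<Rightarrow> 'a set \<Rightarrow> 'a set \<Rightarrow> bool" where
  "rel_projector \<pi> E N P \<longleftrightarrow> subgroup P G \<and> N \<subseteq> P \<and> P \<subseteq> E \<and>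
     (\<forall>M. subgroup M G \<longrightarrow> N \<subseteq> M \<longrightarrow> M \<subseteq> E \<longrightarrow> normalises E M \<longrightarrow>
        pi_number \<pi> (index (P <#> M) M) \<and>
        (\<forall>R. subgroup R G \<longrightarrow> P <#> M \<subseteq> R \<longrightarrow> R \<subseteq> E \<longrightarrow> pi_number \<pi> (index R M) \<longrightarrow> R \<subseteq> P <#> M))"

text \<open>A projector of a projector is a projector: \<open>F/L\<close> is a projector of \<open>E/L\<close>, and \<open>P/N\<close> is one of \<open>F/N\<close>.\<close>

lemma rel_projector_trans:
  assumes E: "subgroup E G" and N: "subgroup N G" and L: "subgroup L G" "normalises E L" "N \<subseteq> L" "L \<subseteq> E"
    and F: "rel_projector \<pi> E L F" and P: "rel_projector \<pi> F N P" and nN: "normalises E N"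
  shows "rel_projector \<pi> E N P"
proof -
  have Fs: "subgroup F G" "L \<subseteq> F" "F \<subseteq> E" using F unfolding rel_projector_def by auto
  have Ps: "subgroup P G" "N \<subseteq> P" "P \<subseteq> F" using P unfolding rel_projector_def by auto
  have Fmax: "R \<subseteq> F <#> M"
    if "subgroup M G" "L \<subseteq> M" "M \<subseteq> E" "normalises E M" "subgroup R G" "F <#> M \<subseteq> R" "R \<subseteq> E" "pi_number \<pi> (index R M)" for M R
    using F that unfolding rel_projector_def by blast
  have Pmax: "R \<subseteq> P <#> M"
    if "subgroup M G" "N \<subseteq> M" "M \<subseteq> F" "normalises F M" "subgroup R G" "P <#> M \<subseteq> R" "R \<subseteq> F" "pi_number \<pi> (index R M)" for M R
    using P that unfolding rel_projector_def by blast
  have nFL: "normalises F L" using normalises_mono[OF L(2) Fs(3)] .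
  have "pi_number \<pi> (index (F <#> L) L)" using F L unfolding rel_projector_def by blast
  then have piFL: "pi_number \<pi> (index F L)" using subgroup_absorb(1)[OF Fs(1) L(1) Fs(2)] by simp
  have PL: "F \<subseteq> P <#> L"
    by (rule Pmax[OF L(1,3) Fs(2) nFL Fs(1) set_mult_least[OF Fs(1) Ps(3) Fs(2)] subset_refl piFL])
  have "pi_number \<pi> (index (P <#> N) N)"
    using P N Ps Fs normalises_mono[OF nN Fs(3)] unfolding rel_projector_def by blast
  then have piPN: "pi_number \<pi> (index P N)" using subgroup_absorb(1)[OF Ps(1) N Ps(2)] by simp
  show ?thesis unfolding rel_projector_def
  proof (intro conjI allI impI)
    show "subgroup P G" "N \<subseteq> P" "P \<subseteq> E" using Ps Fs by auto
    fix M assume M: "subgroup M G" "N \<subseteq> M" "M \<subseteq> E" "normalises E M"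
    have nPM: "normalises P M" using normalises_mono[OF M(4)] Ps Fs by auto
    have PM: "P <#> M = M <#> P" using normalises_permute[OF M(1) Ps(1) nPM] by simp
    have I: "subgroup (M \<inter> P) G" by (rule subgroup_Int[OF M(1) Ps(1)])
    have "index (P <#> M) M = index P (M \<inter> P)" using PM index_set_mult[OF M(1) Ps(1)] by simp
    also have "\<dots> dvd index P N"
      using index_mult[OF N I Ps(1)] M(2) Ps(2) by simp
    finally show "pi_number \<pi> (index (P <#> M) M)" using piPN pi_number_dvd by blast
    fix R assume R: "subgroup R G" "P <#> M \<subseteq> R" "R \<subseteq> E" "pi_number \<pi> (index R M)"
    have MR: "M \<subseteq> R" "P \<subseteq> R" using R(2) sub_set_mult_right[OF Ps(1) M(1)] sub_set_mult_left[OF Ps(1) M(1)] by auto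
    \<comment> \<open>Modulo \<open>M' = LM\<close> the maximality of \<open>F\<close> gives \<open>R \<subseteq> FM\<close>, so \<open>R = M(F \<inter> R)\<close>. The maximality of \<open>P\<close>
      in \<open>F\<close> modulo \<open>M \<inter> F\<close> then applies to \<open>F \<inter> R\<close>.\<close>
    define M' where "M' = L <#> M"
    have nLM: "normalises L M" using normalises_mono[OF M(4) L(4)] .
    have M's: "subgroup M' G" "L \<subseteq> M'" "M \<subseteq> M'" "M' \<subseteq> E"
      unfolding M'_def using normalises_subgroup[OF M(1) L(1) nLM] sub_set_mult_left[OF L(1) M(1)]
        sub_set_mult_right[OF L(1) M(1)] set_mult_least[OF E L(4) M(3)] by auto
    have nM': "normalises E M'" unfolding M'_def
      by (rule normalises_set_mult[OF subgroup.subset[OF E] subgroup.subset[OF L(1)] L(2) subgroup.subset[OF M(1)] M(4)])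
    have nRM': "normalises R M'" using normalises_mono[OF nM' R(3)] .
    have RM': "R <#> M' = M' <#> R" "subgroup (R <#> M') G"
      using normalises_permute[OF M's(1) R(1) nRM'] normalises_subgroup[OF M's(1) R(1) nRM'] by auto
    have "index (R <#> M') M' = index R (M' \<inter> R)" using RM' index_set_mult[OF M's(1) R(1)] by simp
    also have "\<dots> dvd index R M"
      using index_mult[OF M(1) subgroup_Int[OF M's(1) R(1)] R(1)] M's(3) MR by simp
    finally have pi1: "pi_number \<pi> (index (R <#> M') M')" using R(4) pi_number_dvd by blast
    have "F \<subseteq> R <#> M'"
    proof -
      have "P <#> L \<subseteq> R <#> M'" by (rule mono_set_mult) (use MR M's in auto)
      then show ?thesis using PL by auto
    qed
    then have "F <#> M' \<subseteq> R <#> M'" using set_mult_least[OF RM'(2) _ sub_set_mult_right[OF R(1) M's(1)]] by simp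
    then have "R <#> M' \<subseteq> F <#> M'"
      using Fmax[OF M's(1,2,4) nM' RM'(2) _ set_mult_least[OF E R(3) M's(4)] pi1] by simp
    moreover have "F <#> M' = F <#> M"
      unfolding M'_def using set_mult_assoc[OF subgroup.subset[OF Fs(1)] subgroup.subset[OF L(1)] subgroup.subset[OF M(1)]]
        subgroup_absorb(1)[OF Fs(1) L(1) Fs(2)] by simp
    ultimately have RFM: "R \<subseteq> F <#> M" using sub_set_mult_left[OF R(1) M's(1)] by auto
    have nFM: "normalises F M" using normalises_mono[OF M(4) Fs(3)] .
    have "R \<subseteq> (M <#> F) \<inter> R" using RFM normalises_permute[OF M(1) Fs(1) nFM] by auto
    then have R_eq: "R \<subseteq> M <#> (F \<inter> R)" using dedekind[OF M(1) subgroup.subset[OF Fs(1)] R(1) MR(1)] by simp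
    have FR: "subgroup (F \<inter> R) G" "F \<inter> R \<subseteq> F" using subgroup_Int[OF Fs(1) R(1)] by auto
    have MFR: "M <#> (F \<inter> R) = R" using R_eq set_mult_least[OF R(1) MR(1), of "F \<inter> R"] by auto
    have FM: "subgroup (M \<inter> F) G" "M \<inter> F \<subseteq> F" using subgroup_Int[OF M(1) Fs(1)] by auto
    have "M \<inter> (F \<inter> R) = M \<inter> F" using MR by auto
    then have pi2: "pi_number \<pi> (index (F \<inter> R) (M \<inter> F))"
      using index_set_mult[OF M(1) FR(1)] R(4) MFR by simp
    have "F \<inter> R \<subseteq> P <#> (M \<inter> F)"
    proof (rule Pmax[OF FM(1) _ FM(2) _ FR(1) _ FR(2) pi2])
      show "N \<subseteq> M \<inter> F" using M Ps by auto
      show "normalises F (M \<inter> F)" by (rule normalises_Int[OF nFM normalises_self[OF Fs(1)]])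
      show "P <#> (M \<inter> F) \<subseteq> F \<inter> R" by (rule set_mult_least[OF FR(1)]) (use Ps MR in auto)
    qed
    then have "F \<inter> R \<subseteq> P <#> M" using mono_set_mult[of P P "M \<inter> F" M G] by auto
    moreover have "subgroup (P <#> M) G" using normalises_subgroup[OF M(1) Ps(1) nPM] by simp
    ultimately have "M <#> (F \<inter> R) \<subseteq> P <#> M"
      using set_mult_least[OF _ sub_set_mult_right[OF Ps(1) M(1)]] by blast
    then show "R \<subseteq> P <#> M" using R_eq by auto
  qed
qed

text \<open>The case where every proper quotient of \<open>E/N\<close> is a \<open>\<pi>\<close>-group but \<open>E/N\<close> is not: any subgroup that is
\<open>\<pi>\<close>-maximal over \<open>N\<close> and contains a \<open>\<pi>\<close>-supplement of the smallest normal subgroup above \<open>N\<close> will do.\<close>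

lemma rel_projector_of_minimal:
  assumes E: "subgroup E G" and N: "subgroup N G" "N \<subseteq> E" "normalises E N"
    and npi: "\<not> pi_number \<pi> (index E N)"
    and above: "\<And>M. \<lbrakk>subgroup M G; N \<subset> M; M \<subseteq> E; normalises E M\<rbrakk> \<Longrightarrow> pi_number \<pi> (index E M)"
  shows "\<exists>P. rel_projector \<pi> E N P"
proof -
  \<comment> \<open>\<open>D/N\<close> turns out to be the unique minimal normal subgroup of \<open>E/N\<close>: if \<open>M \<inter> D = N\<close>, the index of
    \<open>N\<close> in \<open>E\<close> would be a \<open>\<pi>\<close>-number. So a supplement of \<open>D\<close> supplements every \<open>M\<close> above \<open>N\<close>.\<close>
  define MM where "MM = {M. subgroup M G \<and> N \<subset> M \<and> M \<subseteq> E \<and> normalises E M}"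
  have "N \<noteq> E" using npi subgroup_card_pos[OF E] pi_number_one by (auto simp del: One_nat_def)
  then have EM: "E \<in> MM" unfolding MM_def using E N normalises_self[OF E] by auto
  obtain D where D: "D \<in> MM" and Dmin: "\<And>M. M \<in> MM \<Longrightarrow> card D \<le> card M"
    using EM arg_min_nat_lemma[of "\<lambda>M. M \<in> MM" E card] by blast
  have Ds: "subgroup D G" "N \<subset> D" "D \<subseteq> E" "normalises E D" using D unfolding MM_def by auto
  have DM: "D \<subseteq> M" if M: "M \<in> MM" for M
  proof -
    have Ms: "subgroup M G" "N \<subset> M" "M \<subseteq> E" "normalises E M" using M unfolding MM_def by auto
    have I: "subgroup (M \<inter> D) G" using subgroup_Int[OF Ms(1) Ds(1)] .
    have "M \<inter> D \<noteq> N"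
    proof
      assume e: "M \<inter> D = N"
      have nDM: "normalises D M" using normalises_mono[OF Ms(4) Ds(3)] .
      have MD: "subgroup (M <#> D) G" using normalises_subgroup[OF Ms(1) Ds(1) nDM] by simp
      have "index D N = index (M <#> D) M" using index_set_mult[OF Ms(1) Ds(1)] e by simp
      also have "\<dots> dvd index E M"
        using index_mult[OF Ms(1) MD E sub_set_mult_left[OF Ms(1) Ds(1)] set_mult_least[OF E Ms(3) Ds(3)]] by simp
      finally have "pi_number \<pi> (index D N)" using above[OF Ms] pi_number_dvd by blast
      then have "pi_number \<pi> (index E N)"
        using index_mult[OF N(1) Ds(1) E] Ds above[OF Ds] pi_number_mult by auto
      then show False using npi by simp
    qed
    then have "M \<inter> D \<in> MM" unfolding MM_def using I Ms Ds normalises_Int by auto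
    then have "card D \<le> card (M \<inter> D)" by (rule Dmin)
    then have "M \<inter> D = D" by (intro card_seteq[OF subgroup_finite[OF Ds(1)]]) auto
    then show ?thesis by auto
  qed
  have "\<exists>P. subgroup P (G\<lparr>carrier := E\<rparr>) \<and> pi_number \<pi> (card P) \<and> P <#>\<^bsub>G\<lparr>carrier := E\<rparr>\<^esub> D = carrier (G\<lparr>carrier := E\<rparr>)"
    by (rule exists_pi_supplement[OF subgroup_finite_group[OF E] normal_in_subgroup[OF E Ds(1,3,4)]])
      (use above[OF Ds] in simp)
  then obtain P0 where P0: "subgroup P0 G" "P0 \<subseteq> E" "pi_number \<pi> (card P0)" "P0 <#> D = E"
    using subgroup_of_subgroup[OF E] by auto
  have nP0: "normalises P0 N" using normalises_mono[OF N(3) P0(2)] .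
  have P0N: "subgroup (P0 <#> N) G" "N \<subseteq> P0 <#> N" "P0 \<subseteq> P0 <#> N" "P0 <#> N \<subseteq> E"
    using normalises_subgroup[OF N(1) P0(1) nP0] sub_set_mult_right[OF P0(1) N(1)]
      sub_set_mult_left[OF P0(1) N(1)] set_mult_least[OF E P0(2) N(2)] by auto
  have "index (P0 <#> N) N dvd card P0"
    using normalises_permute[OF N(1) P0(1) nP0] index_set_mult_dvd[OF N(1) P0(1)] by simp
  then have piP0: "pi_number \<pi> (index (P0 <#> N) N)" using P0(3) pi_number_dvd by blast
  define PP where "PP = {P. subgroup P G \<and> P0 <#> N \<subseteq> P \<and> P \<subseteq> E \<and> pi_number \<pi> (index P N)}"
  have PP0: "P0 <#> N \<in> PP" unfolding PP_def using P0N piP0 by auto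
  have "finite PP" by (rule finite_subset[of _ "Pow E"]) (auto simp: PP_def subgroup_finite[OF E])
  then obtain P where P: "P \<in> PP" and Pmax: "\<And>R. R \<in> PP \<Longrightarrow> P \<subseteq> R \<Longrightarrow> R = P"
    using finite_has_maximal[of PP] PP0 by (metis empty_iff)
  have Ps: "subgroup P G" "P0 <#> N \<subseteq> P" "P \<subseteq> E" "pi_number \<pi> (index P N)" using P unfolding PP_def by auto
  have NP: "N \<subseteq> P" using P0N Ps by auto
  have "rel_projector \<pi> E N P" unfolding rel_projector_def
  proof (intro conjI allI impI)
    show "subgroup P G" "N \<subseteq> P" "P \<subseteq> E" using Ps NP by auto
    fix M assume M: "subgroup M G" "N \<subseteq> M" "M \<subseteq> E" "normalises E M"
    have PN: "P <#> N = P" using subgroup_absorb(1)[OF Ps(1) N(1) NP] .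
    have PM: "P <#> M = E" if ne: "M \<noteq> N"
    proof
      have "D \<subseteq> M" using DM M ne unfolding MM_def by auto
      then have "P0 <#> D \<subseteq> P <#> M" using P0N Ps by (intro mono_set_mult) auto
      then show "E \<subseteq> P <#> M" using P0(4) by simp
      show "P <#> M \<subseteq> E" by (rule set_mult_least[OF E Ps(3) M(3)])
    qed
    show "pi_number \<pi> (index (P <#> M) M)"
    proof (cases "M = N")
      case True then show ?thesis using PN Ps by simp
    next
      case False then show ?thesis using PM above[of M] M by auto
    qed
    fix R assume R: "subgroup R G" "P <#> M \<subseteq> R" "R \<subseteq> E" "pi_number \<pi> (index R M)"
    show "R \<subseteq> P <#> M"
    proof (cases "M = N")
      case True
      then have "P \<subseteq> R" using R PN by simp
      moreover have "R \<in> PP" unfolding PP_def using R True Ps calculation by auto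
      ultimately show ?thesis using Pmax True PN by simp
    next
      case False then show ?thesis using PM R by auto
    qed
  qed
  then show ?thesis by blast
qed

lemma exists_rel_projector:
  assumes "subgroup E G" "subgroup N G" "N \<subseteq> E" "normalises E N"
  shows "\<exists>P. rel_projector \<pi> E N P"
  using assms
proof (induction "index E N" arbitrary: E N rule: less_induct)
  case (less E N)
  note E = less.prems(1) and N = less.prems(2-4)
  show ?case
  proof (cases "pi_number \<pi> (index E N)")
    case True
    have "rel_projector \<pi> E N E" unfolding rel_projector_def
    proof (intro conjI allI impI)
      fix M assume M: "subgroup M G" "N \<subseteq> M" "M \<subseteq> E" "normalises E M"
      have EM: "E <#> M = E" using subgroup_absorb(1)[OF E M(1,3)] .
      show "pi_number \<pi> (index (E <#> M) M)"
        using EM index_mult[OF N(1) M(1) E M(2,3)] True pi_number_dvd by simp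
      show "R \<subseteq> E <#> M" if "R \<subseteq> E" for R using EM that by simp
    qed (use E N in auto)
    then show ?thesis by blast
  next
    case npi: False
    show ?thesis
    proof (cases "\<exists>M. subgroup M G \<and> N \<subset> M \<and> M \<subseteq> E \<and> normalises E M \<and> \<not> pi_number \<pi> (index E M)")
      case True
      then obtain M where M: "subgroup M G" "N \<subset> M" "M \<subseteq> E" "normalises E M" "\<not> pi_number \<pi> (index E M)" by auto
      have strict: "index B A > 1" if "subgroup A G" "subgroup B G" "A \<subset> B" for A B
        using that index_pos[of A B] subgroup_eq_of_index_one[of A B]
        by (metis One_nat_def Suc_lessI psubset_eq)
      \<comment> \<open>Both \<open>E/M\<close> and \<open>F/N\<close> are smaller than \<open>E/N\<close>; the latter because \<open>F/M\<close> is a \<open>\<pi>\<close>-group while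
        \<open>E/M\<close> is not.\<close>
      have "index E M < index E N"
        using index_mult[OF N(1) M(1) E _ M(3)] M strict[OF N(1) M(1,2)] index_pos[OF M(1) E M(3)] by auto
      then obtain F where F: "rel_projector \<pi> E M F" using less.hyps E M by blast
      have Fs: "subgroup F G" "M \<subseteq> F" "F \<subseteq> E" using F unfolding rel_projector_def by auto
      have "pi_number \<pi> (index (F <#> M) M)" using F M unfolding rel_projector_def by blast
      then have "F \<noteq> E" using M(5) subgroup_absorb(1)[OF Fs(1) M(1) Fs(2)] by auto
      moreover have NF: "N \<subseteq> F" using M Fs by auto
      ultimately have "index F N < index E N"
        using index_mult[OF N(1) Fs(1) E _ Fs(3)] Fs strict[OF Fs(1) E] index_pos[OF N(1) Fs(1)] by auto
      then obtain P where P: "rel_projector \<pi> F N P"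
        using less.hyps Fs N NF normalises_mono by blast
      show ?thesis using rel_projector_trans[OF E N(1) M(1,4) _ M(3) F P N(3)] M(2) by auto
    next
      case False
      then show ?thesis using rel_projector_of_minimal[OF E N npi] by blast
    qed
  qed
qed

lemma exists_projector: "\<exists>P. projector \<pi> P"
proof -
  obtain P where P: "rel_projector \<pi> (carrier G) {\<one>} P"
    using exists_rel_projector[OF subgroup_self triv_subgroup] unfolding normalises_def by auto
  have Ps: "subgroup P G" using P unfolding rel_projector_def by auto
  have "projector \<pi> P" unfolding projector_def maximal_over_def
  proof (intro conjI allI impI)
    fix N assume "N \<lhd> G"
    then have N: "subgroup N G" "normalises (carrier G) N" "{\<one>} \<subseteq> N" "N \<subseteq> carrier G"
      using normal_iff_normalises subgroup.one_closed[of N G] subgroup.subset[of N G] by auto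
    show "pi_number \<pi> (index (P <#> N) N)" using P N unfolding rel_projector_def by blast
    show "R \<subseteq> P <#> N" if "subgroup R G" "P <#> N \<subseteq> R" "pi_number \<pi> (index R N)" for R
      using P N that subgroup.subset[OF that(1)] unfolding rel_projector_def by blast
  qed (rule Ps)
  then show ?thesis by blast
qed

end

section \<open>Hall parts of a subgroup and normal subgroups that cover them\<close>

context finite_group
begin

text \<open>What is needed of a \<open>\<sigma>\<close>-nilpotent subgroup with its Hall parts, in a form that visibly passes to
homomorphic images.\<close>

definition hall_decomposition :: "nat set set \<Rightarrow> 'a set \<Rightarrow> (nat set \<Rightarrow> 'a set) \<Rightarrow> bool" where
  "hall_decomposition \<sigma> H A \<longleftrightarrow> subgroup H G \<and>
     (\<forall>\<pi>\<in>\<sigma>. subgroup (A \<pi>) G \<and> A \<pi> \<subseteq> H \<and> normalises H (A \<pi>) \<and> pi_number \<pi> (card (A \<pi>)) \<and>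
        (\<forall>p\<in>\<pi>. prime p \<longrightarrow> \<not> p dvd index H (A \<pi>)))"

lemma hall_decompositionD:
  assumes "hall_decomposition \<sigma> H A"
  shows "subgroup H G"
    and "\<And>\<pi>. \<pi> \<in> \<sigma> \<Longrightarrow> subgroup (A \<pi>) G" "\<And>\<pi>. \<pi> \<in> \<sigma> \<Longrightarrow> A \<pi> \<subseteq> H"
    "\<And>\<pi>. \<pi> \<in> \<sigma> \<Longrightarrow> normalises H (A \<pi>)" "\<And>\<pi>. \<pi> \<in> \<sigma> \<Longrightarrow> pi_number \<pi> (card (A \<pi>))"
    "\<And>\<pi> p. \<pi> \<in> \<sigma> \<Longrightarrow> p \<in> \<pi> \<Longrightarrow> prime p \<Longrightarrow> \<not> p dvd index H (A \<pi>)"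
  using assms unfolding hall_decomposition_def by auto

lemma hall_decomposition_absorbs:
  assumes h: "hall_decomposition \<sigma> H A" and pi: "\<pi> \<in> \<sigma>" and V: "subgroup V G" "V \<subseteq> H" "pi_number \<pi> (card V)"
  shows "V \<subseteq> A \<pi>"
  by (rule coprime_normalised_subset[OF V(1) hall_decompositionD(2)[OF h pi] hall_decompositionD(1)[OF h] V(2)
        hall_decompositionD(3)[OF h pi] normalises_mono[OF hall_decompositionD(4)[OF h pi] V(2)]])
    (use pi_number_coprime[OF V(3)] hall_decompositionD(6)[OF h pi] in blast)

lemma hall_decomposition_commute:
  assumes h: "hall_decomposition \<sigma> H A" and "\<pi> \<in> \<sigma>" "\<tau> \<in> \<sigma>" "\<pi> \<inter> \<tau> = {}"
  shows "A \<pi> \<inter> A \<tau> = {\<one>}" "A \<pi> \<subseteq> centraliser (A \<tau>)"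
proof -
  show "A \<pi> \<inter> A \<tau> = {\<one>}"
    using coprime_subgroups_inter hall_decompositionD(2,5)[OF h] assms pi_number_disjoint_coprime by metis
  then show "A \<pi> \<subseteq> centraliser (A \<tau>)"
    using normalises_trivial_inter_commute[OF hall_decompositionD(2)[OF h assms(2)] hall_decompositionD(2)[OF h assms(3)]]
      normalises_mono[OF hall_decompositionD(4)[OF h assms(2)] hall_decompositionD(3)[OF h assms(3)]]
      normalises_mono[OF hall_decompositionD(4)[OF h assms(3)] hall_decompositionD(3)[OF h assms(2)]] by simp
qed

text \<open>In \<open>G/N\<close> the image of \<open>X\<close> lies in a normal \<open>\<pi>\<close>-subgroup.\<close>

definition pi_normal_over :: "nat set \<Rightarrow> 'a set \<Rightarrow> 'a set \<Rightarrow> bool" where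
  "pi_normal_over \<pi> N X \<longleftrightarrow> (\<exists>M. M \<lhd> G \<and> N \<subseteq> M \<and> X \<subseteq> M \<and> pi_number \<pi> (index M N))"

lemma pi_normal_over_trivial:
  "pi_normal_over \<pi> {\<one>} X \<longleftrightarrow> (\<exists>M. M \<lhd> G \<and> X \<subseteq> M \<and> pi_number \<pi> (card M))"
  unfolding pi_normal_over_def using subgroup.one_closed[OF normalD(1)] by auto

text \<open>A subgroup of prime order \<open>p \<notin> \<pi>\<close> in \<open>M1 \<inter> M2\<close> would lie in \<open>N1\<close> and in \<open>N2\<close>.\<close>

lemma pi_normal_over_inter:
  assumes N: "N1 \<lhd> G" "N2 \<lhd> G" "N1 \<inter> N2 = {\<one>}" and o: "pi_normal_over \<pi> N1 X" "pi_normal_over \<pi> N2 X"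
  shows "pi_normal_over \<pi> {\<one>} X"
proof -
  obtain M1 where M1: "M1 \<lhd> G" "N1 \<subseteq> M1" "X \<subseteq> M1" "pi_number \<pi> (index M1 N1)"
    using o(1) unfolding pi_normal_over_def by auto
  obtain M2 where M2: "M2 \<lhd> G" "N2 \<subseteq> M2" "X \<subseteq> M2" "pi_number \<pi> (index M2 N2)"
    using o(2) unfolding pi_normal_over_def by auto
  have I: "subgroup (M1 \<inter> M2) G" using subgroup_Int normalD M1 M2 by blast
  have sub: "V \<subseteq> N'"
    if p: "prime p" "p \<notin> \<pi>" and V: "subgroup V G" "card V = p" and N': "N' \<lhd> G" and M': "M' \<lhd> G" "N' \<subseteq> M'" "V \<subseteq> M'"
      "pi_number \<pi> (index M' N')" for p V N' M'
  proof (rule coprime_normalised_subset[OF V(1) normalD(1)[OF N'] normalD(1)[OF M'(1)] M'(3,2)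
        normalises_mono[OF normalD(2)[OF N'] subgroup.subset[OF V(1)]]])
    show "coprime (card V) (index M' N')"
      using M'(4) p prime_imp_coprime[OF p(1)] unfolding V(2) pi_number_def by blast
  qed
  have "pi_number \<pi> (card (M1 \<inter> M2))"
  proof (rule pi_number_of_no_prime_subgroup[OF I])
    fix p V assume p: "prime p" "p \<notin> \<pi>" and V: "subgroup V G" "V \<subseteq> M1 \<inter> M2" "card V = p"
    have "V \<subseteq> N1" "V \<subseteq> N2"
      using sub[OF p V(1,3) N(1) M1(1,2) _ M1(4)] sub[OF p V(1,3) N(2) M2(1,2) _ M2(4)] V(2) by auto
    then have "V \<subseteq> {\<one>}" using N(3) by auto
    then have "card V \<le> 1" using card_mono[of "{\<one>}" V] by simp
    then show False using V(3) prime_gt_1_nat[OF p(1)] by simp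
  qed
  moreover have "M1 \<inter> M2 \<lhd> G" using normalI_normalises[OF I] normalises_Int normalD(2) M1 M2 by blast
  ultimately show ?thesis unfolding pi_normal_over_trivial using M1 M2 by blast
qed

text \<open>The third permutability notion together with a choice of the projectors.\<close>

definition permutable_setting :: "nat set set \<Rightarrow> 'a set \<Rightarrow> (nat set \<Rightarrow> 'a set) \<Rightarrow> (nat set \<Rightarrow> 'a set) \<Rightarrow> bool" where
  "permutable_setting \<sigma> H A P \<longleftrightarrow> partition_of_primes \<sigma> \<and> hall_decomposition \<sigma> H A \<and>
     (\<forall>\<pi>\<in>\<sigma>. projector \<pi> (P \<pi>) \<and> (\<forall>x\<in>carrier G. H <#> conjugate G (P \<pi>) x = conjugate G (P \<pi>) x <#> H))"

text \<open>For \<open>\<tau> \<noteq> \<rho>\<close> the part \<open>A \<tau>\<close> lies in every conjugate of the \<open>\<tau>\<close>-projector, so in their intersection, which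
is a normal \<open>\<tau>\<close>-subgroup.\<close>

lemma pi_normal_over_of_primary_normal:
  assumes s: "permutable_setting \<sigma> H A P" and N: "N \<lhd> G" and rho: "\<rho> \<in> \<sigma>" "pi_number \<rho> (card N)"
    and o: "\<And>\<pi>. \<pi> \<in> \<sigma> \<Longrightarrow> pi_normal_over \<pi> N (A \<pi>)" and tau: "\<tau> \<in> \<sigma>"
  shows "pi_normal_over \<tau> {\<one>} (A \<tau>)"
proof (cases "\<tau> = \<rho>")
  case True
  obtain M where M: "M \<lhd> G" "N \<subseteq> M" "A \<tau> \<subseteq> M" "pi_number \<tau> (index M N)"
    using o[OF tau] unfolding pi_normal_over_def by auto
  have "pi_number \<tau> (card M)"
    using card_index[OF normalD(1)[OF N] normalD(1)[OF M(1)] M(2)] M(4) rho True pi_number_mult by metis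
  then show ?thesis unfolding pi_normal_over_trivial using M by auto
next
  case False
  have h: "hall_decomposition \<sigma> H A" using s unfolding permutable_setting_def by auto
  have part: "partition_of_primes \<sigma>" using s unfolding permutable_setting_def by auto
  have disj: "\<rho> \<inter> \<tau> = {}" using partition_disjoint[OF part rho(1) tau] False by auto
  have H: "subgroup H G" using hall_decompositionD(1)[OF h] .
  obtain M where M: "M \<lhd> G" "N \<subseteq> M" "A \<tau> \<subseteq> M" "pi_number \<tau> (index M N)"
    using o[OF tau] unfolding pi_normal_over_def by auto
  have Pt: "projector \<tau> (P \<tau>)" using s tau unfolding permutable_setting_def by auto
  note Ns = normalD[OF N]
  have "A \<tau> \<subseteq> conjugate G (P \<tau>) x" if x: "x \<in> carrier G" for x
  proof
    fix a assume a: "a \<in> A \<tau>"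
    let ?Q = "conjugate G (P \<tau>) x"
    have Q: "projector \<tau> ?Q" using projector_conjugate[OF Pt x] .
    note Qs = projector_subgroup[OF Q]
    have perm: "H <#> ?Q = ?Q <#> H" using s tau x unfolding permutable_setting_def by auto
    have HQ: "subgroup (H <#> ?Q) G" using set_mult_subgroup_iff[OF H Qs] perm by simp
    \<comment> \<open>The \<open>\<rho>\<close>-group \<open>HQ \<inter> N\<close> is normal in \<open>HQ\<close>, hence contained in the Hall part \<open>A \<rho>\<close>, which commutes
      with \<open>A \<tau>\<close>. Writing \<open>a = gn\<close> with \<open>g \<in> Q\<close> and \<open>n \<in> N\<close>, the element \<open>g\<close> of the \<open>\<tau>\<close>-group \<open>Q\<close>
      is a product of the commuting elements \<open>a\<close> and \<open>inv n\<close> of coprime orders, so \<open>n = 1\<close>.\<close>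
    let ?V = "(H <#> ?Q) \<inter> N"
    have Vs: "subgroup ?V G" using subgroup_Int[OF HQ Ns(1)] .
    have cop: "coprime (card N) (card ?Q)"
      using pi_number_disjoint_coprime[OF rho(2) projector_pi_number[OF Q] disj] .
    have VN: "card ?V dvd card N" using subgroup_card_dvd[OF Vs Ns(1)] by auto
    have "?V \<subseteq> H"
    proof (rule normalised_pi_subgroup_of_product[OF H Qs HQ Vs])
      show "normalises H ?V"
        using normalises_Int normalises_mono[OF normalises_self[OF HQ] sub_set_mult_left[OF H Qs]]
          normalises_mono[OF Ns(2) subgroup.subset[OF H]] by blast
      show "coprime (card ?V) (card ?Q)" using cop VN by (meson coprime_divisors dvd_refl)
    qed auto
    then have V: "?V \<subseteq> A \<rho>"
      using hall_decomposition_absorbs[OF h rho(1) Vs] rho(2) VN pi_number_dvd by blast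
    have "a \<in> ?Q <#> N" using projector_covers[OF Q N M(1,2,4)] M(3) a by auto
    then obtain g n where gn: "g \<in> ?Q" "n \<in> N" "a = g \<otimes> n" using set_mult_iff by auto
    have c: "g \<in> carrier G" "n \<in> carrier G" using gn sub_carrier[OF Qs] Ns by auto
    have aH: "a \<in> H" using a hall_decompositionD(3)[OF h tau] by auto
    have "n = inv g \<otimes> a" using gn c by simp
    then have "n \<in> H <#> ?Q" using perm set_multI[of "inv g" ?Q a H] subgroup.m_inv_closed[OF Qs gn(1)] aH by simp
    then have nA: "n \<in> A \<rho>" using V gn by auto
    have ga: "g = a \<otimes> inv n" using gn c by (simp add: m_assoc)
    have ac: "a \<in> carrier G" using aH sub_carrier[OF H] by auto
    have nA': "inv n \<in> A \<rho>" using subgroup.m_inv_closed[OF hall_decompositionD(2)[OF h rho(1)] nA] .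
    have comm: "a \<otimes> inv n = inv n \<otimes> a"
      using hall_decomposition_commute(2)[OF h rho(1) tau disj] nA' a unfolding centraliser_def by auto
    let ?e = "card ?Q"
    have pow: "x [^] card S = \<one>" if S: "subgroup S G" "x \<in> S" for x S
    proof -
      interpret S: group "G\<lparr>carrier := S\<rparr>" by (rule subgroup_imp_group[OF S(1)])
      have "x [^]\<^bsub>G\<lparr>carrier := S\<rparr>\<^esub> order (G\<lparr>carrier := S\<rparr>) = \<one>"
        using S.pow_order_eq_1[of x] S by simp
      then show ?thesis unfolding order_def by (simp add: nat_pow_def)
    qed
    have "g [^] ?e = a [^] ?e \<otimes> inv n [^] ?e" unfolding ga using pow_mult_distrib[OF comm ac] c by simp
    then have "\<one> = a [^] ?e \<otimes> inv (n [^] ?e)" using pow[OF Qs gn(1)] c by (simp add: nat_pow_inv)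
    then have ane: "a [^] ?e = n [^] ?e" using ac c by (metis inv_equality inv_inv inv_closed nat_pow_closed)
    have powin: "x [^] k \<in> S" if "subgroup S G" "x \<in> S" for x S and k :: nat
      by (induction k) (use that subgroup.one_closed[OF that(1)] subgroup.m_closed[OF that(1)] in auto)
    have "n [^] ?e \<in> A \<rho> \<inter> A \<tau>"
      using powin[OF hall_decompositionD(2)[OF h rho(1)] nA, of ?e] powin[OF hall_decompositionD(2)[OF h tau] a, of ?e] ane by simp
    then have "n [^] ?e = \<one>" using hall_decomposition_commute(1)[OF h rho(1) tau disj] by simp
    moreover have "n [^] card N = \<one>" using pow[OF Ns(1) gn(2)] .
    ultimately have "ord n dvd ?e" "ord n dvd card N" using pow_eq_id[OF c(2)] by auto
    then have "ord n = 1" using cop by (metis coprime_common_divisor_nat)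
    then have "n = \<one>" using ord_eq_1[OF c(2)] by simp
    then show "a \<in> ?Q" using gn c by simp
  qed
  then have sub: "A \<tau> \<subseteq> (\<Inter>x\<in>carrier G. conjugate G (P \<tau>) x)" by auto
  have C: "(\<Inter>x\<in>carrier G. conjugate G (P \<tau>) x) \<lhd> G" by (rule normal_core[OF projector_subgroup[OF Pt]])
  have "(\<Inter>x\<in>carrier G. conjugate G (P \<tau>) x) \<subseteq> P \<tau>"
    using conjugate_one[OF subgroup.subset[OF projector_subgroup[OF Pt]]] by blast
  then have "pi_number \<tau> (card (\<Inter>x\<in>carrier G. conjugate G (P \<tau>) x))"
    using subgroup_card_dvd[OF normalD(1)[OF C] projector_subgroup[OF Pt]] projector_pi_number[OF Pt] pi_number_dvd by blast
  then show ?thesis unfolding pi_normal_over_trivial using C sub by blast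
qed

end

context finite_epi
begin

lemma image_permutable_setting:
  assumes s: "dom.permutable_setting \<sigma> H A P"
  shows "cod.permutable_setting \<sigma> (h ` H) (\<lambda>\<pi>. h ` A \<pi>) (\<lambda>\<pi>. h ` P \<pi>)"
  unfolding cod.permutable_setting_def cod.hall_decomposition_def
proof (intro conjI ballI impI)
  have hd: "dom.hall_decomposition \<sigma> H A" using s unfolding dom.permutable_setting_def by simp
  note D = dom.hall_decompositionD[OF hd]
  show "partition_of_primes \<sigma>" using s unfolding dom.permutable_setting_def by simp
  show "subgroup (h ` H) Q" using image_subgroup[OF D(1)] .
  fix \<pi> assume pi: "\<pi> \<in> \<sigma>"
  show "subgroup (h ` A \<pi>) Q" "h ` A \<pi> \<subseteq> h ` H" using image_subgroup[OF D(2)[OF pi]] D(3)[OF pi] by auto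
  show "cod.normalises (h ` H) (h ` A \<pi>)"
    by (rule image_normalises[OF subgroup.subset[OF D(1)] subgroup.subset[OF D(2)[OF pi]] D(4)[OF pi]])
  show "pi_number \<pi> (card (h ` A \<pi>))" using pi_number_dvd[OF D(5)[OF pi] card_image_dvd[OF D(2)[OF pi]]] .
  show "\<not> p dvd cod.index (h ` H) (h ` A \<pi>)" if "p \<in> \<pi>" "prime p" for p
    using D(6)[OF pi that] index_image_dvd[OF D(2)[OF pi] D(1) D(3)[OF pi]] dvd_trans by blast
  have P: "dom.projector \<pi> (P \<pi>)" using s pi unfolding dom.permutable_setting_def by simp
  show "cod.projector \<pi> (h ` P \<pi>)" using image_projector[OF P] .
  fix y assume "y \<in> carrier Q"
  then obtain x where x: "x \<in> carrier G" "y = h x" using onto by auto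
  let ?P = "conjugate G (P \<pi>) x"
  have e: "conjugate Q (h ` P \<pi>) y = h ` ?P"
    using image_conjugate[OF subgroup.subset[OF dom.projector_subgroup[OF P]] x(1)] x(2) by simp
  have c: "?P \<subseteq> carrier G" using subgroup.subset[OF dom.conjugate_subgroup[OF dom.projector_subgroup[OF P] x(1)]] .
  have "H <#>\<^bsub>G\<^esub> ?P = ?P <#>\<^bsub>G\<^esub> H" using s pi x unfolding dom.permutable_setting_def by simp
  then show "h ` H <#>\<^bsub>Q\<^esub> conjugate Q (h ` P \<pi>) y = conjugate Q (h ` P \<pi>) y <#>\<^bsub>Q\<^esub> h ` H"
    unfolding e using image_set_mult[OF c subgroup.subset[OF D(1)]] image_set_mult[OF subgroup.subset[OF D(1)] c] by simp
qed

lemma pi_normal_over_pullback: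
  assumes "cod.pi_normal_over \<pi> {\<one>\<^bsub>Q\<^esub>} (h ` X)" "X \<subseteq> carrier G"
  shows "dom.pi_normal_over \<pi> ker X"
proof -
  obtain M where M: "M \<lhd> Q" "h ` X \<subseteq> M" "pi_number \<pi> (card M)" using assms(1) cod.pi_normal_over_trivial by auto
  have Ms: "subgroup M Q" using cod.normalD[OF M(1)] by auto
  have "dom.index (preimage M) ker = card M"
    using card_image_over[OF preimage_subgroup[OF Ms] ker_preimage[OF Ms]] image_preimage[OF subgroup.subset[OF Ms]] by simp
  then have "pi_number \<pi> (dom.index (preimage M) ker)" using M(3) by simp
  then show ?thesis unfolding dom.pi_normal_over_def
    using preimage_normal[OF M(1)] ker_preimage[OF Ms] M(2) assms(2) unfolding preimage_def by blast
qed

end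

section \<open>A minimal normal subgroup as a product of simple factors\<close>

context finite_group
begin

text \<open>The largest \<open>\<pi>\<close>-subgroup of \<open>N\<close> normal in \<open>N\<close> contains every other one, so it is invariant under \<open>G\<close>.\<close>

lemma pi_radical:
  assumes N: "N \<lhd> G" and T: "subgroup T G" "T \<subseteq> N" "normalises N T" "pi_number \<pi> (card T)" "T \<noteq> {\<one>}"
  obtains K where "K \<lhd> G" "K \<noteq> {\<one>}" "pi_number \<pi> (card K)"
proof -
  note Ns = normalD[OF N]
  define YY where "YY = {Y. subgroup Y G \<and> Y \<subseteq> N \<and> normalises N Y \<and> pi_number \<pi> (card Y)}"
  have TY: "T \<in> YY" unfolding YY_def using T by auto
  have "finite YY" by (rule finite_subset[of _ "Pow N"]) (auto simp: YY_def subgroup_finite[OF Ns(1)])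
  then obtain M where M: "M \<in> YY" and Mmax: "\<And>R. R \<in> YY \<Longrightarrow> M \<subseteq> R \<Longrightarrow> R = M"
    using finite_has_maximal[of YY] TY by (metis empty_iff)
  have Ms: "subgroup M G" "M \<subseteq> N" "normalises N M" "pi_number \<pi> (card M)" using M unfolding YY_def by auto
  have absorb: "Y \<subseteq> M" if Y: "Y \<in> YY" for Y
  proof -
    have Ys: "subgroup Y G" "Y \<subseteq> N" "normalises N Y" "pi_number \<pi> (card Y)" using Y unfolding YY_def by auto
    have MY: "subgroup (M <#> Y) G" "M \<subseteq> M <#> Y" "Y \<subseteq> M <#> Y"
      using normalised_product[OF Ms(1) Ys(1) normalises_mono[OF Ms(3) Ys(2)]] by auto
    have "pi_number \<pi> (card (M <#> Y))" by (rule pi_number_set_mult[OF Ms(1,4) Ys(1,4)])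
    then have "M <#> Y \<in> YY" unfolding YY_def
      using MY set_mult_least[OF Ns(1) Ms(2) Ys(2)]
        normalises_set_mult[OF Ns(3) subgroup.subset[OF Ms(1)] Ms(3) subgroup.subset[OF Ys(1)] Ys(3)] by auto
    then show ?thesis using Mmax MY by auto
  qed
  have "M \<lhd> G"
  proof (intro normalI_normalises normalisesI_conjugate)
    fix g assume g: "g \<in> carrier G"
    have "conjugate G M g \<in> YY" unfolding YY_def
      using conjugate_subgroup[OF Ms(1) g] conjugate_mono[OF Ms(2), of g] conjugate_normal[OF N g]
        normalises_conjugate[OF Ns(3) subgroup.subset[OF Ms(1)] g Ms(3)]
        conjugate_card[OF subgroup.subset[OF Ms(1)] g] Ms(4) by auto
    then show "conjugate G M g \<subseteq> M" by (rule absorb)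
  qed (rule Ms(1))
  moreover have "M \<noteq> {\<one>}" using absorb[OF TY] T(5) subgroup.one_closed[OF T(1)] by auto
  ultimately show ?thesis using that Ms(4) by blast
qed

end

text \<open>A conjugation-invariant set of pairwise commuting simple normal subgroups of \<open>N\<close> that generate \<open>N\<close>.
Trivial centres express that the factors are nonabelian.\<close>

locale simple_factors = finite_group +
  fixes N :: "'a set" and \<T> :: "'a set set"
  assumes N_normal: "N \<lhd> G"
    and factor_subgroup: "S \<in> \<T> \<Longrightarrow> subgroup S G"
    and factor_nontrivial: "S \<in> \<T> \<Longrightarrow> S \<noteq> {\<one>}"
    and factor_normalised: "S \<in> \<T> \<Longrightarrow> normalises N S"
    and factor_simple: "S \<in> \<T> \<Longrightarrow> subgroup X G \<Longrightarrow> X \<subseteq> S \<Longrightarrow> normalises S X \<Longrightarrow> X \<noteq> {\<one>} \<Longrightarrow> X = S"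
    and factor_centreless: "S \<in> \<T> \<Longrightarrow> S \<inter> centraliser S = {\<one>}"
    and factors_commute: "S \<in> \<T> \<Longrightarrow> S' \<in> \<T> \<Longrightarrow> S \<noteq> S' \<Longrightarrow> S \<subseteq> centraliser S'"
    and factor_conjugate: "S \<in> \<T> \<Longrightarrow> g \<in> carrier G \<Longrightarrow> conjugate G S g \<in> \<T>"
    and factors_generate: "generate G (\<Union>\<T>) = N"

begin

lemma factor_sub: "S \<in> \<T> \<Longrightarrow> S \<subseteq> N"
  using generate.incl[of _ "\<Union>\<T>" G] factors_generate by auto

lemma factor_carrier: "S \<in> \<T> \<Longrightarrow> S \<subseteq> carrier G"
  using factor_subgroup subgroup.subset by auto

text \<open>\<open>X\<close> meets \<open>S\<close> trivially, so \<open>X \<inter> N\<close> commutes with \<open>S\<close>. Commutators of \<open>S\<close> with any element of \<open>X\<close> lie in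
\<open>X \<inter> N\<close> again. An element that moved \<open>S\<close> to another factor would therefore make \<open>S\<close> abelian, and one
that normalises \<open>S\<close> has its commutators in \<open>S \<inter> X\<close>.\<close>

lemma centralised_of_not_contained:
  assumes S: "S \<in> \<T>" and X: "subgroup X G" "normalises S X" "\<not> S \<subseteq> X"
  shows "X \<subseteq> centraliser S"
proof
  fix b assume b: "b \<in> X"
  note Ss = factor_subgroup[OF S] and Ns = normalD[OF N_normal]
  have SX: "S \<inter> X = {\<one>}"
  proof (rule ccontr)
    assume "S \<inter> X \<noteq> {\<one>}"
    then have "S \<inter> X = S"
      using factor_simple[OF S subgroup_Int[OF Ss X(1)]] normalises_Int[OF normalises_self[OF Ss] X(2)] by blast
    then show False using X(3) by auto
  qed
  have nS: "normalises S (X \<inter> N)"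
    using normalises_Int[OF X(2) normalises_mono[OF Ns(2) factor_carrier[OF S]]] .
  have XN: "X \<inter> N \<subseteq> centraliser S"
    by (rule normalises_trivial_inter_commute[OF subgroup_Int[OF X(1) Ns(1)] Ss _ nS])
      (use normalises_mono[OF factor_normalised[OF S], of "X \<inter> N"] SX in auto)
  have bc: "b \<in> carrier G" using b sub_carrier[OF X(1)] by auto
  have cen: "s \<otimes> c = c \<otimes> s" if "s \<in> S" "c \<in> X \<inter> N" for s c
    using subsetD[OF XN that(2)] that(1) unfolding centraliser_def by simp
  have key: "inv s \<otimes> (inv b \<otimes> s \<otimes> b) \<in> X \<inter> N" if s: "s \<in> S" for s
  proof
    have sc: "s \<in> carrier G" using s factor_carrier[OF S] by auto
    have "inv s \<otimes> inv b \<otimes> s \<in> X" using normalisesD[OF X(2) s subgroup.m_inv_closed[OF X(1) b]] .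
    then have "inv s \<otimes> inv b \<otimes> s \<otimes> b \<in> X" using subgroup.m_closed[OF X(1)] b by simp
    then show "inv s \<otimes> (inv b \<otimes> s \<otimes> b) \<in> X" using sc bc by (simp add: m_assoc)
    have "s \<in> N" using s factor_sub[OF S] by auto
    then show "inv s \<otimes> (inv b \<otimes> s \<otimes> b) \<in> N"
      using subgroup.m_closed[OF Ns(1)] subgroup.m_inv_closed[OF Ns(1)] normalisesD[OF Ns(2) bc] by simp
  qed
  \<comment> \<open>If \<open>b\<close> moved \<open>S\<close> to another factor, that factor would centralise \<open>S\<close>, and so would each \<open>s \<in> S\<close>, as the
    quotient of its conjugate by a commutator.\<close>
  have Sb: "conjugate G S b = S"
  proof (rule ccontr)
    assume ne: "conjugate G S b \<noteq> S"
    have cS: "conjugate G S b \<subseteq> centraliser S"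
      using factors_commute[OF factor_conjugate[OF S bc] S ne] .
    have "S \<subseteq> centraliser S"
    proof
      fix s assume s: "s \<in> S"
      have sc: "s \<in> carrier G" using s factor_carrier[OF S] by auto
      let ?d = "inv b \<otimes> s \<otimes> b"
      have C: "subgroup (centraliser S) G" using centraliser_subgroup[OF factor_carrier[OF S]] .
      have d: "?d \<in> centraliser S" using cS conjugate_memI[OF s] by auto
      have c: "inv s \<otimes> ?d \<in> centraliser S" using key[OF s] XN by auto
      have "s = ?d \<otimes> inv (inv s \<otimes> ?d)" using sc bc by (simp add: inv_mult_group m_assoc)
      then show "s \<in> centraliser S"
        using subgroup.m_closed[OF C d subgroup.m_inv_closed[OF C c]] by simp
    qed
    then show False using factor_centreless[OF S] factor_nontrivial[OF S] by auto
  qed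
  have "b \<otimes> s = s \<otimes> b" if s: "s \<in> S" for s
  proof -
    have sc: "s \<in> carrier G" using s factor_carrier[OF S] by auto
    let ?d = "inv b \<otimes> s \<otimes> b"
    have "?d \<in> S" using conjugate_memI[OF s, of b] Sb by simp
    then have "inv s \<otimes> ?d \<in> S" using subgroup.m_closed[OF Ss subgroup.m_inv_closed[OF Ss s]] by simp
    then have "inv s \<otimes> ?d = \<one>" using key[OF s] SX by auto
    then have "s \<otimes> (inv s \<otimes> ?d) = s" using sc by simp
    then have "?d = s" using sc bc by simp
    then have "b \<otimes> ?d = b \<otimes> s" by simp
    then show ?thesis using sc bc by (simp add: m_assoc)
  qed
  then show "b \<in> centraliser S" unfolding centraliser_def using bc by blast
qed

end

context finite_group
begin

text \<open>The hypotheses make a minimal normal subgroup \<open>N\<close> unique and free of nontrivial normal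
\<open>\<pi>\<close>-subgroups for \<open>\<pi> \<in> \<sigma>\<close>; in particular its centre and its centraliser are trivial.\<close>

lemma exists_simple_factors:
  assumes part: "partition_of_primes \<sigma>" and nt: "carrier G \<noteq> {\<one>}"
    and noprim: "\<And>K \<pi>. \<lbrakk>K \<lhd> G; \<pi> \<in> \<sigma>; pi_number \<pi> (card K)\<rbrakk> \<Longrightarrow> K = {\<one>}"
    and int: "\<And>K L. \<lbrakk>K \<lhd> G; L \<lhd> G; K \<inter> L = {\<one>}\<rbrakk> \<Longrightarrow> K = {\<one>} \<or> L = {\<one>}"
  obtains N \<T> n where "simple_factors G N \<T>" "centraliser N = {\<one>}" "N \<noteq> {\<one>}"
    "\<forall>S\<in>\<T>. card S = n" "\<forall>\<pi>\<in>\<sigma>. \<not> pi_number \<pi> n"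
proof -
  obtain N where N: "N \<lhd> G" "N \<noteq> {\<one>}" and Nmin': "\<And>K. K \<lhd> G \<Longrightarrow> K \<noteq> {\<one>} \<Longrightarrow> card N \<le> card K"
    using arg_min_nat_lemma[of "\<lambda>N. N \<lhd> G \<and> N \<noteq> {\<one>}" "carrier G" card] nt normal_self by blast
  note Ns = normalD[OF N(1)]
  have Nmin: "K = N" if "K \<lhd> G" "K \<noteq> {\<one>}" "K \<subseteq> N" for K
    using card_seteq[OF subgroup_finite[OF Ns(1)] that(3)] Nmin' that by auto
  have npi: "T = {\<one>}" if "subgroup T G" "T \<subseteq> N" "normalises N T" "\<pi> \<in> \<sigma>" "pi_number \<pi> (card T)" for T \<pi>
    by (rule ccontr) (use pi_radical[OF N(1) that(1-3,5)] noprim that(4) in metis)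
  \<comment> \<open>A subgroup of prime order in the centre of \<open>N\<close> would be normal in \<open>N\<close>.\<close>
  have ZN: "N \<inter> centraliser N = {\<one>}"
  proof (rule ccontr)
    assume ne: "\<not> ?thesis"
    have Z: "subgroup (N \<inter> centraliser N) G" using subgroup_Int Ns(1) centraliser_subgroup[OF Ns(3)] by blast
    obtain p where p: "prime p" "p dvd card (N \<inter> centraliser N)" by (rule nontrivial_prime[OF Z ne])
    obtain V where V: "subgroup V G" "V \<subseteq> N \<inter> centraliser N" "card V = p"
      by (rule exists_subgroup_of_prime_card[OF Z p])
    obtain \<pi> where pi: "\<pi> \<in> \<sigma>" "p \<in> \<pi>" using partition_cover[OF part p(1)] by auto
    have "N \<subseteq> centraliser V"
      using centraliser_sym[OF subgroup.subset[OF V(1)] Ns(3)] V(2) by auto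
    then have "V = {\<one>}"
      using npi[OF V(1) _ centraliser_normalises[OF subgroup.subset[OF V(1)]] pi(1)]
        prime_subgroup_pi_number[OF V(3) p(1) pi(2)] V(2) by auto
    then show False using V(3) prime_gt_1_nat[OF p(1)] by simp
  qed
  have CN: "centraliser N = {\<one>}" using int[OF N(1) centraliser_normal[OF N(1)] ZN] N(2) by auto
  \<comment> \<open>The factors are the conjugates of a minimal nontrivial \<open>T\<close> normal in \<open>N\<close>.\<close>
  define Q where "Q T \<longleftrightarrow> subgroup T G \<and> T \<subseteq> N \<and> normalises N T \<and> T \<noteq> {\<one>}" for T
  have QN: "Q N" unfolding Q_def using Ns N(2) normalises_self by auto
  obtain T where T: "Q T" and Tmin: "\<And>X. Q X \<Longrightarrow> card T \<le> card X"
    using arg_min_nat_lemma[of Q N card] QN by blast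
  have Ts: "subgroup T G" "T \<subseteq> N" "normalises N T" "T \<noteq> {\<one>}" using T unfolding Q_def by auto
  define \<T> where "\<T> = (\<lambda>g. conjugate G T g) ` carrier G"
  have Tc: "T \<subseteq> carrier G" using subgroup.subset[OF Ts(1)] .
  have S_card: "card S = card T" if "S \<in> \<T>" for S using that conjugate_card[OF Tc] unfolding \<T>_def by auto
  have S_Q: "Q S" if S: "S \<in> \<T>" for S
  proof -
    obtain g where g: "g \<in> carrier G" "S = conjugate G T g" using S unfolding \<T>_def by auto
    have "card S > 1" using S_card[OF S] card_gt_one[OF Ts(1,4)] by simp
    then have "S \<noteq> {\<one>}" by auto
    moreover have "normalises N S"
      using normalises_conjugate[OF Ns(3) Tc g(1) Ts(3)] conjugate_normal[OF N(1) g(1)] g(2) by simp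
    moreover have "S \<subseteq> N" using conjugate_mono[OF Ts(2), of g] conjugate_normal[OF N(1) g(1)] g(2) by simp
    ultimately show ?thesis unfolding Q_def using conjugate_subgroup[OF Ts(1) g(1)] g(2) by simp
  qed
  have Ss: "subgroup S G" "S \<subseteq> N" "normalises N S" "S \<noteq> {\<one>}" if "S \<in> \<T>" for S
    using S_Q[OF that] unfolding Q_def by auto
  have S_min: "X = S" if S: "S \<in> \<T>" and X: "Q X" "X \<subseteq> S" for S X
    using card_seteq[OF subgroup_finite[OF Ss(1)[OF S]] X(2)] Tmin[OF X(1)] S_card[OF S] by simp
  have commute: "S \<subseteq> centraliser S'" if S: "S \<in> \<T>" "S' \<in> \<T>" "S \<noteq> S'" for S S'
  proof -
    have "S \<inter> S' = {\<one>}"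
    proof (rule ccontr)
      assume "S \<inter> S' \<noteq> {\<one>}"
      then have "Q (S \<inter> S')"
        unfolding Q_def using Ss[OF S(1)] Ss[OF S(2)] subgroup_Int normalises_Int by auto
      then have "S \<inter> S' = S" "S \<inter> S' = S'" using S_min S by auto
      then show False using S(3) by simp
    qed
    then show ?thesis
      using normalises_trivial_inter_commute[OF Ss(1)[OF S(1)] Ss(1)[OF S(2)] normalises_mono[OF Ss(3)[OF S(2)] Ss(2)[OF S(1)]]
          normalises_mono[OF Ss(3)[OF S(1)] Ss(2)[OF S(2)]]] by simp
  qed
  have conj: "conjugate G S g \<in> \<T>" if S: "S \<in> \<T>" "g \<in> carrier G" for S g
  proof -
    obtain x where x: "x \<in> carrier G" "S = conjugate G T x" using S unfolding \<T>_def by auto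
    show ?thesis unfolding \<T>_def x(2) conjugate_conjugate[OF Tc x(1) S(2)] using x S by auto
  qed
  have TT: "T \<in> \<T>" unfolding \<T>_def using conjugate_one[OF Tc] by (metis image_eqI one_closed)
  have UT: "\<Union>\<T> \<subseteq> N" "\<Union>\<T> \<subseteq> carrier G" using Ss(2) Ns(3) by auto
  have gen: "generate G (\<Union>\<T>) = N"
  proof (rule Nmin)
    show "generate G (\<Union>\<T>) \<subseteq> N" using generate_subgroup_incl[OF UT(1) Ns(1)] .
    have "T \<subseteq> generate G (\<Union>\<T>)" using TT generate.incl[of _ "\<Union>\<T>" G] by auto
    then show "generate G (\<Union>\<T>) \<noteq> {\<one>}" using Ts(4) subgroup.one_closed[OF Ts(1)] by auto
    show "generate G (\<Union>\<T>) \<lhd> G"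
    proof (intro normalI_normalises normalisesI_conjugate)
      show "subgroup (generate G (\<Union>\<T>)) G" using generate_is_subgroup[OF UT(2)] .
      fix g assume g: "g \<in> carrier G"
      have "conjugate G (\<Union>\<T>) g \<subseteq> \<Union>\<T>" using conj[OF _ g] unfolding conjugate_eq by blast
      then show "conjugate G (generate G (\<Union>\<T>)) g \<subseteq> generate G (\<Union>\<T>)"
        unfolding conjugate_generate[OF UT(2) g] using mono_generate by blast
    qed
  qed
  \<comment> \<open>A normal subgroup of one factor is centralised by the others, hence normal in \<open>N\<close>.\<close>
  have simple: "X = S" if S: "S \<in> \<T>" and X: "subgroup X G" "X \<subseteq> S" "normalises S X" "X \<noteq> {\<one>}" for S X
  proof (rule S_min[OF S _ X(2)])
    have "normalises S' X" if S': "S' \<in> \<T>" for S'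
    proof (cases "S' = S")
      case False
      have "S' \<subseteq> centraliser X" using commute[OF S' S False] centraliser_antimono[OF X(2)] by auto
      then show ?thesis using centraliser_normalises[OF subgroup.subset[OF X(1)]] by simp
    qed (use X in simp)
    then have "\<Union>\<T> \<subseteq> normaliser X" using normalises_normaliser Ss(1) X(1) by blast
    then have "N \<subseteq> normaliser X"
      using generate_subgroup_incl[OF _ normaliser_subgroup[OF subgroup.subset[OF X(1)]]] gen by auto
    then have "normalises N X" by (rule normaliser_normalises)
    then show "Q X" unfolding Q_def using X Ss(2)[OF S] by auto
  qed
  have centreless: "S \<inter> centraliser S = {\<one>}" if S: "S \<in> \<T>" for S
  proof -
    let ?Z = "S \<inter> centraliser S"
    have Sc: "S \<subseteq> carrier G" using subgroup.subset[OF Ss(1)[OF S]] .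
    have Zc: "?Z \<subseteq> carrier G" using Sc by auto
    have "S' \<subseteq> centraliser ?Z" if S': "S' \<in> \<T>" for S'
    proof (cases "S' = S")
      case True
      then show ?thesis using centraliser_sym[OF Zc Sc] by auto
    next
      case False
      then show ?thesis using commute[OF S' S] centraliser_antimono[of ?Z S] by auto
    qed
    then have "N \<subseteq> centraliser ?Z"
      using generate_subgroup_incl[OF _ centraliser_subgroup[OF Zc], of "\<Union>\<T>"] gen by auto
    then have "?Z \<subseteq> centraliser N" using centraliser_sym[OF Ns(3) Zc] by simp
    then show ?thesis using CN subgroup.one_closed[OF Ss(1)[OF S]]
        subgroup.one_closed[OF centraliser_subgroup[OF Sc]] by auto
  qed
  have sf: "simple_factors G N \<T>"
    by (rule simple_factors.intro[OF finite_group_axioms], rule simple_factors_axioms.intro)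
      (fact N(1) Ss(1) Ss(3) Ss(4) simple centreless commute conj gen)+
  have "\<not> pi_number \<pi> (card T)" if "\<pi> \<in> \<sigma>" for \<pi>
    using npi[OF Ts(1-3) that] Ts(4) by auto
  then show ?thesis using that[OF sf CN N(2)] S_card by blast
qed

end

section \<open>Kegel's maximality argument\<close>

context simple_factors
begin

definition moved_factors :: "'a set \<Rightarrow> 'a set set" where
  "moved_factors H = {S \<in> \<T>. \<not> H \<subseteq> centraliser S}"

text \<open>Below, \<open>J\<close> denotes this group. By \<open>moved_hull_least_normalised\<close> the normal closure of \<open>H\<close> in \<open>J\<close> is all of \<open>J\<close>,
which is the property that the maximality argument exploits.\<close>

definition moved_hull :: "'a set \<Rightarrow> 'a set" where
  "moved_hull H = H <#> generate G (\<Union>(moved_factors H))"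

lemma moved_hull_facts:
  assumes H: "subgroup H G"
  shows "subgroup (moved_hull H) G" "H \<subseteq> moved_hull H" "S \<in> moved_factors H \<Longrightarrow> S \<subseteq> moved_hull H"
    and "subgroup X G \<Longrightarrow> H \<subseteq> X \<Longrightarrow> (\<And>S. S \<in> moved_factors H \<Longrightarrow> S \<subseteq> X) \<Longrightarrow> moved_hull H \<subseteq> X"
    and "subgroup B G \<Longrightarrow> (\<And>S. S \<in> moved_factors H \<Longrightarrow> S \<subseteq> B) \<Longrightarrow> moved_hull H \<subseteq> H <#> B"
proof -
  let ?U = "\<Union>(moved_factors H)"
  let ?R = "generate G ?U"
  have U: "?U \<subseteq> carrier G" using factor_carrier unfolding moved_factors_def by auto
  have R: "subgroup ?R G" using generate_is_subgroup[OF U] .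
  \<comment> \<open>Conjugation by an element of \<open>H\<close> permutes the factors that \<open>H\<close> does not centralise.\<close>
  have n: "normalises H ?R"
  proof (rule normalisesI_conjugate)
    fix x assume x: "x \<in> H"
    have xc: "x \<in> carrier G" using sub_carrier[OF H x] .
    have "conjugate G S x \<in> moved_factors H" if S: "S \<in> moved_factors H" for S
    proof -
      have S': "S \<in> \<T>" "\<not> H \<subseteq> centraliser S" using S unfolding moved_factors_def by auto
      have "\<not> H \<subseteq> centraliser (conjugate G S x)"
      proof
        assume c: "H \<subseteq> centraliser (conjugate G S x)"
        have "k \<in> centraliser S" if k: "k \<in> H" for k
        proof -
          have kc: "k \<in> carrier G" using sub_carrier[OF H k] .
          have kx: "inv x \<otimes> k \<otimes> x \<in> H" using normalisesD[OF normalises_self[OF H] x k] .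
          have "k \<otimes> s = s \<otimes> k" if s: "s \<in> S" for s
          proof -
            have sc: "s \<in> carrier G" using s factor_carrier[OF S'(1)] by auto
            have "(inv x \<otimes> k \<otimes> x) \<otimes> (inv x \<otimes> s \<otimes> x) = (inv x \<otimes> s \<otimes> x) \<otimes> (inv x \<otimes> k \<otimes> x)"
              using subsetD[OF c kx] conjugate_memI[OF s, of x] unfolding centraliser_def by simp
            then show ?thesis
              using conj_mult[OF xc kc sc] conj_mult[OF xc sc kc] conjugate_cong[OF xc, of "k \<otimes> s" "s \<otimes> k"] kc sc by simp
          qed
          then show ?thesis unfolding centraliser_def using kc by blast
        qed
        then show False using S'(2) by auto
      qed
      then show ?thesis using factor_conjugate[OF S'(1) xc] unfolding moved_factors_def by auto
    qed
    then have "conjugate G ?U x \<subseteq> ?U" unfolding conjugate_eq by blast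
    then show "conjugate G ?R x \<subseteq> ?R" unfolding conjugate_generate[OF U xc] by (rule mono_generate)
  qed
  show 1: "subgroup (moved_hull H) G" unfolding moved_hull_def using normalises_subgroup[OF R H n] by simp
  show "H \<subseteq> moved_hull H" unfolding moved_hull_def using sub_set_mult_left[OF H R] .
  show "S \<subseteq> moved_hull H" if "S \<in> moved_factors H"
    unfolding moved_hull_def using sub_set_mult_right[OF H R] that generate.incl[of _ ?U G] by auto
  show "moved_hull H \<subseteq> X" if "subgroup X G" "H \<subseteq> X" "\<And>S. S \<in> moved_factors H \<Longrightarrow> S \<subseteq> X"
    unfolding moved_hull_def
    by (rule set_mult_least[OF that(1,2) generate_subgroup_incl[OF _ that(1)]]) (use that(3) in auto)
  show "moved_hull H \<subseteq> H <#> B" if "subgroup B G" "\<And>S. S \<in> moved_factors H \<Longrightarrow> S \<subseteq> B"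
    unfolding moved_hull_def
    by (rule mono_set_mult[OF subset_refl generate_subgroup_incl[OF _ that(1)]]) (use that(2) in auto)
qed

lemma moved_factors_nonempty:
  assumes H: "subgroup H G" "H \<noteq> {\<one>}" and C: "centraliser N = {\<one>}"
  shows "moved_factors H \<noteq> {}"
proof
  assume e: "moved_factors H = {}"
  have Hc: "H \<subseteq> carrier G" using subgroup.subset[OF H(1)] .
  have "S \<subseteq> centraliser H" if "S \<in> \<T>" for S
    using that e centraliser_sym[OF Hc factor_carrier[OF that]] unfolding moved_factors_def by auto
  then have "N \<subseteq> centraliser H"
    using generate_subgroup_incl[OF _ centraliser_subgroup[OF Hc], of "\<Union>\<T>"] factors_generate by auto
  then have "H \<subseteq> {\<one>}" using centraliser_sym[OF normalD(3)[OF N_normal] Hc] C by simp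
  then show False using H subgroup.one_closed[OF H(1)] by auto
qed

text \<open>A factor not contained in \<open>X\<close> would be centralised by \<open>X\<close>, hence by \<open>H\<close>.\<close>

lemma moved_hull_least_normalised:
  assumes H: "subgroup H G" and X: "subgroup X G" "H \<subseteq> X" "normalises (moved_hull H) X"
  shows "moved_hull H \<subseteq> X"
proof (rule moved_hull_facts(4)[OF H X(1,2)])
  fix S assume S: "S \<in> moved_factors H"
  then have S': "S \<in> \<T>" "\<not> H \<subseteq> centraliser S" unfolding moved_factors_def by auto
  have "normalises S X" using normalises_mono[OF X(3) moved_hull_facts(3)[OF H S]] .
  then show "S \<subseteq> X" using centralised_of_not_contained[OF S'(1) X(1)] S'(2) X(2) by blast
qed

text \<open>This follows the pattern of Kegel's proof that a subgroup permuting with all Sylow subgroups is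
subnormal. A counterexample \<open>P\<close> is replaced by a largest subgroup with the same permutability that contains a
conjugate of \<open>P\<close> and still has \<open>J\<close> outside its product with \<open>H\<close>.\<close>

lemma moved_hull_in_product:
  assumes H: "subgroup H G" and P: "projector \<pi> P"
    and perm: "\<And>x. x \<in> carrier G \<Longrightarrow> H <#> conjugate G P x = conjugate G P x <#> H"
    and p: "prime p" "p \<in> \<pi>" "\<And>S. S \<in> \<T> \<Longrightarrow> p dvd card S"
  shows "moved_hull H \<subseteq> H <#> P"
proof (rule ccontr)
  assume nJ: "\<not> ?thesis"
  let ?J = "moved_hull H"
  note Js = moved_hull_facts[OF H]
  have Hc: "H \<subseteq> carrier G" using subgroup.subset[OF H] .
  have Pc: "P \<subseteq> carrier G" using subgroup.subset[OF projector_subgroup[OF P]] .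
  \<comment> \<open>The subgroups that compete with \<open>P\<close>. The family is closed under conjugation by elements of \<open>J\<close>, and a
    member of largest order is normalised by \<open>H\<close>.\<close>
  define Pr where "Pr B \<longleftrightarrow> subgroup B G \<and> (\<forall>g\<in>carrier G. H <#> conjugate G B g = conjugate G B g <#> H) \<and>
      \<not> ?J \<subseteq> H <#> B \<and> (\<exists>g\<in>carrier G. conjugate G P g \<subseteq> B)" for B
  have "\<exists>g\<in>carrier G. conjugate G P g \<subseteq> P" using conjugate_one[OF Pc] by (intro bexI[of _ \<one>]) auto
  then have PrP: "Pr P" unfolding Pr_def using projector_subgroup[OF P] perm nJ by auto
  have bound: "\<forall>B. Pr B \<longrightarrow> card B < Suc (card (carrier G))"
    using card_mono[OF finite_carrier] subgroup.subset unfolding Pr_def by (metis less_Suc_eq_le)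
  obtain B where B: "Pr B" and Bmax: "\<And>C. Pr C \<Longrightarrow> card C \<le> card B"
    using ex_has_greatest_nat[of Pr P card "Suc (card (carrier G))"] PrP bound by blast
  have PrD: "subgroup B G" "B \<subseteq> carrier G" "\<And>g. g \<in> carrier G \<Longrightarrow> H <#> conjugate G B g = conjugate G B g <#> H"
      "\<not> ?J \<subseteq> H <#> B" "H <#> B = B <#> H" if "Pr B" for B
  proof -
    show 1: "subgroup B G" "\<And>g. g \<in> carrier G \<Longrightarrow> H <#> conjugate G B g = conjugate G B g <#> H" "\<not> ?J \<subseteq> H <#> B"
      using that unfolding Pr_def by auto
    show 2: "B \<subseteq> carrier G" using subgroup.subset[OF 1(1)] .
    show "H <#> B = B <#> H" using 1(2)[of \<one>] conjugate_one[OF 2] by simp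
  qed
  have Pr_conj: "Pr (conjugate G C x)" if C: "Pr C" and x: "x \<in> ?J" for C x
  proof -
    have xc: "x \<in> carrier G" using sub_carrier[OF Js(1) x] .
    note Cs = PrD[OF C]
    have "\<not> ?J \<subseteq> H <#> conjugate G C x"
    proof
      assume sub: "?J \<subseteq> H <#> conjugate G C x"
      then have "x \<in> H <#> conjugate G C x" using x by auto
      \<comment> \<open>Reading \<open>x = k (inv x b x)\<close> as \<open>x = b k\<close> shows that conjugating \<open>C\<close> by \<open>x\<close> is the same as conjugating
        it by \<open>k \<in> H\<close>, and \<open>H\<close> times that conjugate is a conjugate of \<open>HC\<close>.\<close>
      then obtain k b where kb: "k \<in> H" "b \<in> C" "x = k \<otimes> (inv x \<otimes> b \<otimes> x)"
        unfolding conjugate_eq set_mult_iff by auto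
      have c: "k \<in> carrier G" "b \<in> carrier G" using kb Hc Cs by auto
      have "x \<otimes> inv x = k \<otimes> (inv x \<otimes> b \<otimes> x) \<otimes> inv x" using kb(3) by simp
      then have "\<one> = k \<otimes> inv x \<otimes> b" using c xc by (simp add: m_assoc)
      then have "x \<otimes> inv k \<otimes> \<one> = x \<otimes> inv k \<otimes> (k \<otimes> inv x \<otimes> b)" by simp
      then have "x \<otimes> inv k = b" using c xc by (simp add: m_assoc)
      then have xbk: "x = b \<otimes> k" using c xc by (metis inv_solve_right)
      have "conjugate G C x = conjugate G (conjugate G C b) k"
        using conjugate_conjugate[OF Cs(2) c(2,1)] xbk by simp
      also have "\<dots> = conjugate G C k"
        using conjugate_normalised[OF Cs(1) normalises_self[OF Cs(1)] kb(2) c(2)] by simp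
      finally have e: "conjugate G C x = conjugate G C k" .
      have ki: "inv k \<in> ?J" "inv k \<in> carrier G" using subgroup.m_inv_closed[OF H kb(1)] Js(2) c by auto
      have "H <#> conjugate G C k = conjugate G (H <#> C) k"
        using conjugate_set_mult[OF Hc Cs(2) c(1)] conjugate_normalised[OF H normalises_self[OF H] kb(1) c(1)] by simp
      then have "conjugate G ?J (inv k) \<subseteq> conjugate G (conjugate G (H <#> C) k) (inv k)"
        using sub e by (intro conjugate_mono) simp
      then have "?J \<subseteq> H <#> C"
        using conjugate_normalised[OF Js(1) normalises_self[OF Js(1)] ki]
          conjugate_inv_cancel(1)[OF setmult_subset_G[OF Hc Cs(2)] c(1)] by simp
      then show False using Cs(4) by simp
    qed
    moreover have "H <#> conjugate G (conjugate G C x) g = conjugate G (conjugate G C x) g <#> H" if g: "g \<in> carrier G" for g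
      using conjugate_conjugate[OF Cs(2) xc g] Cs(3)[of "x \<otimes> g"] xc g by simp
    moreover have "\<exists>g\<in>carrier G. conjugate G P g \<subseteq> conjugate G C x"
    proof -
      obtain g where g: "g \<in> carrier G" "conjugate G P g \<subseteq> C" using C unfolding Pr_def by auto
      have "conjugate G P (g \<otimes> x) \<subseteq> conjugate G C x"
        using conjugate_mono[OF g(2), of x] conjugate_conjugate[OF Pc g(1) xc] by simp
      then show ?thesis using g xc by blast
    qed
    ultimately show ?thesis unfolding Pr_def using conjugate_subgroup[OF Cs(1) xc] by blast
  qed
  have H_norm: "conjugate G C k \<subseteq> C" if C: "Pr C" and Cmax: "\<And>D. Pr D \<Longrightarrow> card D \<le> card C" and k: "k \<in> H" for C k
  proof -
    note Cs = PrD[OF C]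
    have kc: "k \<in> carrier G" using k Hc by auto
    let ?C' = "conjugate G C k"
    have C': "subgroup ?C' G" "?C' \<subseteq> carrier G"
      using conjugate_subgroup[OF Cs(1) kc] subgroup.subset by auto
    \<comment> \<open>\<open>C\<close> and its conjugate by \<open>k \<in> H\<close> generate a subgroup \<open>E\<close> that still permutes with \<open>H\<close>, and
      \<open>HE = HC\<close>. So \<open>E\<close> competes, and \<open>E = C\<close>.\<close>
    let ?E = "generate G (C \<union> ?C')"
    have U: "C \<union> ?C' \<subseteq> carrier G" using Cs(2) C'(2) by auto
    have E: "subgroup ?E G" "C \<subseteq> ?E" "?C' \<subseteq> ?E"
      using generate_is_subgroup[OF U] generate.incl[of _ "C \<union> ?C'" G] by auto
    have HC: "subgroup (H <#> C) G" using set_mult_subgroup_iff[OF H Cs(1)] Cs(5) by simp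
    have "?C' \<subseteq> H <#> C"
    proof
      fix z assume "z \<in> ?C'"
      then obtain c where c: "c \<in> C" "z = inv k \<otimes> c \<otimes> k" unfolding conjugate_eq by auto
      have "k \<in> H <#> C" "inv k \<in> H <#> C" "c \<in> H <#> C"
        using sub_set_mult_left[OF H Cs(1)] sub_set_mult_right[OF H Cs(1)] k c subgroup.m_inv_closed[OF H k] by auto
      then show "z \<in> H <#> C" unfolding c(2) using subgroup.m_closed[OF HC] by auto
    qed
    then have "?E \<subseteq> H <#> C"
      using generate_subgroup_incl[OF _ HC, of "C \<union> ?C'"] sub_set_mult_right[OF H Cs(1)] by simp
    then have "H <#> ?E \<subseteq> H <#> C" using set_mult_least[OF HC sub_set_mult_left[OF H Cs(1)]] by simp
    then have "\<not> ?J \<subseteq> H <#> ?E" using Cs(4) by auto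
    moreover have "H <#> conjugate G ?E g = conjugate G ?E g <#> H" if g: "g \<in> carrier G" for g
    proof -
      let ?A = "{conjugate G C g, conjugate G C (k \<otimes> g)}"
      have "conjugate G (C \<union> ?C') g = \<Union>?A"
        using conjugate_conjugate[OF Cs(2) kc g] unfolding conjugate_eq[of "C \<union> ?C'"] conjugate_eq[of C g]
        by (simp add: image_Un conjugate_eq[of ?C'])
      then have "conjugate G ?E g = generate G (\<Union>?A)" using conjugate_generate[OF U g] by simp
      moreover have "generate G (\<Union>?A) <#> H = H <#> generate G (\<Union>?A)"
        by (rule permutes_generate[OF H])
          (use conjugate_subgroup[OF Cs(1)] Cs(3) g kc in auto)
      ultimately show ?thesis by simp
    qed
    moreover have "\<exists>g\<in>carrier G. conjugate G P g \<subseteq> ?E" using C E(2) unfolding Pr_def by blast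
    ultimately have "Pr ?E" unfolding Pr_def using E(1) by blast
    then have "?E = C" using card_seteq[OF subgroup_finite[OF E(1)] E(2)] Cmax by auto
    then show ?thesis using E(3) by simp
  qed
  note Bs = PrD[OF B]
  \<comment> \<open>All conjugates of \<open>B\<close> under \<open>J\<close> are of largest order too and hence normalised by \<open>H\<close>; therefore all
    conjugates of \<open>H\<close> under \<open>J\<close>, which together generate \<open>J\<close>, normalise \<open>B\<close>.\<close>
  have HxB: "conjugate G H x \<subseteq> normaliser B" if x: "x \<in> ?J" for x
  proof
    fix z assume "z \<in> conjugate G H x"
    then obtain k where k: "k \<in> H" "z = inv x \<otimes> k \<otimes> x" unfolding conjugate_eq by auto
    have xc: "x \<in> carrier G" "k \<in> carrier G" using sub_carrier[OF Js(1) x] k Hc by auto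
    have zc: "z \<in> carrier G" using k xc by simp
    let ?C = "conjugate G B (inv x)"
    have C: "Pr ?C" using Pr_conj[OF B] subgroup.m_inv_closed[OF Js(1) x] by simp
    have "conjugate G ?C k \<subseteq> ?C"
      by (rule H_norm[OF C _ k(1)]) (use Bmax conjugate_card[OF Bs(2), of "inv x"] xc in simp)
    then have "conjugate G (conjugate G ?C k) x \<subseteq> conjugate G ?C x" by (rule conjugate_mono)
    then have "conjugate G B z \<subseteq> B"
      using conjugate_inv_cancel(2)[OF Bs(2) xc(1)] conjugate_conjugate[OF Bs(2), of "inv x" k]
        conjugate_conjugate[OF Bs(2), of "inv x \<otimes> k" x] xc k(2) by simp
    then have "conjugate G B z = B"
      using card_subset_eq[OF subgroup_finite[OF Bs(1)]] conjugate_card[OF Bs(2) zc] by simp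
    then show "z \<in> normaliser B" unfolding normaliser_def using zc by simp
  qed
  define X where "X = generate G (\<Union>x\<in>?J. conjugate G H x)"
  have UX: "(\<Union>x\<in>?J. conjugate G H x) \<subseteq> carrier G"
    using conjugate_subgroup[OF H] subgroup.subset sub_carrier[OF Js(1)] by (metis UN_least)
  have Xs: "subgroup X G" unfolding X_def using generate_is_subgroup[OF UX] .
  have "?J \<subseteq> X"
  proof (rule moved_hull_least_normalised[OF H Xs])
    have "H \<subseteq> (\<Union>x\<in>?J. conjugate G H x)"
      using conjugate_one[OF Hc] subgroup.one_closed[OF Js(1)] by auto
    then show "H \<subseteq> X" unfolding X_def using generate.incl by (metis subsetD subsetI)
    show "normalises ?J X"
    proof (rule normalisesI_conjugate)
      fix y assume y: "y \<in> ?J"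
      have yc: "y \<in> carrier G" using sub_carrier[OF Js(1) y] .
      have "conjugate G (\<Union>x\<in>?J. conjugate G H x) y = (\<Union>x\<in>?J. conjugate G (conjugate G H x) y)"
        unfolding conjugate_eq[of "\<Union>x\<in>?J. conjugate G H x"] conjugate_eq[of "conjugate G H _" y] by (rule image_UN)
      also have "\<dots> \<subseteq> (\<Union>x\<in>?J. conjugate G H x)"
      proof (rule UN_least)
        fix x assume x: "x \<in> ?J"
        have "conjugate G (conjugate G H x) y = conjugate G H (x \<otimes> y)"
          using conjugate_conjugate[OF Hc _ yc] sub_carrier[OF Js(1) x] by simp
        then show "conjugate G (conjugate G H x) y \<subseteq> (\<Union>x\<in>?J. conjugate G H x)"
          using subgroup.m_closed[OF Js(1) x y] by auto
      qed
      finally show "conjugate G X y \<subseteq> X"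
        unfolding X_def conjugate_generate[OF UX yc] by (rule mono_generate)
    qed
  qed
  also have "X \<subseteq> normaliser B"
    unfolding X_def by (rule generate_subgroup_incl[OF _ normaliser_subgroup[OF Bs(2)]]) (use HxB in auto)
  finally have JB: "normalises ?J B" by (rule normaliser_normalises)
  \<comment> \<open>\<open>J\<close> is not contained in \<open>HB\<close>, so some factor in \<open>J\<close> is not in \<open>B\<close> and is thus centralised by \<open>B\<close>.
    A conjugate of \<open>P\<close> inside \<open>B\<close> can be enlarged by a subgroup of order \<open>p\<close> of this factor.\<close>
  obtain S where S: "S \<in> moved_factors H" "\<not> S \<subseteq> B" using Js(5)[OF Bs(1)] Bs(4) by blast
  have ST: "S \<in> \<T>" using S(1) unfolding moved_factors_def by simp
  have BS: "B \<subseteq> centraliser S"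
    using centralised_of_not_contained[OF ST Bs(1) normalises_mono[OF JB Js(3)[OF S(1)]] S(2)] .
  obtain g where g: "g \<in> carrier G" "conjugate G P g \<subseteq> B" using B unfolding Pr_def by auto
  let ?Q = "conjugate G P g"
  have Q: "projector \<pi> ?Q" using projector_conjugate[OF P g(1)] .
  note Qs = projector_subgroup[OF Q]
  obtain V where V: "subgroup V G" "V \<subseteq> S" "card V = p"
    by (rule exists_subgroup_of_prime_card[OF factor_subgroup[OF ST] p(1) p(3)[OF ST]])
  have "?Q \<subseteq> centraliser V" using g(2) BS centraliser_antimono[OF V(2)] by auto
  then have nQV: "normalises ?Q V" by (rule centraliser_normalises[OF subgroup.subset[OF V(1)]])
  have VQ: "subgroup (V <#> ?Q) G" "V \<subseteq> V <#> ?Q" "?Q \<subseteq> V <#> ?Q"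
    using normalised_product[OF V(1) Qs nQV] by auto
  have "pi_number \<pi> (card (V <#> ?Q))"
    by (rule pi_number_set_mult[OF V(1) prime_subgroup_pi_number[OF V(3) p(1,2)] Qs projector_pi_number[OF Q]])
  then have "V <#> ?Q = ?Q" using projector_maximal[OF Q VQ(1,3)] by simp
  then have "V \<subseteq> S \<inter> centraliser S" using VQ(2) g(2) BS V(2) by auto
  then have "card V \<le> 1" using factor_centreless[OF ST] card_mono[of "{\<one>}" V] by simp
  then show False using V(3) prime_gt_1_nat[OF p(1)] by simp
qed

end

context finite_group
begin

text \<open>The factors of the minimal normal subgroup have order divisible by primes \<open>p \<in> \<pi>\<close> and \<open>q \<in> \<tau>\<close> from
different members of \<open>\<sigma>\<close>. Kegel's argument for both forces a factor into \<open>H\<close>.\<close>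

lemma no_reduced_counterexample:
  assumes s: "permutable_setting \<sigma> H A P" and nt: "H \<noteq> {\<one>}"
    and noprim: "\<And>K \<pi>. \<lbrakk>K \<lhd> G; \<pi> \<in> \<sigma>; pi_number \<pi> (card K)\<rbrakk> \<Longrightarrow> K = {\<one>}"
    and int: "\<And>K L. \<lbrakk>K \<lhd> G; L \<lhd> G; K \<inter> L = {\<one>}\<rbrakk> \<Longrightarrow> K = {\<one>} \<or> L = {\<one>}"
  shows False
proof -
  have part: "partition_of_primes \<sigma>" and h: "hall_decomposition \<sigma> H A"
    using s unfolding permutable_setting_def by auto
  have H: "subgroup H G" using hall_decompositionD(1)[OF h] .
  have ntG: "carrier G \<noteq> {\<one>}" using nt subgroup.subset[OF H] subgroup.one_closed[OF H] by auto
  obtain N \<T> n where sf: "simple_factors G N \<T>" and CN: "centraliser N = {\<one>}" "N \<noteq> {\<one>}"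
    and n': "\<forall>S\<in>\<T>. card S = n" "\<forall>\<pi>\<in>\<sigma>. \<not> pi_number \<pi> n"
    by (rule exists_simple_factors[OF part ntG noprim int])
  note n = bspec[OF n'(1)] bspec[OF n'(2)]
  interpret simple_factors G N \<T> by (rule sf)
  let ?J = "moved_hull H"
  note Js = moved_hull_facts[OF H]
  obtain S where S: "S \<in> moved_factors H" using moved_factors_nonempty[OF H nt CN(1)] by auto
  have ST: "S \<in> \<T>" using S unfolding moved_factors_def by simp
  note Ss = factor_subgroup[OF ST]
  obtain p where p: "prime p" "p dvd n" using nontrivial_prime[OF Ss factor_nontrivial[OF ST]] n(1)[OF ST] by auto
  obtain \<pi> where pi: "\<pi> \<in> \<sigma>" "p \<in> \<pi>" using partition_cover[OF part p(1)] by auto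
  have n0: "n \<noteq> 0" using n(1)[OF ST] subgroup_card_pos[OF Ss] by simp
  obtain q where q: "prime q" "q dvd n" "q \<notin> \<pi>" using n(2)[OF pi(1)] n0 unfolding pi_number_def by auto
  obtain \<tau> where tau: "\<tau> \<in> \<sigma>" "q \<in> \<tau>" using partition_cover[OF part q(1)] by auto
  have disj: "\<pi> \<inter> \<tau> = {}" using partition_disjoint[OF part pi(1) tau(1)] q(3) tau(2) by auto
  \<comment> \<open>\<open>J = H(P \<inter> J)\<close> bounds the index of \<open>H\<close> in \<open>J\<close> by the order of a \<open>\<rho>\<close>-group, for two disjoint \<open>\<rho>\<close>.\<close>
  have J_index: "pi_number \<rho> (index ?J H)" if rho: "\<rho> \<in> \<sigma>" and r: "prime r" "r \<in> \<rho>" "r dvd n" for \<rho> r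
  proof -
    have Pr: "projector \<rho> (P \<rho>)" and perm: "\<And>x. x \<in> carrier G \<Longrightarrow> H <#> conjugate G (P \<rho>) x = conjugate G (P \<rho>) x <#> H"
      using s rho unfolding permutable_setting_def by auto
    note Ps = projector_subgroup[OF Pr]
    have "?J \<subseteq> H <#> P \<rho>" by (rule moved_hull_in_product[OF H Pr perm r(1,2)]) (use r(3) n(1) in auto)
    then have "?J = H <#> (P \<rho> \<inter> ?J)" using dedekind[OF H subgroup.subset[OF Ps] Js(1,2)] by auto
    moreover have PJ: "subgroup (P \<rho> \<inter> ?J) G" using subgroup_Int[OF Ps Js(1)] .
    ultimately have "index ?J H dvd card (P \<rho> \<inter> ?J)"
      using index_set_mult_dvd[OF H PJ] by simp
    also have "\<dots> dvd card (P \<rho>)" by (rule subgroup_card_dvd[OF PJ Ps]) simp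
    finally show ?thesis using projector_pi_number[OF Pr] pi_number_dvd by blast
  qed
  have "coprime (index ?J H) (index ?J H)"
    by (rule pi_number_disjoint_coprime[OF J_index[OF pi(1) p(1) pi(2) p(2)] J_index[OF tau(1) q(1) tau(2) q(2)] disj])
  then have "index ?J H = 1" by simp
  then have "H = ?J" using subgroup_eq_of_index_one[OF H Js(1,2)] by simp
  \<comment> \<open>The Hall part \<open>A \<pi>\<close> meets the simple group \<open>S \<subseteq> H\<close> nontrivially, so it contains \<open>S\<close>, whose order is
    not a \<open>\<pi>\<close>-number.\<close>
  then have SH: "S \<subseteq> H" using Js(3)[OF S] by simp
  obtain V where V: "subgroup V G" "V \<subseteq> S" "card V = p"
    by (rule exists_subgroup_of_prime_card[OF Ss p(1)]) (use p n(1)[OF ST] in auto)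
  have "V \<subseteq> A \<pi>"
    using hall_decomposition_absorbs[OF h pi(1) V(1) _ prime_subgroup_pi_number[OF V(3) p(1) pi(2)]] V(2) SH by auto
  then have "S \<inter> A \<pi> \<noteq> {\<one>}" using V prime_gt_1_nat[OF p(1)] card_mono[of "{\<one>}" V] by auto
  moreover have "normalises S (S \<inter> A \<pi>)"
    using normalises_Int[OF normalises_self[OF Ss] normalises_mono[OF hall_decompositionD(4)[OF h pi(1)] SH]] .
  ultimately have "S \<inter> A \<pi> = S"
    using factor_simple[OF ST subgroup_Int[OF Ss hall_decompositionD(2)[OF h pi(1)]]] by auto
  then have "card S dvd card (A \<pi>)" using subgroup_card_dvd[OF Ss hall_decompositionD(2)[OF h pi(1)]] by auto
  then have "pi_number \<pi> n" using hall_decompositionD(5)[OF h pi(1)] pi_number_dvd n(1)[OF ST] by auto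
  then show False using n(2)[OF pi(1)] by simp
qed

text \<open>A nontrivial primary normal subgroup and a pair of nontrivial normal subgroups with trivial
intersection are each enough to conclude; if neither exists, \<open>H\<close> is trivial.\<close>

lemma hall_part_in_normal_pi_subgroup_step:
  assumes s: "permutable_setting \<sigma> H A P"
    and o: "\<And>N \<pi>. \<lbrakk>N \<lhd> G; N \<noteq> {\<one>}; \<pi> \<in> \<sigma>\<rbrakk> \<Longrightarrow> pi_normal_over \<pi> N (A \<pi>)" and pi: "\<pi> \<in> \<sigma>"
  shows "pi_normal_over \<pi> {\<one>} (A \<pi>)"
proof (rule ccontr)
  assume neg: "\<not> ?thesis"
  have h: "hall_decomposition \<sigma> H A" using s unfolding permutable_setting_def by auto
  have "H \<noteq> {\<one>}"
  proof
    assume "H = {\<one>}"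
    then have "A \<pi> \<subseteq> {\<one>}" using hall_decompositionD(3)[OF h pi] by simp
    then have "pi_normal_over \<pi> {\<one>} (A \<pi>)" unfolding pi_normal_over_def using one_is_normal
      by (intro exI[of _ "{\<one>}"]) (auto simp: pi_number_def)
    then show False using neg by simp
  qed
  then show False
  proof (rule no_reduced_counterexample[OF s])
    fix K \<rho> assume K: "K \<lhd> G" "\<rho> \<in> \<sigma>" "pi_number \<rho> (card K)"
    show "K = {\<one>}"
    proof (rule ccontr)
      assume "K \<noteq> {\<one>}"
      then have "pi_normal_over \<pi> {\<one>} (A \<pi>)" by (intro pi_normal_over_of_primary_normal[OF s K o[OF K(1)] pi])
      then show False using neg by simp
    qed
  next
    fix K L assume KL: "K \<lhd> G" "L \<lhd> G" "K \<inter> L = {\<one>}"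
    show "K = {\<one>} \<or> L = {\<one>}"
    proof (rule ccontr)
      assume "\<not> ?thesis"
      then have "pi_normal_over \<pi> {\<one>} (A \<pi>)" by (intro pi_normal_over_inter[OF KL] o KL pi) auto
      then show False using neg by simp
    qed
  qed
qed

end

lemma hall_part_in_normal_pi_subgroup:
  fixes G :: "('a, 'b) monoid_scheme"
  assumes "finite_group G" "finite_group.permutable_setting G \<sigma> H A P" "\<pi> \<in> \<sigma>"
  shows "finite_group.pi_normal_over G \<pi> {\<one>\<^bsub>G\<^esub>} (A \<pi>)"
  using assms
proof (induction "card (carrier G)" arbitrary: G H A P \<pi> rule: less_induct)
  case (less G H A P \<pi>)
  interpret finite_group G by (rule less.prems(1))
  have H: "hall_decomposition \<sigma> H A" using less.prems(2) unfolding permutable_setting_def by auto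
  show ?case
  proof (rule hall_part_in_normal_pi_subgroup_step[OF less.prems(2) _ less.prems(3)])
    fix N \<tau> assume N: "N \<lhd> G" "N \<noteq> {\<one>\<^bsub>G\<^esub>}" and tau: "\<tau> \<in> \<sigma>"
    obtain Q :: "('a, 'b) monoid_scheme" and h where Q: "finite_epi G Q h" "kernel G Q h = N"
      by (rule exists_quotient_same_type[OF N(1)])
    interpret E: finite_epi G Q h by (rule Q(1))
    have cQ: "card (carrier G) = card N * card (carrier Q)"
      using E.card_image_ker[OF subgroup_self] Q(2) E.onto normalD(3)[OF N(1)] by (simp add: Int_absorb1)
    have "E.cod.pi_normal_over \<tau> {\<one>\<^bsub>Q\<^esub>} (h ` A \<tau>)"
    proof (rule less.hyps[OF _ E.cod.finite_group_axioms E.image_permutable_setting[OF less.prems(2)] tau])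
      show "card (carrier Q) < card (carrier G)"
        using cQ card_gt_one[OF normalD(1)[OF N(1)] N(2)] E.cod.subgroup_card_pos[OF E.H.subgroup_self] by simp
    qed
    then show "pi_normal_over \<tau> N (A \<tau>)"
      using E.pi_normal_over_pullback Q(2) subgroup.subset[OF hall_decompositionD(2)[OF H tau]] by simp
  qed
qed

section \<open>The three permutability notions\<close>

context finite_group
begin

lemma pi_maximal_iff:
  "pi_maximal \<pi> G X \<longleftrightarrow> subgroup X G \<and> pi_number \<pi> (card X) \<and>
     (\<forall>Y. subgroup Y G \<longrightarrow> pi_number \<pi> (card Y) \<longrightarrow> X \<subseteq> Y \<longrightarrow> Y = X)"
  unfolding pi_maximal_def pi_subgroup_iff by blast

lemma projector_pi_maximal: "projector \<pi> P \<Longrightarrow> pi_maximal \<pi> G P"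
  unfolding pi_maximal_iff using projector_subgroup projector_pi_number projector_maximal by blast

lemma hall_subgroup_restrict_iff:
  assumes H: "subgroup H G"
  shows "hall_subgroup \<pi> (G\<lparr>carrier := H\<rparr>) B \<longleftrightarrow>
    subgroup B G \<and> B \<subseteq> H \<and> pi_number \<pi> (card B) \<and> (\<forall>p\<in>\<pi>. prime p \<longrightarrow> \<not> p dvd index H B)"
proof -
  interpret R: finite_group "G\<lparr>carrier := H\<rparr>" by (rule subgroup_finite_group[OF H])
  have s: "subgroup B (G\<lparr>carrier := H\<rparr>) \<longleftrightarrow> subgroup B G \<and> B \<subseteq> H"
    using subgroup_of_subgroup[OF H] subgroup_restrict[OF _ H] by blast
  show ?thesis
    unfolding hall_subgroup_def R.pi_subgroup_iff s using index_rcosets(1)[OF _ H] by auto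
qed

lemma sigma_nilpotent_hall_decomposition:
  assumes H: "subgroup H G" and n: "sigma_nilpotent \<sigma> (G\<lparr>carrier := H\<rparr>)"
  obtains A where "hall_decomposition \<sigma> H A" "generate G (\<Union>\<pi>\<in>\<sigma>. A \<pi>) = H"
proof -
  interpret R: finite_group "G\<lparr>carrier := H\<rparr>" by (rule subgroup_finite_group[OF H])
  obtain A where A: "\<And>\<pi>. \<pi> \<in> \<sigma> \<Longrightarrow> hall_subgroup \<pi> (G\<lparr>carrier := H\<rparr>) (A \<pi>)"
    and nA: "\<And>\<pi>. \<pi> \<in> \<sigma> \<Longrightarrow> A \<pi> \<lhd> G\<lparr>carrier := H\<rparr>"
    and g: "generate (G\<lparr>carrier := H\<rparr>) (\<Union>\<pi>\<in>\<sigma>. A \<pi>) = H"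
    using n unfolding sigma_nilpotent_def internal_direct_product_def by auto
  have AH: "subgroup (A \<pi>) G" "A \<pi> \<subseteq> H" "pi_number \<pi> (card (A \<pi>))" "\<And>p. p \<in> \<pi> \<Longrightarrow> prime p \<Longrightarrow> \<not> p dvd index H (A \<pi>)"
    if "\<pi> \<in> \<sigma>" for \<pi>
    using A[OF that] hall_subgroup_restrict_iff[OF H] by auto
  have norm: "normalises H (A \<pi>)" if "\<pi> \<in> \<sigma>" for \<pi>
  proof -
    have "R.normalises H (A \<pi>)" using R.normalD(2)[OF nA[OF that]] by simp
    then show ?thesis unfolding R.normalises_def normalises_def using m_inv_consistent[OF H] by simp
  qed
  have "hall_decomposition \<sigma> H A" unfolding hall_decomposition_def using H AH norm by blast
  moreover have "generate G (\<Union>\<pi>\<in>\<sigma>. A \<pi>) = H"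
    using g generate_consistent[OF _ H, of "\<Union>\<pi>\<in>\<sigma>. A \<pi>"] AH(2) by auto
  ultimately show ?thesis using that by blast
qed

text \<open>A normal Hall subgroup contains every \<open>\<pi>\<close>-subgroup.\<close>

lemma hall_subgroup_unique:
  assumes h: "hall_decomposition \<sigma> H A" and pi: "\<pi> \<in> \<sigma>" and B: "hall_subgroup \<pi> (G\<lparr>carrier := H\<rparr>) B"
  shows "B = A \<pi>"
proof -
  note H = hall_decompositionD(1)[OF h] and As = hall_decompositionD(2,3,5)[OF h pi]
  have Bs: "subgroup B G" "B \<subseteq> H" "pi_number \<pi> (card B)" "\<And>p. p \<in> \<pi> \<Longrightarrow> prime p \<Longrightarrow> \<not> p dvd index H B"
    using B hall_subgroup_restrict_iff[OF H] by auto
  have BA: "B \<subseteq> A \<pi>" by (rule hall_decomposition_absorbs[OF h pi Bs(1-3)])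
  have "coprime (card (A \<pi>)) (index H B)"
    using pi_number_coprime[OF As(3)] Bs(4) by blast
  moreover have "index H B = index H (A \<pi>) * index (A \<pi>) B" by (rule index_mult[OF Bs(1) As(1) H BA As(2)])
  moreover have "index (A \<pi>) B dvd card (A \<pi>)" by (rule index_dvd_card[OF Bs(1) As(1) BA])
  ultimately have "index (A \<pi>) B = 1" by (metis coprime_common_divisor_nat dvd_triv_right)
  then show ?thesis using subgroup_eq_of_index_one[OF Bs(1) As(1) BA] by simp
qed

text \<open>A \<open>\<pi>\<close>-group, in particular a Hall part of \<open>H\<close>, is itself \<open>\<sigma>\<close>-nilpotent.\<close>

lemma hall_decomposition_pi_subgroup:
  assumes part: "partition_of_primes \<sigma>" and pi: "\<pi> \<in> \<sigma>" and B: "subgroup B G" "pi_number \<pi> (card B)"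
  shows "hall_decomposition \<sigma> B (\<lambda>\<tau>. if \<tau> = \<pi> then B else {\<one>})"
proof -
  have "\<not> p dvd card B" if "\<tau> \<in> \<sigma>" "\<tau> \<noteq> \<pi>" "p \<in> \<tau>" "prime p" for \<tau> p
    using B(2) partition_disjoint[OF part that(1) pi that(2)] that(3,4) unfolding pi_number_def by blast
  moreover have "normalises B {\<one>}" using sub_carrier[OF B(1)] unfolding normalises_def by auto
  ultimately show ?thesis
    unfolding hall_decomposition_def
    using B subgroup_card_pos[OF B(1)] triv_subgroup normalises_self[OF B(1)] subgroup.one_closed[OF B(1)]
    by (auto simp: pi_number_def)
qed

lemma normalised_permutes_with:
  assumes "subgroup A G" "subgroup X G" "normalises X A" shows "permutes_with G A X"
  unfolding permutes_with_def using normalises_subgroup[OF assms] by simp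

text \<open>Let \<open>M\<close> be a normal \<open>\<pi>\<close>-subgroup of \<open>G\<close> containing \<open>A \<pi>\<close>. Every \<open>\<pi>\<close>-maximal subgroup contains \<open>M\<close>; every
\<open>\<tau>\<close>-subgroup with \<open>\<tau> \<noteq> \<pi>\<close> normalises \<open>A \<pi>\<close>, because the conjugates of the \<open>\<tau>\<close>-projector do.\<close>

lemma sigma3_imp_hall_part_sigma1:
  assumes part: "partition_of_primes \<sigma>" and h: "hall_decomposition \<sigma> H A"
    and s3: "sigma3_permutable \<sigma> G H" and pi: "\<pi> \<in> \<sigma>"
  shows "sigma1_permutable \<sigma> G (A \<pi>)"
proof -
  obtain P where P: "\<And>\<tau>. \<tau> \<in> \<sigma> \<Longrightarrow> projector \<tau> (P \<tau>)"
    "\<And>\<tau> x. \<tau> \<in> \<sigma> \<Longrightarrow> x \<in> carrier G \<Longrightarrow> H <#> conjugate G (P \<tau>) x = conjugate G (P \<tau>) x <#> H"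
    using s3 unfolding sigma3_permutable_def pi_projector_iff by metis
  have s: "permutable_setting \<sigma> H A P" unfolding permutable_setting_def using part h P by blast
  obtain M where M: "M \<lhd> G" "A \<pi> \<subseteq> M" "pi_number \<pi> (card M)"
    using hall_part_in_normal_pi_subgroup[OF finite_group_axioms s pi] pi_normal_over_trivial by blast
  note Ms = normalD[OF M(1)] and As = hall_decompositionD(2)[OF h pi] and H = hall_decompositionD(1)[OF h]
  have "permutes_with G (A \<pi>) X" if tau: "\<tau> \<in> \<sigma>" and X: "pi_maximal \<tau> G X" for \<tau> X
  proof -
    have Xs: "subgroup X G" "pi_number \<tau> (card X)" using X pi_maximal_iff by auto
    show ?thesis
    proof (cases "\<tau> = \<pi>")
      case True
      have MX: "subgroup (M <#> X) G" "M \<subseteq> M <#> X" "X \<subseteq> M <#> X"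
        using normalised_product[OF Ms(1) Xs(1) normalises_mono[OF Ms(2) subgroup.subset[OF Xs(1)]]] by auto
      have "M <#> X = X"
        using X MX pi_number_set_mult[OF Ms(1) M(3) Xs(1)] Xs(2) True unfolding pi_maximal_iff by blast
      then have "A \<pi> \<subseteq> X" using MX(2) M(2) by auto
      then show ?thesis unfolding permutes_with_def using subgroup_absorb(2)[OF Xs(1) As] Xs(1) by simp
    next
      case False
      have disj: "\<pi> \<inter> \<tau> = {}" using partition_disjoint[OF part pi tau] False by auto
      have norm: "normalises (conjugate G (P \<tau>) x) (A \<pi>)" if x: "x \<in> carrier G" for x
      proof -
        let ?Q = "conjugate G (P \<tau>) x"
        have Q: "projector \<tau> ?Q" using projector_conjugate[OF P(1)[OF tau] x] .
        note Qs = projector_subgroup[OF Q]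
        have HQ: "subgroup (H <#> ?Q) G" using set_mult_subgroup_iff[OF H Qs] P(2)[OF tau x] by simp
        \<comment> \<open>\<open>HQ \<inter> M\<close> is a \<open>\<pi>\<close>-group and normal in \<open>HQ\<close>; it equals \<open>A \<pi>\<close>.\<close>
        let ?V = "(H <#> ?Q) \<inter> M"
        have nV: "normalises (H <#> ?Q) ?V"
          by (rule normalises_Int[OF normalises_self[OF HQ] normalises_mono[OF Ms(2) subgroup.subset[OF HQ]]])
        have V: "subgroup ?V G" using subgroup_Int[OF HQ Ms(1)] .
        have piV: "pi_number \<pi> (card ?V)" using pi_number_dvd[OF M(3) subgroup_card_dvd[OF V Ms(1)]] by simp
        have "?V \<subseteq> H"
          by (rule normalised_pi_subgroup_of_product[OF H Qs HQ V _ normalises_mono[OF nV sub_set_mult_left[OF H Qs]]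
                pi_number_disjoint_coprime[OF piV projector_pi_number[OF Q] disj]]) simp
        then have "?V \<subseteq> A \<pi>" using hall_decomposition_absorbs[OF h pi V _ piV] by simp
        moreover have "A \<pi> \<subseteq> ?V"
          using M(2) hall_decompositionD(3)[OF h pi] sub_set_mult_left[OF H Qs] by auto
        ultimately have "?V = A \<pi>" by auto
        then show ?thesis using normalises_mono[OF nV sub_set_mult_right[OF H Qs]] by simp
      qed
      have "(\<Union>x\<in>carrier G. conjugate G (P \<tau>) x) \<subseteq> normaliser (A \<pi>)"
        using norm normalises_normaliser[OF conjugate_subgroup[OF projector_subgroup[OF P(1)[OF tau]]] As]
        by (intro UN_least) auto
      then have "generate G (\<Union>x\<in>carrier G. conjugate G (P \<tau>) x) \<subseteq> normaliser (A \<pi>)"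
        by (rule generate_subgroup_incl[OF _ normaliser_subgroup[OF subgroup.subset[OF As]]])
      then have "X \<subseteq> normaliser (A \<pi>)" using conjugates_of_projector_generate[OF P(1)[OF tau] Xs] by auto
      then show ?thesis by (intro normalised_permutes_with[OF As Xs(1)] normaliser_normalises)
    qed
  qed
  then show ?thesis unfolding sigma1_permutable_def using As by blast
qed

lemma sigma1_of_hall_parts:
  assumes h: "hall_decomposition \<sigma> H A" and g: "generate G (\<Union>\<pi>\<in>\<sigma>. A \<pi>) = H"
    and s1: "\<And>\<pi>. \<pi> \<in> \<sigma> \<Longrightarrow> sigma1_permutable \<sigma> G (A \<pi>)"
  shows "sigma1_permutable \<sigma> G H"
  unfolding sigma1_permutable_def
proof (intro conjI ballI allI impI)
  show H: "subgroup H G" using hall_decompositionD(1)[OF h] .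
  fix \<tau> X assume tau: "\<tau> \<in> \<sigma>" and X: "pi_maximal \<tau> G X"
  have Xs: "subgroup X G" using X pi_maximal_iff by auto
  have "generate G (\<Union>(A ` \<sigma>)) <#> X = X <#> generate G (\<Union>(A ` \<sigma>))"
  proof (rule permutes_generate[OF Xs])
    fix B assume "B \<in> A ` \<sigma>"
    then obtain \<pi> where pi: "\<pi> \<in> \<sigma>" "B = A \<pi>" by auto
    show B: "subgroup B G" using pi hall_decompositionD(2)[OF h] by simp
    show "B <#> X = X <#> B"
      using s1[OF pi(1)] tau X pi(2) permutes_with_iff[OF B Xs] unfolding sigma1_permutable_def by blast
  qed
  then show "permutes_with G H X" using permutes_with_iff[OF H Xs] g by simp
qed

lemma sigma1_imp_sigma2: "sigma1_permutable \<sigma> G H \<Longrightarrow> sigma2_permutable \<sigma> G H"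
  unfolding sigma1_permutable_def sigma2_permutable_def pi_projector_iff using projector_pi_maximal by blast

lemma sigma2_imp_sigma3:
  assumes "sigma2_permutable \<sigma> G H" shows "sigma3_permutable \<sigma> G H"
  unfolding sigma3_permutable_def pi_projector_iff
proof (intro conjI ballI)
  show H: "subgroup H G" using assms unfolding sigma2_permutable_def by simp
  fix \<pi> assume pi: "\<pi> \<in> \<sigma>"
  obtain P where P: "projector \<pi> P" using exists_projector by blast
  have "H <#> conjugate G P x = conjugate G P x <#> H" if x: "x \<in> carrier G" for x
  proof -
    have Q: "projector \<pi> (conjugate G P x)" by (rule projector_conjugate[OF P x])
    then show ?thesis
      using assms pi permutes_with_iff[OF H projector_subgroup[OF Q]] unfolding sigma2_permutable_def pi_projector_iff by blast
  qed
  then show "\<exists>P. projector \<pi> P \<and> (\<forall>x\<in>carrier G. H <#> conjugate G P x = conjugate G P x <#> H)" using P by blast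
qed

end

theorem theorem3:
  fixes G :: "('a, 'b) monoid_scheme" and H :: "'a set" and \<sigma> :: "nat set set"
  assumes "partition_of_primes \<sigma>"
    and "group G" and "finite (carrier G)"
    and "subgroup H G" and "sigma_nilpotent \<sigma> (G\<lparr>carrier := H\<rparr>)"
  shows "(sigma1_permutable \<sigma> G H \<or> sigma2_permutable \<sigma> G H \<or> sigma3_permutable \<sigma> G H \<longrightarrow>
            sigma1_permutable \<sigma> G H \<and> sigma2_permutable \<sigma> G H \<and> sigma3_permutable \<sigma> G H) \<and>
         (sigma3_permutable \<sigma> G H \<longleftrightarrow>
            (\<forall>\<pi>\<in>\<sigma>. \<forall>A. hall_subgroup \<pi> (G\<lparr>carrier := H\<rparr>) A \<longrightarrow> sigma3_permutable \<sigma> G A))"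
proof -
  interpret finite_group G by (intro finite_group.intro finite_group_axioms.intro assms(2,3))
  obtain A where h: "hall_decomposition \<sigma> H A" and g: "generate G (\<Union>\<pi>\<in>\<sigma>. A \<pi>) = H"
    by (rule sigma_nilpotent_hall_decomposition[OF assms(4,5)])
  have down: "sigma1_permutable \<sigma> G (A \<pi>)" if "sigma3_permutable \<sigma> G H" "\<pi> \<in> \<sigma>" for \<pi>
    by (rule sigma3_imp_hall_part_sigma1[OF assms(1) h that])
  have s13: "sigma3_permutable \<sigma> G B" if "sigma1_permutable \<sigma> G B" for B
    using that sigma1_imp_sigma2 sigma2_imp_sigma3 by blast
  have s31: "sigma1_permutable \<sigma> G H" if "sigma3_permutable \<sigma> G H"
    by (rule sigma1_of_hall_parts[OF h g down[OF that]])
  \<comment> \<open>The Hall part \<open>A \<pi>\<close> takes the place of \<open>H\<close>.\<close>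
  have part_s1: "sigma1_permutable \<sigma> G (A \<pi>)" if "sigma3_permutable \<sigma> G (A \<pi>)" "\<pi> \<in> \<sigma>" for \<pi>
    using sigma3_imp_hall_part_sigma1[OF assms(1) hall_decomposition_pi_subgroup[OF assms(1) that(2)
          hall_decompositionD(2,5)[OF h that(2)]] that] by simp
  have hall: "hall_subgroup \<pi> (G\<lparr>carrier := H\<rparr>) (A \<pi>)" if "\<pi> \<in> \<sigma>" for \<pi>
    unfolding hall_subgroup_restrict_iff[OF assms(4)] using hall_decompositionD(2,3,5,6)[OF h that] by simp
  have "sigma3_permutable \<sigma> G H \<longleftrightarrow> (\<forall>\<pi>\<in>\<sigma>. sigma3_permutable \<sigma> G (A \<pi>))"
  proof
    assume "sigma3_permutable \<sigma> G H"
    then show "\<forall>\<pi>\<in>\<sigma>. sigma3_permutable \<sigma> G (A \<pi>)" using down s13 by simp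
  next
    assume "\<forall>\<pi>\<in>\<sigma>. sigma3_permutable \<sigma> G (A \<pi>)"
    then have "sigma1_permutable \<sigma> G H" using part_s1 by (intro sigma1_of_hall_parts[OF h g]) simp
    then show "sigma3_permutable \<sigma> G H" by (rule s13)
  qed
  also have "\<dots> \<longleftrightarrow> (\<forall>\<pi>\<in>\<sigma>. \<forall>B. hall_subgroup \<pi> (G\<lparr>carrier := H\<rparr>) B \<longrightarrow> sigma3_permutable \<sigma> G B)"
    using hall hall_subgroup_unique[OF h] by metis
  finally have "sigma3_permutable \<sigma> G H \<longleftrightarrow>
      (\<forall>\<pi>\<in>\<sigma>. \<forall>B. hall_subgroup \<pi> (G\<lparr>carrier := H\<rparr>) B \<longrightarrow> sigma3_permutable \<sigma> G B)"
    .
  then show ?thesis using s31 sigma1_imp_sigma2 sigma2_imp_sigma3 by blast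
qed

end
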